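(* Let $\mathbf{L}$ be a normed space. (i) Every retract of a well composed $\mathbf{L}$-space is metrically projective, and every near-retract of a well composed $\mathbf{L}$-space is extremely projective. (ii) If $\mathbf{L}$ is properly presented (relative to the family of all its finite-dimensional contractively complemented subspaces), then every metrically projective $\mathbf{L}$-space is a retract of some well composed $\mathbf{L}$-space, and every extremely projective $\mathbf{L}$-space is a near-retract of some well composed $\mathbf{L}$-space. (iii) If $\mathbf{L}$ is properly presented (relative to the family of all its finite-dimensional contractively complemented subspaces), then for every $\mathbf{L}$-space $E$ there exist a well composed $\mathbf{L}$-space $W$ and an $\mathbf{L}$-strictly coisometric operator from $W$ onto $E$.
   Context: All linear spaces are over a fixed scalar field ($\mathbb{R}$ or $\mathbb{C}$). Fix a normed space $\mathbf{L}$ (the base space); $\mathcal{B}(\mathbf{L})$ is the algebra of bounded operators on $\mathbf{L}$; $\otimes$ is the algebraic tensor product. For a linear space $E$, $\mathbf{L}\otimes E$ is a left $\mathcal{B}(\mathbf{L})$-module via $a\cdot(\xi\otimes x)=a\xi\otimes x$. An $\mathbf{L}$-norm on $E$ is a norm on $\mathbf{L}\otimes E$ with $\|a\cdot u\|\le\|a\|\|u\|$ for all $a\in\mathcal{B}(\mathbf{L})$, $u\in\mathbf{L}\otimes E$; an $\mathbf{L}$-space is a linear space endowed with an $\mathbf{L}$-norm. For a linear operator $\varphi:G\to E$ between $\mathbf{L}$-spaces put $\varphi_\infty:=\mathbf{1}_{\mathbf{L}}\otimes\varphi$; $\varphi$ is $\mathbf{L}$-bounded if $\varphi_\infty$ is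 bounded, with $\|\varphi\|_{\mathbf{L}b}:=\|\varphi_\infty\|$; $\mathbf{L}$-contractive if $\|\varphi\|_{\mathbf{L}b}\le1$; $\mathbf{L}$-strictly coisometric (respectively $\mathbf{L}$-coisometric) if $\varphi_\infty$ maps the closed (respectively open) unit ball of $\mathbf{L}\otimes G$ onto the closed (respectively open) unit ball of $\mathbf{L}\otimes E$. A lifting of $\varphi:P\to E$ across $\tau:G\to E$ is an operator $\psi:P\to G$ with $\tau\psi=\varphi$. An $\mathbf{L}$-space $P$ is metrically projective if for all $\mathbf{L}$-spaces $G,E$, every $\mathbf{L}$-strictly coisometric $\tau:G\to E$ and every $\mathbf{L}$-bounded $\varphi:P\to E$ there is a lifting $\psi$ of $\varphi$ across $\tau$ with $\|\psi\|_{\mathbf{L}b}=\|\varphi\|_{\mathbf{L}b}$. $P$ is extremely projective if for all $\mathbf{L}$-spaces $G,E$, every $\mathbf{L}$-coisometric $\tau:G\to E$, every $\mathbf{L}$-bounded $\varphi:P\to E$ and every $\varepsilon>0$ there is a lifting $\psi$ of $\varphi$ across $\tau$ with $\|\psi\|_{\mathbf{L}b}<\|\varphi\|_{\mathbf{L}b}+\varepsilon$. An $\mathbf{L}$-contractive operator is a retraction if it has an $\mathbf{L}$-contractive right inverse; it is a near-retraction if for every $\varepsilon>0$ it has an $\mathbf{L}$-bounded right inverse $\rho$ with $\|\rho\|_{\mathbf{L}b}<1+\varepsilon$. $E$ is a retract (near-retract) of $G$ if there is a retraction (near-retraction) from $G$ onto $E$. The $\oplus_1$-sum of $\mathbf{L}$-spaces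 $(E_i)_i$ is their algebraic direct sum $\oplus_iE_i$, where $\mathbf{L}\otimes(\oplus_iE_i)$ is identified with $\oplus_i(\mathbf{L}\otimes E_i)$ and normed by $\|(u_i)\|=\sum_i\|u_i\|$ (no completion). A subspace of $\mathbf{L}$ is contractively complemented if it is the range of a projection on $\mathbf{L}$ of norm at most $1$. For a finite-dimensional subspace $Z$ of $\mathbf{L}$, $\mathrm{MIN}(Z^* )$ is $Z^*$ with the minimal $\mathbf{L}$-norm, i.e. $\mathbf{L}\otimes Z^*$ carries the injective tensor norm. An $\mathbf{L}$-space is well composed if it is a $\oplus_1$-sum $\oplus_{\mu\in\mathcal{M}}\mathrm{MIN}(Z_\mu^* )$, where each $Z_\mu$ is a finite-dimensional contractively complemented subspace of $\mathbf{L}$ (possibly different for different $\mu$). $\mathbf{L}$ is properly presented relative to a family $(L^\nu)_{\nu\in\Lambda}$ of contractively complemented subspaces if for all $N\in\mathbb{N}$ and $f_1,\dots,f_N\in\mathbf{L}$ there is $\nu\in\Lambda$ with $f_1,\dots,f_N\in L^\nu$. *)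

theory Defs
  imports "HOL-Analysis.Analysis" "HOL-Library.Function_Algebras"
begin

section \<open>Scalars and the base space\<close>

text \<open>The scalar field is \<open>\<real>\<close> or the field of complex numbers, up to isometric isomorphism.\<close>

class real_or_complex = real_normed_field +
  assumes real_or_complex:
    "\<exists>h :: 'a \<Rightarrow> complex.
       (\<forall>x y. h (x + y) = h x + h y) \<and> (\<forall>x y. h (x * y) = h x * h y) \<and>
       (\<forall>x. norm (h x) = norm x) \<and> (range h = \<real> \<or> range h = UNIV)"

instance real :: real_or_complex
  by standard (rule exI[of _ complex_of_real], auto simp: Reals_def)

instance complex :: real_or_complex
  by standard (rule exI[of _ id], auto)

text \<open>The base space \<open>\<^bold>L\<close> is the whole type \<open>'l\<close>, with scalar multiplication \<open>sL\<close> over the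
  field \<open>'k\<close>; the type class supplies the norm and the underlying real structure.\<close>

locale normed_space_over = vector_space sL
  for sL :: "'k::real_or_complex \<Rightarrow> 'l::real_normed_vector \<Rightarrow> 'l" +
  assumes norm_smul: "norm (sL c \<xi>) = norm c * norm \<xi>"
    and smul_of_real: "sL (of_real r) \<xi> = r *\<^sub>R \<xi>"

definition bounded_op :: "('k::real_or_complex \<Rightarrow> 'l::real_normed_vector \<Rightarrow> 'l) \<Rightarrow> ('l \<Rightarrow> 'l) \<Rightarrow> bool" where
  "bounded_op sL a \<longleftrightarrow> Vector_Spaces.linear sL sL a \<and> bounded_linear a"

definition contractively_complemented ::
    "('k::real_or_complex \<Rightarrow> 'l::real_normed_vector \<Rightarrow> 'l) \<Rightarrow> 'l set \<Rightarrow> bool" where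
  "contractively_complemented sL Z \<longleftrightarrow>
     (\<exists>p. bounded_op sL p \<and> p \<circ> p = p \<and> onorm p \<le> 1 \<and> range p = Z)"

definition fin_dim :: "('k::real_or_complex \<Rightarrow> 'l::real_normed_vector \<Rightarrow> 'l) \<Rightarrow> 'l set \<Rightarrow> bool" where
  "fin_dim sL Z \<longleftrightarrow> (\<exists>S. finite S \<and> Z = module.span sL S)"

definition properly_presented ::
    "('k::real_or_complex \<Rightarrow> 'l::real_normed_vector \<Rightarrow> 'l) \<Rightarrow> 'l set set \<Rightarrow> bool" where
  "properly_presented sL \<Lambda> \<longleftrightarrow>
     (\<forall>Z\<in>\<Lambda>. contractively_complemented sL Z) \<and>
     (\<forall>A. finite A \<longrightarrow> (\<exists>Z\<in>\<Lambda>. A \<subseteq> Z))"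


section \<open>Linear spaces and normed spaces\<close>

text \<open>A linear space is a subspace \<open>carr E\<close> of an ambient vector space type \<open>'e\<close>. Carriers make it
  possible to quantify over all spaces inside a given type; maps matter only on carriers.\<close>

record ('k, 'e) linsp =
  carr :: "'e set"
  smul :: "'k \<Rightarrow> 'e \<Rightarrow> 'e"

record ('k, 'e) nsp = "('k, 'e) linsp" +
  nrm :: "'e \<Rightarrow> real"

definition linear_space :: "('k::real_or_complex, 'e::ab_group_add, 'z) linsp_scheme \<Rightarrow> bool" where
  "linear_space E \<longleftrightarrow> vector_space (smul E) \<and> module.subspace (smul E) (carr E)"

definition lin_on :: "('k, 'e::plus, 'z) linsp_scheme \<Rightarrow> ('k \<Rightarrow> 'b \<Rightarrow> 'b) \<Rightarrow> ('e \<Rightarrow> 'b::plus) \<Rightarrow> bool" where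
  "lin_on E s f \<longleftrightarrow>
     (\<forall>x\<in>carr E. \<forall>y\<in>carr E. f (x + y) = f x + f y) \<and>
     (\<forall>c. \<forall>x\<in>carr E. f (smul E c x) = s c (f x))"

definition lin_op :: "('k, 'e::plus, 'z) linsp_scheme \<Rightarrow> ('k, 'f::plus, 'y) linsp_scheme \<Rightarrow> ('e \<Rightarrow> 'f) \<Rightarrow> bool" where
  "lin_op G E \<phi> \<longleftrightarrow> lin_on G (smul E) \<phi> \<and> \<phi> ` carr G \<subseteq> carr E"

definition sub_nsp :: "('k \<Rightarrow> 'l \<Rightarrow> 'l) \<Rightarrow> 'l::real_normed_vector set \<Rightarrow> ('k, 'l) nsp" where
  "sub_nsp sL Z = \<lparr>carr = Z, smul = sL, nrm = norm\<rparr>"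

definition pscale :: "'k::times \<Rightarrow> ('a \<Rightarrow> 'k) \<Rightarrow> 'a \<Rightarrow> 'k" where
  "pscale c u = (\<lambda>b. c * u b)"

definition unit_ball :: "('k, 'e) nsp \<Rightarrow> 'e set" where
  "unit_ball F = {x \<in> carr F. nrm F x \<le> 1}"

text \<open>The Banach dual; functionals are normalised to vanish off the carrier.\<close>

definition dual :: "('k::real_or_complex, 'e::ab_group_add) nsp \<Rightarrow> ('k, 'e \<Rightarrow> 'k) nsp" where
  "dual F = \<lparr>carr = {f. lin_on F (*) f \<and> (\<exists>C. \<forall>x\<in>carr F. norm (f x) \<le> C * nrm F x) \<and>
                        (\<forall>x. x \<notin> carr F \<longrightarrow> f x = 0)},
             smul = pscale,
             nrm = (\<lambda>f. SUP x\<in>unit_ball F. norm (f x))\<rparr>"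


section \<open>The algebraic tensor product with the base space\<close>

text \<open>\<open>\<^bold>L \<otimes> E\<close> is realised in the dual of the space of bilinear forms on \<open>\<^bold>L \<times> E\<close>: the elementary
  tensor \<open>\<xi> \<otimes> x\<close> is evaluation at \<open>(\<xi>, x)\<close>, and \<open>\<^bold>L \<otimes> E\<close> is the span of the elementary tensors.
  Functions that are not bilinear forms on \<open>\<^bold>L \<times> E\<close> are sent to 0. The lemmas
  \<open>etensor_independent\<close>, \<open>act_etensor\<close> and \<open>amplify_etensor\<close> below confirm that this is the
  usual tensor product with the usual operators \<open>a \<otimes> 1\<close> and \<open>1 \<otimes> \<phi>\<close>.\<close>

type_synonym ('k, 'e, 'l) tensor = "('l \<Rightarrow> 'e \<Rightarrow> 'k) \<Rightarrow> 'k"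

definition bilin :: "('k::real_or_complex \<Rightarrow> 'l::real_normed_vector \<Rightarrow> 'l) \<Rightarrow>
    ('k, 'e::ab_group_add, 'z) linsp_scheme \<Rightarrow> ('l \<Rightarrow> 'e \<Rightarrow> 'k) set" where
  "bilin sL E = {B. (\<forall>x\<in>carr E. Vector_Spaces.linear sL (*) (\<lambda>\<xi>. B \<xi> x)) \<and> (\<forall>\<xi>. lin_on E (*) (B \<xi>))}"

definition etensor :: "('k::real_or_complex \<Rightarrow> 'l::real_normed_vector \<Rightarrow> 'l) \<Rightarrow>
    ('k, 'e::ab_group_add, 'z) linsp_scheme \<Rightarrow> 'l \<Rightarrow> 'e \<Rightarrow> ('k, 'e, 'l) tensor" where
  "etensor sL E \<xi> x = (\<lambda>B. if B \<in> bilin sL E then B \<xi> x else 0)"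

definition ltensor :: "('k::real_or_complex \<Rightarrow> 'l::real_normed_vector \<Rightarrow> 'l) \<Rightarrow>
    ('k, 'e::ab_group_add, 'z) linsp_scheme \<Rightarrow> ('k, 'e, 'l) tensor set" where
  "ltensor sL E = module.span pscale {etensor sL E \<xi> x | \<xi> x. x \<in> carr E}"

text \<open>\<open>act sL E a u\<close> is \<open>a \<cdot> u\<close>, the value at \<open>u\<close> of \<open>a \<otimes> 1\<close> on \<open>\<^bold>L \<otimes> E\<close>.\<close>

definition act :: "('k::real_or_complex \<Rightarrow> 'l::real_normed_vector \<Rightarrow> 'l) \<Rightarrow>
    ('k, 'e::ab_group_add, 'z) linsp_scheme \<Rightarrow> ('l \<Rightarrow> 'l) \<Rightarrow> ('k, 'e, 'l) tensor \<Rightarrow> ('k, 'e, 'l) tensor" where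
  "act sL E a u = (\<lambda>B. if B \<in> bilin sL E then u (\<lambda>\<xi> x. B (a \<xi>) x) else 0)"

text \<open>\<open>amplify sL E \<phi>\<close> is \<open>\<phi>\<^sub>\<infinity> = 1 \<otimes> \<phi>\<close>, where \<open>E\<close> is the codomain of \<open>\<phi>\<close>.\<close>

definition amplify :: "('k::real_or_complex \<Rightarrow> 'l::real_normed_vector \<Rightarrow> 'l) \<Rightarrow>
    ('k, 'e::ab_group_add, 'z) linsp_scheme \<Rightarrow> ('g \<Rightarrow> 'e) \<Rightarrow> ('k, 'g, 'l) tensor \<Rightarrow> ('k, 'e, 'l) tensor" where
  "amplify sL E \<phi> u = (\<lambda>B. if B \<in> bilin sL E then u (\<lambda>\<xi> x. B \<xi> (\<phi> x)) else 0)"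


section \<open>\<open>\<^bold>L\<close>-spaces and their operators\<close>

record ('k, 'e, 'l) lsp = "('k, 'e) linsp" +
  lnorm :: "('k, 'e, 'l) tensor \<Rightarrow> real"

definition L_space :: "('k::real_or_complex \<Rightarrow> 'l::real_normed_vector \<Rightarrow> 'l) \<Rightarrow>
    ('k, 'e::ab_group_add, 'l) lsp \<Rightarrow> bool" where
  "L_space sL E \<longleftrightarrow> linear_space E \<and>
     (\<forall>u\<in>ltensor sL E. lnorm E u \<ge> 0) \<and>
     (\<forall>u\<in>ltensor sL E. lnorm E u = 0 \<longleftrightarrow> u = 0) \<and>
     (\<forall>c. \<forall>u\<in>ltensor sL E. lnorm E (pscale c u) = norm c * lnorm E u) \<and>
     (\<forall>u\<in>ltensor sL E. \<forall>v\<in>ltensor sL E. lnorm E (u + v) \<le> lnorm E u + lnorm E v) \<and>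
     (\<forall>a. bounded_op sL a \<longrightarrow>
        (\<forall>u\<in>ltensor sL E. lnorm E (act sL E a u) \<le> onorm a * lnorm E u))"

definition L_bounded :: "('k::real_or_complex \<Rightarrow> 'l::real_normed_vector \<Rightarrow> 'l) \<Rightarrow>
    ('k, 'g::ab_group_add, 'l) lsp \<Rightarrow> ('k, 'e::ab_group_add, 'l) lsp \<Rightarrow> ('g \<Rightarrow> 'e) \<Rightarrow> bool" where
  "L_bounded sL G E \<phi> \<longleftrightarrow> lin_op G E \<phi> \<and>
     (\<exists>C. \<forall>u\<in>ltensor sL G. lnorm E (amplify sL E \<phi> u) \<le> C * lnorm G u)"

definition L_ball :: "('k::real_or_complex \<Rightarrow> 'l::real_normed_vector \<Rightarrow> 'l) \<Rightarrow>
    ('k, 'e::ab_group_add, 'l) lsp \<Rightarrow> ('k, 'e, 'l) tensor set" where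
  "L_ball sL E = {u \<in> ltensor sL E. lnorm E u < 1}"

definition L_cball :: "('k::real_or_complex \<Rightarrow> 'l::real_normed_vector \<Rightarrow> 'l) \<Rightarrow>
    ('k, 'e::ab_group_add, 'l) lsp \<Rightarrow> ('k, 'e, 'l) tensor set" where
  "L_cball sL E = {u \<in> ltensor sL E. lnorm E u \<le> 1}"

definition Lb_norm :: "('k::real_or_complex \<Rightarrow> 'l::real_normed_vector \<Rightarrow> 'l) \<Rightarrow>
    ('k, 'g::ab_group_add, 'l) lsp \<Rightarrow> ('k, 'e::ab_group_add, 'l) lsp \<Rightarrow> ('g \<Rightarrow> 'e) \<Rightarrow> real" where
  "Lb_norm sL G E \<phi> = (SUP u\<in>L_cball sL G. lnorm E (amplify sL E \<phi> u))"

definition L_contractive :: "('k::real_or_complex \<Rightarrow> 'l::real_normed_vector \<Rightarrow> 'l) \<Rightarrow>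
    ('k, 'g::ab_group_add, 'l) lsp \<Rightarrow> ('k, 'e::ab_group_add, 'l) lsp \<Rightarrow> ('g \<Rightarrow> 'e) \<Rightarrow> bool" where
  "L_contractive sL G E \<phi> \<longleftrightarrow> L_bounded sL G E \<phi> \<and> Lb_norm sL G E \<phi> \<le> 1"

definition L_strictly_coisometric :: "('k::real_or_complex \<Rightarrow> 'l::real_normed_vector \<Rightarrow> 'l) \<Rightarrow>
    ('k, 'g::ab_group_add, 'l) lsp \<Rightarrow> ('k, 'e::ab_group_add, 'l) lsp \<Rightarrow> ('g \<Rightarrow> 'e) \<Rightarrow> bool" where
  "L_strictly_coisometric sL G E \<tau> \<longleftrightarrow> lin_op G E \<tau> \<and> amplify sL E \<tau> ` L_cball sL G = L_cball sL E"

definition L_coisometric :: "('k::real_or_complex \<Rightarrow> 'l::real_normed_vector \<Rightarrow> 'l) \<Rightarrow>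
    ('k, 'g::ab_group_add, 'l) lsp \<Rightarrow> ('k, 'e::ab_group_add, 'l) lsp \<Rightarrow> ('g \<Rightarrow> 'e) \<Rightarrow> bool" where
  "L_coisometric sL G E \<tau> \<longleftrightarrow> lin_op G E \<tau> \<and> amplify sL E \<tau> ` L_ball sL G = L_ball sL E"

definition lifting :: "('k, 'p, 'z) linsp_scheme \<Rightarrow> ('g \<Rightarrow> 'e) \<Rightarrow> ('p \<Rightarrow> 'e) \<Rightarrow> ('p \<Rightarrow> 'g) \<Rightarrow> bool" where
  "lifting P \<tau> \<phi> \<psi> \<longleftrightarrow> (\<forall>x\<in>carr P. \<tau> (\<psi> x) = \<phi> x)"

text \<open>HOL cannot quantify over types inside a formula, so projectivity is relative to the types
  \<open>'g\<close> and \<open>'e\<close> in which the test spaces \<open>G\<close> and \<open>E\<close> live.\<close>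

definition metrically_projective :: "'g::ab_group_add itself \<Rightarrow> 'e::ab_group_add itself \<Rightarrow>
    ('k::real_or_complex \<Rightarrow> 'l::real_normed_vector \<Rightarrow> 'l) \<Rightarrow> ('k, 'p::ab_group_add, 'l) lsp \<Rightarrow> bool" where
  "metrically_projective _ _ sL P \<longleftrightarrow> L_space sL P \<and>
     (\<forall>(G :: ('k, 'g, 'l) lsp) (E :: ('k, 'e, 'l) lsp) \<tau> \<phi>.
        L_space sL G \<and> L_space sL E \<and> L_strictly_coisometric sL G E \<tau> \<and> L_bounded sL P E \<phi> \<longrightarrow>
        (\<exists>\<psi>. L_bounded sL P G \<psi> \<and> lifting P \<tau> \<phi> \<psi> \<and> Lb_norm sL P G \<psi> = Lb_norm sL P E \<phi>))"

definition extremely_projective :: "'g::ab_group_add itself \<Rightarrow> 'e::ab_group_add itself \<Rightarrow>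
    ('k::real_or_complex \<Rightarrow> 'l::real_normed_vector \<Rightarrow> 'l) \<Rightarrow> ('k, 'p::ab_group_add, 'l) lsp \<Rightarrow> bool" where
  "extremely_projective _ _ sL P \<longleftrightarrow> L_space sL P \<and>
     (\<forall>(G :: ('k, 'g, 'l) lsp) (E :: ('k, 'e, 'l) lsp) \<tau> \<phi> \<epsilon>.
        L_space sL G \<and> L_space sL E \<and> L_coisometric sL G E \<tau> \<and> L_bounded sL P E \<phi> \<and> \<epsilon> > 0 \<longrightarrow>
        (\<exists>\<psi>. L_bounded sL P G \<psi> \<and> lifting P \<tau> \<phi> \<psi> \<and> Lb_norm sL P G \<psi> < Lb_norm sL P E \<phi> + \<epsilon>))"

definition right_inverse :: "('k, 'e, 'z) linsp_scheme \<Rightarrow> ('g \<Rightarrow> 'e) \<Rightarrow> ('e \<Rightarrow> 'g) \<Rightarrow> bool" where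
  "right_inverse E \<sigma> \<rho> \<longleftrightarrow> (\<forall>x\<in>carr E. \<sigma> (\<rho> x) = x)"

definition retraction_op :: "('k::real_or_complex \<Rightarrow> 'l::real_normed_vector \<Rightarrow> 'l) \<Rightarrow>
    ('k, 'g::ab_group_add, 'l) lsp \<Rightarrow> ('k, 'e::ab_group_add, 'l) lsp \<Rightarrow> ('g \<Rightarrow> 'e) \<Rightarrow> bool" where
  "retraction_op sL G E \<sigma> \<longleftrightarrow> L_contractive sL G E \<sigma> \<and>
     (\<exists>\<rho>. L_contractive sL E G \<rho> \<and> right_inverse E \<sigma> \<rho>)"

definition near_retraction_op :: "('k::real_or_complex \<Rightarrow> 'l::real_normed_vector \<Rightarrow> 'l) \<Rightarrow>
    ('k, 'g::ab_group_add, 'l) lsp \<Rightarrow> ('k, 'e::ab_group_add, 'l) lsp \<Rightarrow> ('g \<Rightarrow> 'e) \<Rightarrow> bool" where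
  "near_retraction_op sL G E \<sigma> \<longleftrightarrow> L_contractive sL G E \<sigma> \<and>
     (\<forall>\<epsilon>>0. \<exists>\<rho>. L_bounded sL E G \<rho> \<and> right_inverse E \<sigma> \<rho> \<and> Lb_norm sL E G \<rho> < 1 + \<epsilon>)"

definition L_retract_of :: "('k::real_or_complex \<Rightarrow> 'l::real_normed_vector \<Rightarrow> 'l) \<Rightarrow>
    ('k, 'e::ab_group_add, 'l) lsp \<Rightarrow> ('k, 'g::ab_group_add, 'l) lsp \<Rightarrow> bool" where
  "L_retract_of sL E G \<longleftrightarrow> (\<exists>\<sigma>. retraction_op sL G E \<sigma>)"

definition L_near_retract_of :: "('k::real_or_complex \<Rightarrow> 'l::real_normed_vector \<Rightarrow> 'l) \<Rightarrow>
    ('k, 'e::ab_group_add, 'l) lsp \<Rightarrow> ('k, 'g::ab_group_add, 'l) lsp \<Rightarrow> bool" where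
  "L_near_retract_of sL E G \<longleftrightarrow> (\<exists>\<sigma>. near_retraction_op sL G E \<sigma>)"


section \<open>Well composed spaces\<close>

text \<open>For \<open>u = \<Sum>\<^sub>k \<xi>\<^sub>k \<otimes> x\<^sub>k\<close> the number \<open>u (\<lambda>\<xi> x. f \<xi> * g x)\<close> is \<open>\<Sum>\<^sub>k f(\<xi>\<^sub>k) g(x\<^sub>k) = (f \<otimes> g)(u)\<close>.\<close>

definition inj_norm :: "('k::real_or_complex \<Rightarrow> 'l::real_normed_vector \<Rightarrow> 'l) \<Rightarrow>
    ('k, 'e::ab_group_add) nsp \<Rightarrow> ('k, 'e, 'l) tensor \<Rightarrow> real" where
  "inj_norm sL F u =
     (SUP (f, g) \<in> unit_ball (dual (sub_nsp sL UNIV)) \<times> unit_ball (dual F).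
        norm (u (\<lambda>\<xi> x. f \<xi> * g x)))"

definition MIN_space :: "('k::real_or_complex \<Rightarrow> 'l::real_normed_vector \<Rightarrow> 'l) \<Rightarrow>
    ('k, 'e::ab_group_add) nsp \<Rightarrow> ('k, 'e, 'l) lsp" where
  "MIN_space sL F = \<lparr>carr = carr F, smul = smul F, lnorm = inj_norm sL F\<rparr>"

text \<open>The algebraic direct sum over the index set \<open>M\<close> consists of the finitely supported families
  (zero off \<open>M\<close>). The component of \<open>u \<in> \<^bold>L \<otimes> (\<Oplus>\<^sub>\<mu> E\<^sub>\<mu>)\<close> in \<open>\<^bold>L \<otimes> E\<^sub>\<mu>\<close> is its image under
  \<open>1 \<otimes> \<pi>\<^sub>\<mu>\<close> for the coordinate projection \<open>\<pi>\<^sub>\<mu>\<close>; only finitely many components are nonzero.\<close>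

definition oplus1 :: "('k::real_or_complex \<Rightarrow> 'l::real_normed_vector \<Rightarrow> 'l) \<Rightarrow> 'i set \<Rightarrow>
    ('i \<Rightarrow> ('k, 'e::ab_group_add, 'l) lsp) \<Rightarrow> ('k, 'i \<Rightarrow> 'e, 'l) lsp" where
  "oplus1 sL M E =
     \<lparr>carr = {x. (\<forall>\<mu>\<in>M. x \<mu> \<in> carr (E \<mu>)) \<and> (\<forall>\<mu>. \<mu> \<notin> M \<longrightarrow> x \<mu> = 0) \<and> finite {\<mu>. x \<mu> \<noteq> 0}},
      smul = (\<lambda>c x \<mu>. smul (E \<mu>) c (x \<mu>)),
      lnorm = (\<lambda>u. \<Sum>\<mu> | \<mu> \<in> M \<and> amplify sL (E \<mu>) (\<lambda>x. x \<mu>) u \<noteq> 0.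
                      lnorm (E \<mu>) (amplify sL (E \<mu>) (\<lambda>x. x \<mu>) u))\<rparr>"

definition well_composed :: "('k::real_or_complex \<Rightarrow> 'l::real_normed_vector \<Rightarrow> 'l) \<Rightarrow>
    ('k, 'i \<Rightarrow> 'l \<Rightarrow> 'k, 'l) lsp \<Rightarrow> bool" where
  "well_composed sL W \<longleftrightarrow>
     (\<exists>M Z. (\<forall>\<mu>\<in>M. fin_dim sL (Z \<mu>) \<and> contractively_complemented sL (Z \<mu>)) \<and>
            W = oplus1 sL M (\<lambda>\<mu>. MIN_space sL (dual (sub_nsp sL (Z \<mu>)))))"


section \<open>The model of the tensor product is correct\<close>

lemma act_etensor:
  assumes "Vector_Spaces.linear sL sL a" "x \<in> carr E"
  shows "act sL E a (etensor sL E \<xi> x) = etensor sL E (a \<xi>) x"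
proof -
  interpret a: Vector_Spaces.linear sL sL a by fact
  have "(\<lambda>\<xi> x. B (a \<xi>) x) \<in> bilin sL E" if B: "B \<in> bilin sL E" for B
  proof -
    have "Vector_Spaces.linear sL (*) ((\<lambda>\<xi>. B \<xi> y) \<circ> a)" if "y \<in> carr E" for y
      using B that by (intro Vector_Spaces.linear_compose[OF assms(1)]) (auto simp: bilin_def)
    then show ?thesis using B by (auto simp: bilin_def o_def)
  qed
  then show ?thesis by (auto simp: act_def etensor_def fun_eq_iff)
qed

lemma amplify_etensor:
  assumes "lin_op G E \<phi>" "x \<in> carr G"
  shows "amplify sL E \<phi> (etensor sL G \<xi> x) = etensor sL E \<xi> (\<phi> x)"
proof -
  have "(\<lambda>\<xi> x. B \<xi> (\<phi> x)) \<in> bilin sL G" if "B \<in> bilin sL E" for B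
    using that assms(1) unfolding bilin_def lin_op_def lin_on_def by (auto simp: image_subset_iff)
  then show ?thesis by (auto simp: amplify_def etensor_def fun_eq_iff)
qed

lemma etensor_bilinear:
  assumes "x \<in> carr E" "y \<in> carr E"
  shows "etensor sL E (\<xi> + \<eta>) x = etensor sL E \<xi> x + etensor sL E \<eta> x"
    and "etensor sL E \<xi> (x + y) = etensor sL E \<xi> x + etensor sL E \<xi> y"
    and "etensor sL E (sL c \<xi>) x = pscale c (etensor sL E \<xi> x)"
    and "etensor sL E \<xi> (smul E c x) = pscale c (etensor sL E \<xi> x)"
proof -
  have B: "B (\<xi> + \<eta>) x = B \<xi> x + B \<eta> x" "B (sL c \<xi>) x = c * B \<xi> x"
    "B \<xi> (x + y) = B \<xi> x + B \<xi> y" "B \<xi> (smul E c x) = c * B \<xi> x"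
    if "B \<in> bilin sL E" for B
  proof -
    have "Vector_Spaces.linear sL (*) (\<lambda>\<xi>. B \<xi> x)" and l: "lin_on E (*) (B \<xi>)"
      using that assms(1) by (simp_all add: bilin_def)
    then interpret B: Vector_Spaces.linear sL "(*)" "\<lambda>\<xi>. B \<xi> x" by simp
    show "B (\<xi> + \<eta>) x = B \<xi> x + B \<eta> x" "B (sL c \<xi>) x = c * B \<xi> x" by (rule B.add, rule B.scale)
    show "B \<xi> (x + y) = B \<xi> x + B \<xi> y" "B \<xi> (smul E c x) = c * B \<xi> x"
      using l assms by (simp_all add: lin_on_def)
  qed
  show "etensor sL E (\<xi> + \<eta>) x = etensor sL E \<xi> x + etensor sL E \<eta> x"
    "etensor sL E \<xi> (x + y) = etensor sL E \<xi> x + etensor sL E \<xi> y"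
    "etensor sL E (sL c \<xi>) x = pscale c (etensor sL E \<xi> x)"
    "etensor sL E \<xi> (smul E c x) = pscale c (etensor sL E \<xi> x)"
    by (rule ext, simp add: etensor_def pscale_def B)+
qed

lemma etensor_independent:
  assumes L: "vector_space sL" and E: "linear_space E"
    and S: "finite S" "S \<subseteq> carr E" "\<not> module.dependent (smul E) S"
    and zero: "(\<Sum>x\<in>S. etensor sL E (\<xi> x) x) = 0" and y: "y \<in> S"
  shows "\<xi> y = 0"
proof (rule ccontr)
  assume ne: "\<xi> y \<noteq> 0"
  have K: "vector_space ((*) :: 'a \<Rightarrow> 'a \<Rightarrow> 'a)" by unfold_locales (auto simp: algebra_simps)
  interpret L: vector_space_pair sL "(*)" using L K by (simp add: vector_space_pair_def)
  interpret E: vector_space_pair "smul E" "(*)"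
    using E K by (simp add: vector_space_pair_def linear_space_def)
  have "L.vs1.independent {\<xi> y}" using ne by simp
  from L.linear_independent_extend[OF this, of "\<lambda>_. 1"] obtain f
    where f: "Vector_Spaces.linear sL (*) f" "f (\<xi> y) = 1" by auto
  from E.linear_independent_extend[OF S(3), of "\<lambda>x. if x = y then 1 else 0"] obtain g
    where g: "Vector_Spaces.linear (smul E) (*) g" "\<forall>x\<in>S. g x = (if x = y then 1 else 0)" by auto
  interpret f: Vector_Spaces.linear sL "(*)" f by fact
  interpret g: Vector_Spaces.linear "smul E" "(*)" g by fact
  define B where "B = (\<lambda>\<eta> x. f \<eta> * g x)"
  have "Vector_Spaces.linear sL (*) (\<lambda>\<eta>. g x * f \<eta>)" for x
    by (rule L.linear_compose_scale_right[OF f(1)])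
  then have B: "B \<in> bilin sL E"
    unfolding bilin_def lin_on_def B_def by (auto simp: g.add g.scale algebra_simps)
  have "0 = (\<Sum>x\<in>S. etensor sL E (\<xi> x) x) B" using zero by simp
  also have "\<dots> = (\<Sum>x\<in>S. etensor sL E (\<xi> x) x B)"
    using S(1) by (rule finite_induct) auto
  also have "\<dots> = (\<Sum>x\<in>S. B (\<xi> x) x)" using B by (simp add: etensor_def)
  also have "\<dots> = (\<Sum>x\<in>S. if x = y then f (\<xi> x) else 0)"
    by (rule sum.cong) (auto simp: B_def g(2))
  also have "\<dots> = 1" using S(1) y f(2) by simp
  finally show False by simp
qed

end

theory Submission
  imports Defs
begin

text \<open>For a finite-dimensional contractively complemented subspace \<open>Z\<close> of the base space,
  \<open>\<^bold>L \<otimes> Z\<^sup>*\<close> contains a canonical tensor \<open>w\<close> of injective norm at most 1, the inclusion of \<open>Z\<close>.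
  By Hahn--Banach every \<open>v \<in> \<^bold>L \<otimes> MIN(Z\<^sup>*)\<close> is \<open>a \<cdot> w\<close> with \<open>\<parallel>a\<parallel> \<le> \<parallel>v\<parallel>\<close>, so an operator
  \<open>\<phi>\<close> from \<open>MIN(Z\<^sup>*)\<close> to an \<open>\<^bold>L\<close>-space \<open>E\<close> is determined by \<open>\<phi>\<^sub>\<infinity>(w)\<close> and has the norm of that
  tensor; the tensors that arise are those fixed by the projection \<open>p\<close> onto \<open>Z\<close>. Hence lifting an operator
  amounts to lifting one tensor and cutting it down by \<open>p\<close>, and \<open>\<oplus>\<^sub>1\<close>-sums are handled
  summand by summand. If \<open>\<^bold>L\<close> is properly presented, each tensor of the unit ball of \<open>\<^bold>L \<otimes> E\<close> is
  fixed by some such \<open>p\<close>, and the \<open>\<oplus>\<^sub>1\<close>-sum of the corresponding operators covers \<open>E\<close>; for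
  projective \<open>E\<close> one lifts the identity.\<close>

section \<open>Hahn--Banach\<close>

text \<open>Finite dimension of \<open>Z\<close> turns its inclusion into a finite-rank operator,
  hence into a tensor \<open>w\<close>. The injective norm is small enough to make \<open>w\<close>
  contractive and large enough to control operators: pairing a \<cdot> w with f \<otimes>
  (evaluation at p \<xi>) gives f (a (p \<xi>)), and a norming f recovers the norm of this vector.
  The contractive projection has two uses: it extends functionals from \<open>Z\<close> to the base
  space without loss of norm, and it cuts tensors down without loss. The cut is harmless for
  liftings because the action of bounded operators commutes with amplification: if v lifts u, then p
  \<cdot> v lifts p \<cdot> u, which is u itself for the tensors in question. Strictly coisometric
  and coisometric operators differ only in the constant with which tensors lift, 1 or 1 + \<delta>,
  so a single lifting lemma with a constant \<open>K\<close> serves both notions of projectivity. In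
  the cover every tensor of the closed unit ball is its own index and is attained exactly; hence the
  index type of tensors, and hence the same cover is coisometric in both senses.\<close>

definition sublinear :: "('a::real_vector \<Rightarrow> real) \<Rightarrow> bool" where
  "sublinear p \<longleftrightarrow> (\<forall>x y. p (x + y) \<le> p x + p y) \<and> (\<forall>t>0. \<forall>x. p (t *\<^sub>R x) \<le> t * p x)"

lemma sublinear_0: "sublinear p \<Longrightarrow> p 0 = 0"
proof -
  assume p: "sublinear p"
  have "p (2 *\<^sub>R 0) \<le> 2 * p 0" "p ((1/2) *\<^sub>R 0) \<le> (1/2) * p 0"
    using p unfolding sublinear_def by (metis zero_less_numeral, metis half_gt_zero_iff zero_less_one)
  then show ?thesis by simp
qed

lemma sublinear_minus: "sublinear p \<Longrightarrow> - p (- x) \<le> p x"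
  using sublinear_0[of p] unfolding sublinear_def by (metis add.right_inverse add.commute diff_ge_0_iff_ge diff_minus_eq_add)

text \<open>The infimum over t \<ge> 0 of \<open>p (x + t *\<^sub>R y) - t * p y\<close> is the
  largest decrease of \<open>p\<close> in the direction of \<open>y\<close> that keeps it sublinear
  enough to stay finite; t = 1 gives the value at \<open>- y\<close>. A minimal sublinear function
  admits no such decrease, so it is odd.\<close>

lemma sublinear_lower_at:
  assumes p: "sublinear p"
  shows "\<exists>q. sublinear q \<and> q \<le> p \<and> q (- y) \<le> - p y"
proof -
  have add: "p (x + z) \<le> p x + p z" for x z using p by (auto simp: sublinear_def)
  have scale: "p (t *\<^sub>R x) \<le> t * p x" if "t > 0" for t x using p that by (auto simp: sublinear_def)
  define r where "r x t = p (x + t *\<^sub>R y) - t * p y" for x t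
  define q where "q x = (INF t\<in>{0..}. r x t)" for x
  have ge: "- p (- x) \<le> r x t" if "t \<ge> 0" for x t
  proof (cases "t = 0")
    case False
    have "p y \<le> p ((1/t) *\<^sub>R (t *\<^sub>R y))" using False by simp
    also have "\<dots> \<le> (1/t) * p (t *\<^sub>R y)" using False that by (intro scale) auto
    finally have "t * p y \<le> p (t *\<^sub>R y)" using False that by (simp add: field_simps)
    also have "\<dots> \<le> p (x + t *\<^sub>R y) + p (- x)" using add[of "x + t *\<^sub>R y" "- x"] by simp
    finally show ?thesis by (simp add: r_def)
  qed (use sublinear_minus[OF p] in \<open>simp add: r_def\<close>)
  have bdd: "bdd_below (r x ` {0..})" for x using ge by (auto intro!: bdd_belowI)
  have le: "q x \<le> r x t" if "t \<ge> 0" for x t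
    unfolding q_def using bdd that by (intro cINF_lower) auto
  have gr: "c \<le> q x" if "\<And>t. t \<ge> 0 \<Longrightarrow> c \<le> r x t" for c x
    unfolding q_def using that by (intro cINF_greatest) auto
  have sub: "q (x + z) \<le> q x + q z" for x z
  proof -
    have *: "q (x + z) \<le> r x t + r z s" if "t \<ge> 0" "s \<ge> 0" for t s
    proof -
      have "q (x + z) \<le> r (x + z) (t + s)" using that by (intro le) auto
      also have "\<dots> \<le> r x t + r z s"
        using add[of "x + t *\<^sub>R y" "z + s *\<^sub>R y"] by (simp add: r_def algebra_simps)
      finally show ?thesis .
    qed
    have "q (x + z) - r x t \<le> q z" if "t \<ge> 0" for t using *[OF that] by (intro gr) (simp add: algebra_simps)
    then have "q (x + z) - q z \<le> q x" by (intro gr) (simp add: algebra_simps)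
    then show ?thesis by simp
  qed
  have sc: "q (c *\<^sub>R x) \<le> c * q x" if c: "c > 0" for c x
  proof -
    have "q (c *\<^sub>R x) / c \<le> r x t" if "t \<ge> 0" for t
    proof -
      have "q (c *\<^sub>R x) \<le> r (c *\<^sub>R x) (c * t)" using that c by (intro le) auto
      also have "\<dots> \<le> c * r x t"
        using scale[OF c, of "x + t *\<^sub>R y"] by (simp add: r_def algebra_simps)
      finally show ?thesis using c by (simp add: field_simps)
    qed
    then have "q (c *\<^sub>R x) / c \<le> q x" by (rule gr)
    then show ?thesis using c by (simp add: field_simps)
  qed
  have "q x \<le> p x" for x using le[of 0 x] by (simp add: r_def)
  moreover have "q (- y) \<le> - p y" using le[of 1 "- y"] sublinear_0[OF p] by (simp add: r_def)
  ultimately show ?thesis using sub sc by (intro exI[of _ q]) (auto simp: sublinear_def le_fun_def)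
qed

text \<open>The pointwise infimum works: subadditivity mixes two members of the chain, and the
  smaller of them handles both terms. The common upper bound \<open>b\<close> keeps the infimum
  finite, since p x \<ge> - p (- x) \<ge> - b (- x).\<close>

lemma sublinear_chain_Inf:
  assumes C: "C \<noteq> {}" "\<And>p. p \<in> C \<Longrightarrow> sublinear p"
    and chain: "\<And>p q. p \<in> C \<Longrightarrow> q \<in> C \<Longrightarrow> p \<le> q \<or> q \<le> p"
    and bdd: "\<And>p x. p \<in> C \<Longrightarrow> p x \<le> b x"
  shows "\<exists>q. sublinear q \<and> (\<forall>p\<in>C. q \<le> p)"
proof -
  define q where "q x = (INF p\<in>C. p x)" for x
  have "bdd_below ((\<lambda>p. p x) ` C)" for x
  proof (rule bdd_belowI2)
    fix p assume "p \<in> C"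
    then show "- b (- x) \<le> p x" using sublinear_minus[of p x] C(2) bdd[of p "- x"] by fastforce
  qed
  then have le: "q x \<le> p x" if "p \<in> C" for x p unfolding q_def using that by (intro cINF_lower) auto
  have gr: "c \<le> q x" if "\<And>p. p \<in> C \<Longrightarrow> c \<le> p x" for c x
    unfolding q_def using that C(1) by (intro cINF_greatest) auto
  have "q (x + y) \<le> q x + q y" for x y
  proof -
    have *: "q (x + y) \<le> p x + p' y" if pp: "p \<in> C" "p' \<in> C" for p p'
    proof -
      obtain m where m: "m \<in> C" "m \<le> p" "m \<le> p'" using chain[OF pp] pp by blast
      have "q (x + y) \<le> m (x + y)" by (rule le[OF m(1)])
      also have "\<dots> \<le> m x + m y" using C(2)[OF m(1)] by (simp add: sublinear_def)
      also have "\<dots> \<le> p x + p' y" using m by (intro add_mono) (auto simp: le_fun_def)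
      finally show ?thesis .
    qed
    have "q (x + y) - p x \<le> q y" if "p \<in> C" for p using *[OF that] by (intro gr) (simp add: algebra_simps)
    then have "q (x + y) - q y \<le> q x" by (intro gr) (simp add: algebra_simps)
    then show ?thesis by simp
  qed
  moreover have "q (c *\<^sub>R x) \<le> c * q x" if c: "c > 0" for c x
  proof -
    have "q (c *\<^sub>R x) / c \<le> p x" if "p \<in> C" for p
    proof -
      have "q (c *\<^sub>R x) \<le> p (c *\<^sub>R x)" by (rule le[OF that])
      also have "\<dots> \<le> c * p x" using C(2)[OF that] c by (simp add: sublinear_def)
      finally show ?thesis using c by (simp add: field_simps)
    qed
    then have "q (c *\<^sub>R x) / c \<le> q x" by (rule gr)
    then show ?thesis using c by (simp add: field_simps)
  qed
  ultimately show ?thesis using le by (intro exI[of _ q]) (auto simp: sublinear_def le_fun_def)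
qed

lemma exists_linear_below_sublinear:
  fixes p :: "'a::real_vector \<Rightarrow> real"
  assumes p: "sublinear p"
  obtains g where "linear g" "g \<le> p"
proof -
  define A where "A = {q. sublinear q \<and> q \<le> p}"
  \<comment> \<open>Zorn's lemma for the reversed order: a maximal element for it is a minimal
    sublinear function below \<open>p\<close>.\<close>
  have "\<exists>m\<in>A. \<forall>a\<in>A. a \<le> m \<longrightarrow> a = m"
  proof (rule predicate_Zorn[where P = "\<lambda>a b. b \<le> a"])
    show "partial_order_on A (relation_of (\<lambda>a b. b \<le> a) A)"
      by (intro partial_order_on_relation_ofI) auto
    fix C assume "C \<in> Chains (relation_of (\<lambda>a b. b \<le> a) A)"
    then have C: "C \<subseteq> A" "\<And>a b. a \<in> C \<Longrightarrow> b \<in> C \<Longrightarrow> a \<le> b \<or> b \<le> a"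
      by (auto simp: Chains_def relation_of_def)
    show "\<exists>u\<in>A. \<forall>a\<in>C. u \<le> a"
    proof (cases "C = {}")
      case True then show ?thesis using p by (auto simp: A_def)
    next
      case False
      obtain q where q: "sublinear q" "\<forall>a\<in>C. q \<le> a"
        using sublinear_chain_Inf[of C p] False C by (auto simp: A_def le_fun_def)
      then show ?thesis using False C(1) by (intro bexI[of _ q]) (auto simp: A_def intro: order_trans)
    qed
  qed
  then obtain m where m: "sublinear m" "m \<le> p" and min: "\<And>a. a \<in> A \<Longrightarrow> a \<le> m \<Longrightarrow> a = m"
    by (auto simp: A_def)
  have odd: "m (- y) = - m y" for y
  proof -
    obtain q where q: "sublinear q" "q \<le> m" "q (- y) \<le> - m y" using sublinear_lower_at[OF m(1)] by blast
    have "q = m" using q m by (intro min) (auto simp: A_def)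
    then show ?thesis using q(3) sublinear_minus[OF m(1), of y] by simp
  qed
  have add: "m (x + y) \<le> m x + m y" for x y using m(1) by (simp add: sublinear_def)
  have sc: "m (t *\<^sub>R x) \<le> t * m x" if "t > 0" for t x using m(1) that by (simp add: sublinear_def)
  \<comment> \<open>Oddness turns subadditivity at \<open>x + y\<close> and \<open>- y\<close> into
    the reverse inequality.\<close>
  have "m (x + y) = m x + m y" for x y
    using add[of "x + y" "- y"] add[of x y] odd by (simp add: algebra_simps)
  moreover have pos: "m (t *\<^sub>R x) = t * m x" if "t > 0" for t x
    using sc[OF that, of x] sc[OF that, of "- x"] odd by (simp add: antisym)
  have "m (t *\<^sub>R x) = t * m x" for t x
  proof (cases "t = 0 \<or> t > 0")
    case False
    then have "m ((- t) *\<^sub>R x) = (- t) * m x" by (intro pos) auto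
    then show ?thesis using odd[of "t *\<^sub>R x"] by simp
  qed (use pos sublinear_0[OF m(1)] in auto)
  ultimately have "linear m" by (intro linearI) auto
  with m(2) that show thesis by blast
qed

text \<open>Lowering the norm at \<open>x0\<close> before taking a linear minorant builds the value
  at \<open>x0\<close> into every such minorant, in place of extending a functional from the line
  through \<open>x0\<close>.\<close>

lemma real_norming_functional:
  fixes x0 :: "'a::real_normed_vector"
  obtains g where "linear g" "\<And>x. g x \<le> norm x" "g x0 = norm x0"
proof -
  have "sublinear (norm :: 'a \<Rightarrow> real)" by (auto simp: sublinear_def norm_triangle_ineq)
  then obtain q where q: "sublinear q" "q \<le> norm" "q (- x0) \<le> - norm x0"
    using sublinear_lower_at by blast
  obtain g where g: "linear g" "g \<le> q" using exists_linear_below_sublinear[OF q(1)] .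
  have le: "g x \<le> norm x" for x using g(2) q(2) by (meson le_funD order_trans)
  have "- g x0 \<le> - norm x0" using g(2) q(3) linear_neg[OF g(1), of x0] by (metis le_funD order_trans)
  then show thesis using that[OF g(1) le] le[of x0] by simp
qed

text \<open>The class only provides an isometric embedding of the scalars into the complex numbers.
  This makes it a usable dichotomy: all scalars are real, or the field contains an imaginary unit
  \<open>j\<close> and \<open>h\<close> reads off real and imaginary parts.\<close>

lemma real_or_complex_cases:
  obtains (real) "\<And>c::'k::real_or_complex. \<exists>r. c = of_real r"
  | (complex) j :: "'k::real_or_complex" and h :: "'k::real_or_complex \<Rightarrow> complex" where
      "\<And>c::'k::real_or_complex. \<exists>a b. c = of_real a + of_real b * j"
      "\<And>a b. h (of_real a + of_real b * j) = Complex a b"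
      "\<And>c. norm (h c) = norm c" "j * j = - 1"
proof -
  obtain h :: "'k \<Rightarrow> complex" where add: "\<And>x y. h (x + y) = h x + h y"
    and mult: "\<And>x y. h (x * y) = h x * h y" and nrm: "\<And>x. norm (h x) = norm x"
    and range: "range h = \<real> \<or> range h = UNIV" using real_or_complex by blast
  interpret h: additive h by standard (rule add)
  have inj: "x = y" if "h x = h y" for x y
    using nrm[of "x - y"] that by (simp add: h.diff)
  have "h 1 * h 1 = h 1" "h 1 \<noteq> 0" using mult[of 1 1] nrm[of 1] by auto
  then have one: "h 1 = 1" by simp
  \<comment> \<open>The moduli of h r and of h r + 1 place h r on two circles with centres 0 and -1
    that meet only at r.\<close>
  have of_real: "h (of_real r) = of_real r" for r
  proof -
    have "(Re (h (of_real r)))\<^sup>2 + (Im (h (of_real r)))\<^sup>2 = r\<^sup>2"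
      using nrm[of "of_real r"] by (simp flip: cmod_power2)
    moreover have "norm (h (of_real r + 1)) = \<bar>r + 1\<bar>"
      unfolding nrm by (metis norm_of_real of_real_1 of_real_add)
    then have "(Re (h (of_real r)) + 1)\<^sup>2 + (Im (h (of_real r)))\<^sup>2 = (r + 1)\<^sup>2"
      using cmod_power2[of "h (of_real r) + 1"] by (simp add: add one)
    ultimately have "Re (h (of_real r)) = r" "Im (h (of_real r)) = 0"
      by (auto simp: power2_eq_square algebra_simps)
    then show ?thesis by (simp add: complex_eq_iff)
  qed
  from range show thesis
  proof
    assume R: "range h = \<real>"
    have "\<exists>r. c = of_real r" for c :: 'k
    proof -
      have "h c \<in> \<real>" using R by auto
      then obtain r where "h c = of_real r" by (auto elim: Reals_cases)
      then show ?thesis using of_real by (intro exI[of _ r] inj) simp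
    qed
    then show thesis by (rule real)
  next
    assume U: "range h = UNIV"
    then obtain j where j: "h j = \<i>" by (metis rangeE UNIV_I)
    have eq: "h (of_real a + of_real b * j) = Complex a b" for a b
      by (simp add: add mult of_real j complex_eq_iff)
    have "\<exists>a b. c = of_real a + of_real b * j" for c
      by (rule exI[of _ "Re (h c)"], rule exI[of _ "Im (h c)"], rule inj) (simp add: eq)
    moreover have "j * j = - 1" by (rule inj) (simp add: mult j h.minus one)
    ultimately show thesis using complex[of j h] eq nrm by blast
  qed
qed

section \<open>Norming functionals on the base space\<close>

context normed_space_over
begin

lemma vs_field: "vector_space ((*) :: 'k \<Rightarrow> 'k \<Rightarrow> 'k)"
  by unfold_locales (auto simp: algebra_simps)

lemma linear_functional_iff:
  "Vector_Spaces.linear sL (*) f \<longleftrightarrow> (\<forall>x y. f (x + y) = f x + f y) \<and> (\<forall>c x. f (sL c x) = c * f x)"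
  unfolding Vector_Spaces.linear_iff using vs_field vector_space_axioms by blast

text \<open>Over the complex numbers the real norming functional \<open>g\<close> is the real part
  of f x = g x - i g (i x). Its value at \<open>x0\<close> is then at least norm x0 in modulus, and
  the upper bound comes from rotating f x onto the positive axis.\<close>

lemma norming_functional:
  obtains f where "Vector_Spaces.linear sL (*) f" "\<And>x. norm (f x) \<le> norm x" "norm (f x0) = norm x0"
proof -
  obtain g :: "'l \<Rightarrow> real" where g: "linear g" and le: "\<And>x. g x \<le> norm x" and g0: "g x0 = norm x0"
    using real_norming_functional[of x0] by blast
  have absg: "\<bar>g x\<bar> \<le> norm x" for x using le[of x] le[of "- x"] linear_neg[OF g, of x] by simp
  have gadd: "g (x + y) = g x + g y" and gsc: "g (r *\<^sub>R x) = r * g x" for x y r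
    using linear_add[OF g] linear_scale[OF g] by auto
  show thesis
  proof (cases rule: real_or_complex_cases[where 'k = 'k])
    case real
    define f :: "'l \<Rightarrow> 'k" where "f x = of_real (g x)" for x
    have "f (sL c x) = c * f x" for c x
    proof -
      obtain r where "c = of_real r" using real by blast
      then show ?thesis by (simp add: f_def smul_of_real gsc)
    qed
    then have "Vector_Spaces.linear sL (*) f" by (simp add: linear_functional_iff f_def gadd)
    then show thesis using absg g0 by (intro that[of f]) (auto simp: f_def)
  next
    case (complex j h)
    define f :: "'l \<Rightarrow> 'k" where "f x = of_real (g x) - of_real (g (sL j x)) * j" for x
    have hf: "h (f x) = Complex (g x) (- g (sL j x))" for x
      using complex(2)[of "g x" "- g (sL j x)"] by (simp add: f_def)
    have lin: "Vector_Spaces.linear sL (*) f"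
      unfolding linear_functional_iff
    proof (intro conjI allI)
      show "f (x + y) = f x + f y" for x y by (simp add: f_def scale_right_distrib gadd algebra_simps)
      fix c x
      obtain a b where c: "c = of_real a + of_real b * j" using complex(1) by blast
      have s: "sL c x = a *\<^sub>R x + b *\<^sub>R sL j x"
        by (simp only: c scale_left_distrib scale_scale[symmetric] smul_of_real)
      have sr: "sL j (r *\<^sub>R y) = r *\<^sub>R sL j y" for r y
        by (simp only: smul_of_real[symmetric] scale_scale mult.commute)
      have "sL j (sL j x) = - x" by (simp only: scale_scale complex(4) scale_minus_left scale_one)
      then have t: "sL j (sL c x) = a *\<^sub>R sL j x - b *\<^sub>R x"
        unfolding s scale_right_distrib sr by simp
      have gd: "g (u - v) = g u - g v" for u v by (rule linear_diff[OF g])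
      have *: "A * G + B * H - (A * H - B * G) * j = (A + B * j) * (G - H * j)" for A B G H :: 'k
      proof -
        have "(A + B * j) * (G - H * j) = A * G - A * H * j + B * G * j - B * H * (j * j)"
          by (simp add: algebra_simps)
        then show ?thesis unfolding complex(4) by (simp add: algebra_simps)
      qed
      show "f (sL c x) = c * f x"
        unfolding f_def t unfolding s unfolding gadd gd gsc unfolding c by (simp only: of_real_add of_real_diff of_real_mult *)
    qed
    have "norm (f x) \<le> norm x" for x
    proof (cases "f x = 0")
      case False
      \<comment> \<open>A scalar of modulus 1 makes \<open>f\<close> real at the rotated vector,
        where it agrees with \<open>g\<close>; the vector keeps its norm.\<close>
      define c where "c = of_real (norm (f x)) / f x"
      have c: "norm c = 1" using False by (simp add: c_def norm_divide)
      have "f (sL c x) = of_real (norm (f x))"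
        using lin False by (simp add: linear_functional_iff c_def)
      then have "h (f (sL c x)) = Complex (norm (f x)) 0"
        using complex(2)[of "norm (f x)" 0] by simp
      then have "norm (f x) = g (sL c x)" using hf[of "sL c x"] by simp
      also have "\<dots> \<le> norm x" using le[of "sL c x"] by (simp add: norm_smul c)
      finally show ?thesis .
    qed simp
    moreover have "norm (f x0) \<ge> norm x0"
      using complex_Re_le_cmod[of "h (f x0)"] unfolding complex(3) by (simp add: hf g0)
    ultimately show thesis using lin by (intro that[of f]) (auto intro: antisym)
  qed
qed

end

text \<open>Induction leaves goals in eta-long form, where these two rules would destroy \<open>0\<close> and \<open>+\<close> of tensors.\<close>

declare zero_fun_apply [simp del] plus_fun_apply [simp del]

section \<open>Linear spaces and the algebraic tensor product\<close>

lemma sum_fun_apply: "(\<Sum>i\<in>A. f i) x = (\<Sum>i\<in>A. f i x)"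
  for f :: "'i \<Rightarrow> 'a \<Rightarrow> 'b::comm_monoid_add"
  by (induction A rule: infinite_finite_induct) (auto simp: zero_fun_apply plus_fun_apply)

lemma vector_space_pscale: "vector_space (pscale :: 'k::field \<Rightarrow> ('a \<Rightarrow> 'k) \<Rightarrow> 'a \<Rightarrow> 'k)"
  by unfold_locales (auto simp: pscale_def fun_eq_iff plus_fun_apply algebra_simps)

lemma module_pscale: "module (pscale :: 'k::field \<Rightarrow> ('a \<Rightarrow> 'k) \<Rightarrow> 'a \<Rightarrow> 'k)"
  by unfold_locales (auto simp: pscale_def fun_eq_iff plus_fun_apply algebra_simps)

lemma pscale_apply: "pscale c u b = c * u b"
  by (simp add: pscale_def)

lemma pscale_inverse: "c \<noteq> 0 \<Longrightarrow> pscale c (pscale (inverse c) u) = u" for c :: "'k::field"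
  by (simp add: pscale_def fun_eq_iff flip: mult.assoc)

lemma linear_spaceD:
  assumes "linear_space E"
  shows "vector_space (smul E)" "module (smul E)" "0 \<in> carr E"
    "\<And>x y. x \<in> carr E \<Longrightarrow> y \<in> carr E \<Longrightarrow> x + y \<in> carr E"
    "\<And>c x. x \<in> carr E \<Longrightarrow> smul E c x \<in> carr E"
    "\<And>x y. x \<in> carr E \<Longrightarrow> y \<in> carr E \<Longrightarrow> x - y \<in> carr E"
    "\<And>A f. (\<And>i. i \<in> A \<Longrightarrow> f i \<in> carr E) \<Longrightarrow> sum f A \<in> carr E"
proof -
  have v: "vector_space (smul E)" and s: "module.subspace (smul E) (carr E)"
    using assms by (auto simp: linear_space_def)
  interpret vector_space "smul E" by (rule v)
  show "vector_space (smul E)" "module (smul E)" "0 \<in> carr E"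
    "\<And>x y. x \<in> carr E \<Longrightarrow> y \<in> carr E \<Longrightarrow> x + y \<in> carr E"
    "\<And>c x. x \<in> carr E \<Longrightarrow> smul E c x \<in> carr E"
    "\<And>x y. x \<in> carr E \<Longrightarrow> y \<in> carr E \<Longrightarrow> x - y \<in> carr E"
    using s v module_axioms by (auto intro: subspace_0 subspace_add subspace_scale subspace_diff)
  show "\<And>A f. (\<And>i. i \<in> A \<Longrightarrow> f i \<in> carr E) \<Longrightarrow> sum f A \<in> carr E"
    using s by (rule subspace_sum)
qed

lemma lin_on_0:
  fixes f :: "'e::ab_group_add \<Rightarrow> 'b::ab_group_add"
  assumes "linear_space E" "lin_on E s f"
  shows "f 0 = 0"
proof -
  have "f (0 + 0) = f 0 + f 0"
    using assms linear_spaceD(3)[of E] unfolding lin_on_def by blast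
  then show ?thesis by simp
qed

lemma lin_on_sum:
  fixes f :: "'e::ab_group_add \<Rightarrow> 'b::ab_group_add"
  assumes E: "linear_space E" and f: "lin_on E s f" and "\<And>i. i \<in> A \<Longrightarrow> g i \<in> carr E"
  shows "f (\<Sum>i\<in>A. g i) = (\<Sum>i\<in>A. f (g i))"
  using assms(3)
proof (induction A rule: infinite_finite_induct)
  case (insert a A)
  then have "g a \<in> carr E" "(\<Sum>i\<in>A. g i) \<in> carr E" by (auto intro!: linear_spaceD(7)[OF E])
  with f have "f (g a + (\<Sum>i\<in>A. g i)) = f (g a) + f (\<Sum>i\<in>A. g i)" by (auto simp: lin_on_def)
  with insert show ?case by simp
qed (use lin_on_0[OF E f] in auto)

lemma lin_opD:
  assumes "lin_op G E \<phi>"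
  shows "\<And>x. x \<in> carr G \<Longrightarrow> \<phi> x \<in> carr E"
    "\<And>x y. x \<in> carr G \<Longrightarrow> y \<in> carr G \<Longrightarrow> \<phi> (x + y) = \<phi> x + \<phi> y"
    "\<And>c x. x \<in> carr G \<Longrightarrow> \<phi> (smul G c x) = smul E c (\<phi> x)"
    "lin_on G (smul E) \<phi>"
  using assms by (auto simp: lin_op_def lin_on_def)

lemma lin_opI:
  assumes "\<And>x. x \<in> carr G \<Longrightarrow> \<phi> x \<in> carr E"
    "\<And>x y. x \<in> carr G \<Longrightarrow> y \<in> carr G \<Longrightarrow> \<phi> (x + y) = \<phi> x + \<phi> y"
    "\<And>c x. x \<in> carr G \<Longrightarrow> \<phi> (smul G c x) = smul E c (\<phi> x)"
  shows "lin_op G E \<phi>"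
  using assms by (auto simp: lin_op_def lin_on_def)

lemma lin_op_comp: "lin_op P G \<psi> \<Longrightarrow> lin_op G E \<tau> \<Longrightarrow> lin_op P E (\<lambda>x. \<tau> (\<psi> x))"
  by (rule lin_opI) (auto simp: lin_opD)

lemma lin_op_id: "lin_op E E (\<lambda>x. x)"
  by (rule lin_opI) auto

lemma lin_op_sum:
  assumes "linear_space E" "\<And>i. i \<in> A \<Longrightarrow> lin_op G E (\<phi> i)"
  shows "lin_op G E (\<lambda>x. \<Sum>i\<in>A. \<phi> i x)"
proof -
  interpret module "smul E" using assms(1) by (rule linear_spaceD)
  show ?thesis
    using lin_opD[OF assms(2)]
    by (intro lin_opI) (simp_all add: linear_spaceD(7)[OF assms(1)] sum.distrib scale_sum_right)
qed

text \<open>An L-norm lives on the tensor product and not on E, so vectors of E are told apart by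
  purely algebraic functionals, here one with value 1 at \<open>x - y\<close>.\<close>

lemma exists_separating_functional:
  assumes "vector_space s" "x \<noteq> y"
  obtains h where "Vector_Spaces.linear s (*) h" "h x \<noteq> (h y :: 'k::field)"
proof -
  have K: "vector_space ((*) :: 'k \<Rightarrow> 'k \<Rightarrow> 'k)" by unfold_locales (auto simp: algebra_simps)
  interpret vector_space_pair s "(*)" using assms K by (simp add: vector_space_pair_def)
  have "vs1.independent {x - y}" using assms(2) by simp
  from linear_independent_extend[OF this, of "\<lambda>_. 1"] obtain h
    where h: "Vector_Spaces.linear s (*) h" "h (x - y) = 1" by auto
  interpret h: Vector_Spaces.linear s "(*)" h by fact
  show thesis using h by (intro that[of h]) (auto simp: h.diff)
qed

section \<open>Elementary tensors, amplification and the module action\<close>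

lemma etensor_in: "x \<in> carr E \<Longrightarrow> etensor sL E \<xi> x \<in> ltensor sL E"
  unfolding ltensor_def by (rule module.span_base[OF module_pscale]) auto

lemma ltensor_0: "0 \<in> ltensor sL E"
  unfolding ltensor_def by (rule module.span_zero[OF module_pscale])

lemma ltensor_add: "u \<in> ltensor sL E \<Longrightarrow> v \<in> ltensor sL E \<Longrightarrow> u + v \<in> ltensor sL E"
  unfolding ltensor_def by (rule module.span_add[OF module_pscale])

lemma ltensor_scale: "u \<in> ltensor sL E \<Longrightarrow> pscale c u \<in> ltensor sL E"
  unfolding ltensor_def by (rule module.span_scale[OF module_pscale])

lemma ltensor_sum: "(\<And>i. i \<in> A \<Longrightarrow> w i \<in> ltensor sL E) \<Longrightarrow> sum w A \<in> ltensor sL E"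
  unfolding ltensor_def by (rule module.span_sum[OF module_pscale])

text \<open>A scalar is absorbed by the left factor of an elementary tensor, so every tensor is a
  plain sum of elementary ones and scalar multiples need no case of their own.\<close>

lemma ltensor_induct [consumes 1, case_names zero elem add]:
  assumes u: "u \<in> ltensor sL E" and 0: "P 0"
    and elem: "\<And>\<xi> x. x \<in> carr E \<Longrightarrow> P (etensor sL E \<xi> x)"
    and add: "\<And>u v. u \<in> ltensor sL E \<Longrightarrow> v \<in> ltensor sL E \<Longrightarrow> P u \<Longrightarrow> P v \<Longrightarrow> P (u + v)"
  shows "P u"
proof -
  have "u \<in> ltensor sL E \<and> P u"
    using u unfolding ltensor_def
  proof (induction rule: module.span_induct_alt[OF module_pscale, consumes 1])
    case 1
    then show ?case using 0 ltensor_0[of sL E] by (simp add: ltensor_def)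
  next
    case (2 c v u)
    then obtain \<xi> x where x: "x \<in> carr E" "v = etensor sL E \<xi> x" by blast
    then have "pscale c v = etensor sL E (sL c \<xi>) x" by (simp add: etensor_bilinear)
    with x have "pscale c v \<in> ltensor sL E" "P (pscale c v)" by (auto intro: etensor_in elem)
    with 2 show ?case using add[of "pscale c v" u] ltensor_add[of "pscale c v" sL E u]
      by (simp add: ltensor_def)
  qed
  then show ?thesis ..
qed

lemma etensor_0_left: "x \<in> carr E \<Longrightarrow> etensor sL E 0 x = 0"
  using etensor_bilinear(1)[of x E x sL 0 0] by simp

lemma etensor_0_right: "linear_space E \<Longrightarrow> etensor sL E \<xi> 0 = 0"
  using etensor_bilinear(2)[of 0 E 0 sL \<xi>] linear_spaceD(3)[of E] by simp

lemma etensor_sum_left: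
  "x \<in> carr E \<Longrightarrow> etensor sL E (\<Sum>i\<in>A. \<xi> i) x = (\<Sum>i\<in>A. etensor sL E (\<xi> i) x)"
  by (induction A rule: infinite_finite_induct) (auto simp: etensor_0_left etensor_bilinear)

lemma etensor_sum_right:
  assumes "linear_space E" "\<And>i. i \<in> A \<Longrightarrow> x i \<in> carr E"
  shows "etensor sL E \<xi> (\<Sum>i\<in>A. x i) = (\<Sum>i\<in>A. etensor sL E \<xi> (x i))"
  using assms(2)
  by (induction A rule: infinite_finite_induct)
    (auto simp: etensor_0_right assms(1) etensor_bilinear linear_spaceD(7)[OF assms(1)])

lemma amplify_0 [simp]: "amplify sL E \<phi> 0 = 0"
  and amplify_add: "amplify sL E \<phi> (u + v) = amplify sL E \<phi> u + amplify sL E \<phi> v"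
  and amplify_scale: "amplify sL E \<phi> (pscale c u) = pscale c (amplify sL E \<phi> u)"
  by (auto simp: amplify_def fun_eq_iff pscale_def zero_fun_apply plus_fun_apply)

lemma amplify_sum: "amplify sL E \<phi> (\<Sum>i\<in>A. u i) = (\<Sum>i\<in>A. amplify sL E \<phi> (u i))"
  by (induction A rule: infinite_finite_induct) (simp_all add: amplify_add)

lemma act_0 [simp]: "act sL E a 0 = 0"
  and act_add: "act sL E a (u + v) = act sL E a u + act sL E a v"
  by (auto simp: act_def fun_eq_iff pscale_def zero_fun_apply plus_fun_apply)

lemma act_sum: "act sL E a (\<Sum>i\<in>A. u i) = (\<Sum>i\<in>A. act sL E a (u i))"
  by (induction A rule: infinite_finite_induct) (simp_all add: act_add)

lemma amplify_in:
  assumes "lin_op G E \<phi>" "u \<in> ltensor sL G"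
  shows "amplify sL E \<phi> u \<in> ltensor sL E"
  using assms(2)
  by (induction rule: ltensor_induct)
    (simp_all add: ltensor_0 amplify_add ltensor_add amplify_etensor[OF assms(1)] etensor_in
      lin_opD(1)[OF assms(1)])

lemma amplify_comp:
  assumes "lin_op P G \<psi>" "lin_op G E \<tau>" "u \<in> ltensor sL P"
  shows "amplify sL E \<tau> (amplify sL G \<psi> u) = amplify sL E (\<lambda>x. \<tau> (\<psi> x)) u"
  using assms(3)
  by (induction rule: ltensor_induct)
    (simp_all add: amplify_add amplify_etensor[OF assms(1)] amplify_etensor[OF assms(2)]
      amplify_etensor[OF lin_op_comp[OF assms(1,2)]] lin_opD(1)[OF assms(1)])

text \<open>Operators matter only on carriers, but \<open>amplify\<close> composes forms with the
  whole function. On true tensors the values off the carrier have no influence, as induction on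
  elementary tensors shows.\<close>

lemma amplify_cong:
  assumes \<phi>: "lin_op G E \<phi>" and eq: "\<And>x. x \<in> carr G \<Longrightarrow> \<phi> x = \<phi>' x" and "u \<in> ltensor sL G"
    and G: "linear_space G"
  shows "amplify sL E \<phi> u = amplify sL E \<phi>' u"
proof -
  have "lin_op G E \<phi>'"
  proof (rule lin_opI)
    show "\<phi>' (x + y) = \<phi>' x + \<phi>' y" if "x \<in> carr G" "y \<in> carr G" for x y
      using that eq lin_opD(2)[OF \<phi>, of x y] linear_spaceD(4)[OF G, of x y] by simp
    show "\<phi>' (smul G c x) = smul E c (\<phi>' x)" if "x \<in> carr G" for c x
      using that eq lin_opD(3)[OF \<phi>, of x c] linear_spaceD(5)[OF G, of x c] by simp
  qed (use eq lin_opD(1)[OF \<phi>] in force)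
  from assms(3) show ?thesis
    by (induction rule: ltensor_induct)
      (simp_all add: amplify_add amplify_etensor[OF \<phi>] amplify_etensor[OF \<open>lin_op G E \<phi>'\<close>] eq)
qed

lemma amplify_id: "u \<in> ltensor sL E \<Longrightarrow> amplify sL E (\<lambda>x. x) u = u"
  by (induction rule: ltensor_induct) (simp_all add: amplify_add amplify_etensor[OF lin_op_id])

lemma amplify_act:
  assumes "lin_op G E \<phi>" "Vector_Spaces.linear sL sL a" "u \<in> ltensor sL G"
  shows "amplify sL E \<phi> (act sL G a u) = act sL E a (amplify sL E \<phi> u)"
  using assms(3)
  by (induction rule: ltensor_induct)
    (simp_all add: act_add amplify_add amplify_etensor[OF assms(1)] act_etensor[OF assms(2)]
      lin_opD(1)[OF assms(1)])

lemma amplify_sum_op: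
  assumes "linear_space E" "\<And>i. i \<in> A \<Longrightarrow> lin_op G E (\<phi> i)" "u \<in> ltensor sL G"
  shows "amplify sL E (\<lambda>x. \<Sum>i\<in>A. \<phi> i x) u = (\<Sum>i\<in>A. amplify sL E (\<phi> i) u)"
  using assms(3)
proof (induction rule: ltensor_induct)
  case (elem \<xi> x)
  then have "amplify sL E (\<lambda>x. \<Sum>i\<in>A. \<phi> i x) (etensor sL G \<xi> x) = (\<Sum>i\<in>A. etensor sL E \<xi> (\<phi> i x))"
    using amplify_etensor[OF lin_op_sum[of E A G \<phi>] elem, of sL \<xi>] assms(1,2)
    by (simp add: etensor_sum_right lin_opD(1)[OF assms(2)])
  also have "\<dots> = (\<Sum>i\<in>A. amplify sL E (\<phi> i) (etensor sL G \<xi> x))"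
    by (intro sum.cong refl) (simp add: amplify_etensor[OF assms(2)] elem)
  finally show ?case .
qed (simp_all add: amplify_add sum.distrib)

lemma act_add_op:
  assumes "Vector_Spaces.linear sL sL a" "Vector_Spaces.linear sL sL b"
    "Vector_Spaces.linear sL sL (\<lambda>\<xi>. a \<xi> + b \<xi>)" "u \<in> ltensor sL E"
  shows "act sL E (\<lambda>\<xi>. a \<xi> + b \<xi>) u = act sL E a u + act sL E b u"
  using assms(4)
  by (induction rule: ltensor_induct)
    (simp_all add: act_add act_etensor[OF assms(1)] act_etensor[OF assms(2)] act_etensor[OF assms(3)]
      etensor_bilinear)

text \<open>As encoded, a tensor is a function of arbitrary forms. Membership in
  \<open>ltensor\<close> makes it a sum of evaluations, hence linear on bilinear forms and, in the
  next lemma, blind to their values off the carrier.\<close>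

lemma ltensor_eval_scale:
  assumes "u \<in> ltensor sL E" "B \<in> bilin sL E" "(\<lambda>\<xi> x. c * B \<xi> x) \<in> bilin sL E"
  shows "u (\<lambda>\<xi> x. c * B \<xi> x) = c * u B"
  using assms(1)
  by (induction rule: ltensor_induct) (auto simp: etensor_def assms(2,3) zero_fun_apply plus_fun_apply algebra_simps)

lemma ltensor_eval_cong:
  assumes "u \<in> ltensor sL E" "B \<in> bilin sL E" "B' \<in> bilin sL E"
    "\<And>\<xi> x. x \<in> carr E \<Longrightarrow> B \<xi> x = B' \<xi> x"
  shows "u B = u B'"
  using assms(1)
  by (induction rule: ltensor_induct) (auto simp: etensor_def assms(2-4) zero_fun_apply plus_fun_apply)

section \<open>Norms of operators\<close>

lemma L_spaceD:
  assumes "L_space sL E"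
  shows "linear_space E"
    "\<And>u. u \<in> ltensor sL E \<Longrightarrow> lnorm E u \<ge> 0"
    "\<And>u. u \<in> ltensor sL E \<Longrightarrow> lnorm E u = 0 \<longleftrightarrow> u = 0"
    "\<And>c u. u \<in> ltensor sL E \<Longrightarrow> lnorm E (pscale c u) = norm c * lnorm E u"
    "\<And>u v. u \<in> ltensor sL E \<Longrightarrow> v \<in> ltensor sL E \<Longrightarrow> lnorm E (u + v) \<le> lnorm E u + lnorm E v"
    "\<And>a u. bounded_op sL a \<Longrightarrow> u \<in> ltensor sL E \<Longrightarrow> lnorm E (act sL E a u) \<le> onorm a * lnorm E u"
    "lnorm E 0 = 0"
  using assms ltensor_0[of sL E] unfolding L_space_def by simp_all

lemma lnorm_sum:
  assumes E: "L_space sL E" and "\<And>i. i \<in> A \<Longrightarrow> w i \<in> ltensor sL E"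
  shows "lnorm E (\<Sum>i\<in>A. w i) \<le> (\<Sum>i\<in>A. lnorm E (w i))"
  using assms(2)
proof (induction A rule: infinite_finite_induct)
  case (insert a A)
  then have "lnorm E (w a + (\<Sum>i\<in>A. w i)) \<le> lnorm E (w a) + lnorm E (\<Sum>i\<in>A. w i)"
    by (intro L_spaceD(5)[OF E] ltensor_sum) auto
  with insert show ?case by simp
qed (auto simp: L_spaceD(7)[OF E])

text \<open>An explicit bound composes and sums without any argument about suprema.
  \<open>Lb_norm_le\<close> and \<open>Lb_le_Lb_norm\<close> translate between it and the norm
  defined by a supremum.\<close>

definition Lb_le :: "('k::real_or_complex \<Rightarrow> 'l::real_normed_vector \<Rightarrow> 'l) \<Rightarrow>
    ('k, 'g::ab_group_add, 'l) lsp \<Rightarrow> ('k, 'e::ab_group_add, 'l) lsp \<Rightarrow> ('g \<Rightarrow> 'e) \<Rightarrow> real \<Rightarrow> bool" where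
  "Lb_le sL G E \<phi> C \<longleftrightarrow> lin_op G E \<phi> \<and>
     (\<forall>u\<in>ltensor sL G. lnorm E (amplify sL E \<phi> u) \<le> C * lnorm G u)"

lemma Lb_leD:
  assumes "Lb_le sL G E \<phi> C"
  shows "lin_op G E \<phi>" "\<And>u. u \<in> ltensor sL G \<Longrightarrow> lnorm E (amplify sL E \<phi> u) \<le> C * lnorm G u"
  using assms by (auto simp: Lb_le_def)

lemma L_bounded_iff: "L_bounded sL G E \<phi> \<longleftrightarrow> (\<exists>C. Lb_le sL G E \<phi> C)"
  by (auto simp: L_bounded_def Lb_le_def)

lemma Lb_le_mono:
  assumes "Lb_le sL G E \<phi> C" "C \<le> D" "L_space sL G"
  shows "Lb_le sL G E \<phi> D"
  using assms L_spaceD(2)[OF assms(3)] unfolding Lb_le_def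
  by (meson mult_right_mono order_trans)

lemma Lb_le_comp:
  assumes "Lb_le sL P G \<psi> C" "Lb_le sL G E \<tau> D" "0 \<le> D"
  shows "Lb_le sL P E (\<lambda>x. \<tau> (\<psi> x)) (D * C)"
  unfolding Lb_le_def
proof safe
  show "lin_op P E (\<lambda>x. \<tau> (\<psi> x))" using assms by (auto simp: Lb_le_def intro: lin_op_comp)
  fix u assume u: "u \<in> ltensor sL P"
  have "lnorm E (amplify sL E (\<lambda>x. \<tau> (\<psi> x)) u) = lnorm E (amplify sL E \<tau> (amplify sL G \<psi> u))"
    by (simp add: amplify_comp[OF Lb_leD(1)[OF assms(1)] Lb_leD(1)[OF assms(2)] u])
  also have "\<dots> \<le> D * lnorm G (amplify sL G \<psi> u)"
    by (rule Lb_leD(2)[OF assms(2)]) (rule amplify_in[OF Lb_leD(1)[OF assms(1)] u])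
  also have "\<dots> \<le> D * (C * lnorm P u)" using Lb_leD(2)[OF assms(1) u] assms(3) by (rule mult_left_mono)
  finally show "lnorm E (amplify sL E (\<lambda>x. \<tau> (\<psi> x)) u) \<le> D * C * lnorm P u" by (simp add: mult.assoc)
qed

lemma Lb_norm_le:
  assumes "Lb_le sL G E \<phi> C" "0 \<le> C" "L_space sL G"
  shows "Lb_norm sL G E \<phi> \<le> C"
  unfolding Lb_norm_def
proof (rule cSUP_least)
  show "L_cball sL G \<noteq> {}" using L_spaceD(7)[OF assms(3)] ltensor_0[of sL G] by (auto simp: L_cball_def)
  fix u assume u: "u \<in> L_cball sL G"
  then have "lnorm E (amplify sL E \<phi> u) \<le> C * lnorm G u" using assms by (auto simp: Lb_le_def L_cball_def)
  also have "\<dots> \<le> C * 1" using u assms(2) by (intro mult_left_mono) (auto simp: L_cball_def)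
  finally show "lnorm E (amplify sL E \<phi> u) \<le> C" by simp
qed

text \<open>Boundedness makes the supremum a genuine one; rescaling to the closed unit ball then
  gives the estimate, and tensors of norm 0 are zero by definiteness.\<close>

lemma Lb_le_Lb_norm:
  assumes "L_bounded sL G E \<phi>" "L_space sL G" "L_space sL E"
  shows "Lb_le sL G E \<phi> (Lb_norm sL G E \<phi>)" "0 \<le> Lb_norm sL G E \<phi>"
proof -
  obtain C where C: "Lb_le sL G E \<phi> C" using assms(1) by (auto simp: L_bounded_iff)
  note lin = Lb_leD(1)[OF C]
  have "bdd_above ((\<lambda>u. lnorm E (amplify sL E \<phi> u)) ` L_cball sL G)"
  proof (rule bdd_aboveI2)
    fix u assume "u \<in> L_cball sL G"
    then have u: "u \<in> ltensor sL G" "lnorm G u \<le> 1" by (auto simp: L_cball_def)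
    have "lnorm E (amplify sL E \<phi> u) \<le> C * lnorm G u" using C u by (simp add: Lb_leD)
    also have "\<dots> \<le> \<bar>C\<bar> * 1" using u L_spaceD(2)[OF assms(2) u(1)] by (intro mult_mono) auto
    finally show "lnorm E (amplify sL E \<phi> u) \<le> \<bar>C\<bar>" by simp
  qed
  then have le: "lnorm E (amplify sL E \<phi> u) \<le> Lb_norm sL G E \<phi>" if "u \<in> L_cball sL G" for u
    unfolding Lb_norm_def using that by (intro cSUP_upper)
  show "0 \<le> Lb_norm sL G E \<phi>"
    using le[of 0] L_spaceD(7)[OF assms(2)] L_spaceD(7)[OF assms(3)] ltensor_0[of sL G]
    by (auto simp: L_cball_def)
  have "lnorm E (amplify sL E \<phi> u) \<le> Lb_norm sL G E \<phi> * lnorm G u" if u: "u \<in> ltensor sL G" for u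
  proof (cases "lnorm G u = 0")
    case True
    then show ?thesis using L_spaceD(3)[OF assms(2) u] L_spaceD(7)[OF assms(3)] by simp
  next
    case False
    then have pos: "lnorm G u > 0" using L_spaceD(2)[OF assms(2) u] by simp
    define c :: 'a where "c = of_real (1 / lnorm G u)"
    have c: "norm c = 1 / lnorm G u" using pos unfolding c_def norm_of_real by simp
    have "pscale c u \<in> L_cball sL G"
      using u pos by (simp add: L_cball_def L_spaceD(4)[OF assms(2)] ltensor_scale c)
    from le[OF this] have "norm c * lnorm E (amplify sL E \<phi> u) \<le> Lb_norm sL G E \<phi>"
      using amplify_in[OF lin u] by (simp add: amplify_scale L_spaceD(4)[OF assms(3)])
    then show ?thesis using pos by (simp add: c field_simps)
  qed
  with lin show "Lb_le sL G E \<phi> (Lb_norm sL G E \<phi>)" by (auto simp: Lb_le_def)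
qed

lemma Lb_le_id: "Lb_le sL E E (\<lambda>x. x) 1"
  by (auto simp: Lb_le_def lin_op_id amplify_id)

lemma L_contractive_iff:
  assumes "L_space sL G" "L_space sL E"
  shows "L_contractive sL G E \<phi> \<longleftrightarrow> Lb_le sL G E \<phi> 1"
proof
  assume "L_contractive sL G E \<phi>"
  then show "Lb_le sL G E \<phi> 1"
    using Lb_le_Lb_norm[of sL G E \<phi>] Lb_le_mono[of sL G E \<phi>] assms by (auto simp: L_contractive_def)
next
  assume "Lb_le sL G E \<phi> 1"
  then show "L_contractive sL G E \<phi>"
    using Lb_norm_le[of sL G E \<phi> 1] assms by (auto simp: L_contractive_def L_bounded_iff)
qed

text \<open>Homogeneity turns the statement about unit balls into a quantitative one. The closed
  ball contains u divided by exactly its norm, so tensors lift with constant 1.\<close>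

lemma L_strictly_coisometricD:
  assumes \<tau>: "L_strictly_coisometric sL G E \<tau>" and G: "L_space sL G" and E: "L_space sL E"
  shows "Lb_le sL G E \<tau> 1"
    and "u \<in> ltensor sL E \<Longrightarrow> \<exists>v\<in>ltensor sL G. amplify sL E \<tau> v = u \<and> lnorm G v \<le> lnorm E u"
proof -
  have lin: "lin_op G E \<tau>" and im: "amplify sL E \<tau> ` L_cball sL G = L_cball sL E"
    using \<tau> by (auto simp: L_strictly_coisometric_def)
  have "lnorm E (amplify sL E \<tau> u) \<le> 1 * lnorm G u" if u: "u \<in> ltensor sL G" for u
  proof (cases "u = 0")
    case True
    then show ?thesis by (simp add: L_spaceD(7)[OF E] L_spaceD(7)[OF G])
  next
    case False
    then have pos: "lnorm G u > 0" using L_spaceD(2,3)[OF G u] by linarith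
    define c :: 'a where "c = of_real (1 / lnorm G u)"
    have c: "norm c = 1 / lnorm G u" using pos unfolding c_def norm_of_real by simp
    have "pscale c u \<in> L_cball sL G"
      using u pos by (simp add: L_cball_def L_spaceD(4)[OF G] ltensor_scale c)
    then have "amplify sL E \<tau> (pscale c u) \<in> L_cball sL E" using im by blast
    then have "norm c * lnorm E (amplify sL E \<tau> u) \<le> 1"
      using amplify_in[OF lin u] by (simp add: L_cball_def amplify_scale L_spaceD(4)[OF E])
    then show ?thesis using pos by (simp add: c field_simps)
  qed
  then show "Lb_le sL G E \<tau> 1" using lin by (auto simp: Lb_le_def)
  assume u: "u \<in> ltensor sL E"
  show "\<exists>v\<in>ltensor sL G. amplify sL E \<tau> v = u \<and> lnorm G v \<le> lnorm E u"
  proof (cases "u = 0")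
    case True
    then show ?thesis
      by (intro bexI[of _ 0]) (auto simp: ltensor_0 L_spaceD(7)[OF E] L_spaceD(7)[OF G])
  next
    case False
    then have pos: "lnorm E u > 0" using L_spaceD(2,3)[OF E u] by linarith
    define c :: 'a where "c = of_real (lnorm E u)"
    have c: "norm c = lnorm E u" "c \<noteq> 0" using pos unfolding c_def norm_of_real by auto
    have "pscale (inverse c) u \<in> L_cball sL E"
      using u pos c by (simp add: L_cball_def L_spaceD(4)[OF E] ltensor_scale norm_inverse)
    then obtain v where v: "v \<in> L_cball sL G" "amplify sL E \<tau> v = pscale (inverse c) u"
      using im by (metis imageE)
    have "amplify sL E \<tau> (pscale c v) = u"
      unfolding amplify_scale v(2) using c(2) by (rule pscale_inverse)
    moreover have "lnorm G (pscale c v) \<le> lnorm E u"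
      using v(1) pos by (simp add: L_cball_def L_spaceD(4)[OF G] c)
    ultimately show ?thesis using v(1) by (intro bexI[of _ "pscale c v"]) (auto simp: L_cball_def ltensor_scale)
  qed
qed

text \<open>To enter the open ball u must be divided by more than its norm; this is the origin of
  the factor 1 + \<delta>.\<close>

lemma L_coisometricD:
  assumes \<tau>: "L_coisometric sL G E \<tau>" and G: "L_space sL G" and E: "L_space sL E"
    and u: "u \<in> ltensor sL E" and \<delta>: "\<delta> > 0"
  shows "\<exists>v\<in>ltensor sL G. amplify sL E \<tau> v = u \<and> lnorm G v \<le> (1 + \<delta>) * lnorm E u"
proof (cases "u = 0")
  case True
  then show ?thesis
    by (intro bexI[of _ 0]) (auto simp: ltensor_0 L_spaceD(7)[OF E] L_spaceD(7)[OF G])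
next
  case False
  then have "lnorm E u > 0" using L_spaceD(2,3)[OF E u] by linarith
  then have pos: "(1 + \<delta>) * lnorm E u > lnorm E u" "lnorm E u > 0" using \<delta> by auto
  define c :: 'a where "c = of_real ((1 + \<delta>) * lnorm E u)"
  have c: "norm c = (1 + \<delta>) * lnorm E u" "c \<noteq> 0" using pos unfolding c_def norm_of_real of_real_eq_0_iff by auto
  have im: "amplify sL E \<tau> ` L_ball sL G = L_ball sL E" using \<tau> by (auto simp: L_coisometric_def)
  have "norm (inverse c) * lnorm E u < 1"
    using pos unfolding norm_inverse c(1) by (simp add: field_simps)
  then have "pscale (inverse c) u \<in> L_ball sL E"
    using u by (simp add: L_ball_def L_spaceD(4)[OF E] ltensor_scale)
  then obtain v where v: "v \<in> L_ball sL G" "amplify sL E \<tau> v = pscale (inverse c) u"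
    using im by (metis imageE)
  have "amplify sL E \<tau> (pscale c v) = u"
    unfolding amplify_scale v(2) using c(2) by (rule pscale_inverse)
  moreover have "lnorm G (pscale c v) \<le> norm c"
    using v(1) mult_left_mono[of "lnorm G v" 1 "norm c"] by (simp add: L_ball_def L_spaceD(4)[OF G])
  ultimately show ?thesis using v(1) c(1)
    by (intro bexI[of _ "pscale c v"]) (auto simp: L_ball_def ltensor_scale)
qed

text \<open>A lifting of no larger norm stays in the closed ball and also in the open one, so exact
  liftings give both notions at once.\<close>

lemma L_coisometricI:
  assumes \<tau>: "Lb_le sL G E \<tau> 1"
    and *: "\<And>u. u \<in> ltensor sL E \<Longrightarrow> \<exists>v\<in>ltensor sL G. amplify sL E \<tau> v = u \<and> lnorm G v \<le> lnorm E u"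
  shows "L_strictly_coisometric sL G E \<tau>" "L_coisometric sL G E \<tau>"
proof -
  have "amplify sL E \<tau> u \<in> ltensor sL E" "lnorm E (amplify sL E \<tau> u) \<le> lnorm G u"
    if "u \<in> ltensor sL G" for u
    using that Lb_leD[OF \<tau>] by (auto simp: amplify_in)
  then show "L_strictly_coisometric sL G E \<tau>" "L_coisometric sL G E \<tau>"
    using * Lb_leD(1)[OF \<tau>] unfolding L_strictly_coisometric_def L_coisometric_def L_ball_def L_cball_def
    by (fastforce simp: image_iff)+
qed

section \<open>Duals and the injective norm\<close>

text \<open>Just the structure that rescaling to the unit ball uses. It passes to duals, so the
  estimates below apply alike to \<open>Z\<close>, to its dual and to its bidual, which occurs in
  the injective norm.\<close>

definition seminormed :: "('k::real_or_complex, 'e::ab_group_add) nsp \<Rightarrow> bool" where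
  "seminormed F \<longleftrightarrow> linear_space F \<and> (\<forall>x\<in>carr F. nrm F x \<ge> 0) \<and>
     (\<forall>c. \<forall>x\<in>carr F. nrm F (smul F c x) = norm c * nrm F x)"

lemma seminormedD:
  assumes "seminormed F"
  shows "linear_space F" "\<And>x. x \<in> carr F \<Longrightarrow> nrm F x \<ge> 0"
    "\<And>c x. x \<in> carr F \<Longrightarrow> nrm F (smul F c x) = norm c * nrm F x" "nrm F 0 = 0"
proof -
  show *: "linear_space F" "\<And>x. x \<in> carr F \<Longrightarrow> nrm F x \<ge> 0"
    "\<And>c x. x \<in> carr F \<Longrightarrow> nrm F (smul F c x) = norm c * nrm F x"
    using assms by (auto simp: seminormed_def)
  interpret module "smul F" by (rule linear_spaceD[OF *(1)])
  show "nrm F 0 = 0" using *(3)[of 0 0] linear_spaceD(3)[OF *(1)] by simp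
qed

lemma unit_ball_0: "seminormed F \<Longrightarrow> 0 \<in> unit_ball F"
  by (simp add: unit_ball_def seminormedD linear_spaceD)

lemma dual_simps:
  "smul (dual F) = pscale" "nrm (dual F) f = (SUP x\<in>unit_ball F. norm (f x))"
  "f \<in> carr (dual F) \<longleftrightarrow> lin_on F (*) f \<and> (\<exists>C. \<forall>x\<in>carr F. norm (f x) \<le> C * nrm F x) \<and>
     (\<forall>x. x \<notin> carr F \<longrightarrow> f x = 0)"
  by (simp_all add: dual_def)

lemma dual_nrm_le:
  assumes "seminormed F" "0 \<le> C" "\<And>x. x \<in> carr F \<Longrightarrow> norm (f x) \<le> C * nrm F x"
  shows "nrm (dual F) f \<le> C"
  unfolding dual_simps
proof (rule cSUP_least)
  show "unit_ball F \<noteq> {}" using unit_ball_0[OF assms(1)] by blast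
  fix x assume "x \<in> unit_ball F"
  then show "norm (f x) \<le> C"
    using assms(3)[of x] assms(2) mult_left_mono[of "nrm F x" 1 C] by (simp add: unit_ball_def)
qed

text \<open>Rescaling to the unit ball; where the norm of x vanishes, the crude bound that comes
  with membership in the dual already forces f x = 0.\<close>

lemma dual_bound:
  assumes F: "seminormed F" and f: "f \<in> carr (dual F)" and x: "x \<in> carr F"
  shows "norm (f x) \<le> nrm (dual F) f * nrm F x"
proof -
  have lin: "lin_on F (*) f" using f by (simp add: dual_simps)
  obtain C where C: "\<And>x. x \<in> carr F \<Longrightarrow> norm (f x) \<le> C * nrm F x" using f by (auto simp: dual_simps)
  show ?thesis
  proof (cases "nrm F x = 0")
    case True
    then show ?thesis using C[OF x] by simp
  next
    case False
    then have pos: "nrm F x > 0" using seminormedD(2)[OF F x] by simp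
    have "bdd_above ((\<lambda>x. norm (f x)) ` unit_ball F)"
    proof (rule bdd_aboveI2)
      fix x assume "x \<in> unit_ball F"
      then have x: "x \<in> carr F" "nrm F x \<le> 1" by (auto simp: unit_ball_def)
      have "norm (f x) \<le> C * nrm F x" by (rule C[OF x(1)])
      also have "\<dots> \<le> \<bar>C\<bar> * 1" using x seminormedD(2)[OF F x(1)] by (intro mult_mono) auto
      finally show "norm (f x) \<le> \<bar>C\<bar>" by simp
    qed
    then have le: "norm (f y) \<le> nrm (dual F) f" if "y \<in> unit_ball F" for y
      unfolding dual_simps using that by (intro cSUP_upper)
    define c :: 'a where "c = of_real (1 / nrm F x)"
    have c: "norm c = 1 / nrm F x" using pos unfolding c_def norm_of_real by simp
    have "smul F c x \<in> unit_ball F"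
      using x pos by (simp add: unit_ball_def seminormedD[OF F] linear_spaceD[OF seminormedD(1)[OF F]] c)
    from le[OF this] have "norm c * norm (f x) \<le> nrm (dual F) f"
      using lin x by (simp add: lin_on_def norm_mult)
    then show ?thesis using pos by (simp add: c field_simps)
  qed
qed

lemma seminormed_dual:
  assumes F: "seminormed F"
  shows "seminormed (dual F)"
proof -
  have nn: "nrm (dual F) f \<ge> 0" if f: "f \<in> carr (dual F)" for f
  proof -
    have "f 0 = 0" using f lin_on_0[OF seminormedD(1)[OF F]] by (auto simp: dual_simps)
    moreover have "bdd_above ((\<lambda>x. norm (f x)) ` unit_ball F)"
    proof (rule bdd_aboveI2)
      fix x assume x: "x \<in> unit_ball F"
      then have "norm (f x) \<le> nrm (dual F) f * nrm F x" using dual_bound[OF F f] by (auto simp: unit_ball_def)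
      also have "\<dots> \<le> \<bar>nrm (dual F) f\<bar> * 1"
        using x seminormedD(2)[OF F, of x] by (intro mult_mono) (auto simp: unit_ball_def)
      finally show "norm (f x) \<le> \<bar>nrm (dual F) f\<bar>" by simp
    qed
    then have "norm (f 0) \<le> nrm (dual F) f"
      unfolding dual_simps using unit_ball_0[OF F] by (intro cSUP_upper)
    ultimately show ?thesis by simp
  qed
  have cl: "pscale c f \<in> carr (dual F)" if f: "f \<in> carr (dual F)" for c f
  proof -
    obtain C where C: "\<forall>x\<in>carr F. norm (f x) \<le> C * nrm F x" using f by (auto simp: dual_simps)
    have "\<forall>x\<in>carr F. norm (pscale c f x) \<le> (norm c * C) * nrm F x"
      using C by (auto simp: pscale_def norm_mult mult.assoc intro!: mult_left_mono)
    then have "\<exists>C. \<forall>x\<in>carr F. norm (pscale c f x) \<le> C * nrm F x" by blast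
    moreover have "lin_on F (*) (pscale c f)" "\<forall>x. x \<notin> carr F \<longrightarrow> pscale c f x = 0"
      using f by (auto simp: dual_simps lin_on_def pscale_def algebra_simps)
    ultimately show ?thesis unfolding dual_simps by blast
  qed
  have le: "nrm (dual F) (pscale c f) \<le> norm c * nrm (dual F) f" if f: "f \<in> carr (dual F)" for c f
    using dual_bound[OF F f] nn[OF f]
    by (intro dual_nrm_le[OF F]) (auto simp: pscale_def norm_mult mult.assoc intro!: mult_left_mono)
  have sc: "nrm (dual F) (pscale c f) = norm c * nrm (dual F) f" if f: "f \<in> carr (dual F)" for c f
  proof (cases "c = 0")
    case True
    then show ?thesis using le[OF f, of c] nn[OF cl[OF f, of c]] by simp
  next
    case False
    have "norm c * nrm (dual F) f = norm c * nrm (dual F) (pscale (inverse c) (pscale c f))"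
      using False pscale_inverse[of "inverse c" f] by simp
    also have "\<dots> \<le> norm c * (norm (inverse c) * nrm (dual F) (pscale c f))"
      by (intro mult_left_mono le cl f) auto
    also have "\<dots> = nrm (dual F) (pscale c f)" using False by (simp add: norm_inverse)
    finally show ?thesis using le[OF f, of c] by simp
  qed
  have "linear_space (dual F)"
    unfolding linear_space_def dual_simps
  proof (intro conjI vector_space_pscale module.subspaceI[OF module_pscale])
    show "0 \<in> carr (dual F)"
      by (auto simp: dual_simps lin_on_def zero_fun_apply intro!: exI[of _ 0])
    fix f g assume f: "f \<in> carr (dual F)" and g: "g \<in> carr (dual F)"
    have "norm ((f + g) x) \<le> (nrm (dual F) f + nrm (dual F) g) * nrm F x" if "x \<in> carr F" for x
      using dual_bound[OF F f that] dual_bound[OF F g that] norm_triangle_ineq[of "f x" "g x"]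
      by (simp add: plus_fun_apply algebra_simps)
    then have "\<exists>C. \<forall>x\<in>carr F. norm ((f + g) x) \<le> C * nrm F x" by blast
    moreover have "lin_on F (*) (f + g)" "\<forall>x. x \<notin> carr F \<longrightarrow> (f + g) x = 0"
      using f g by (auto simp: dual_simps lin_on_def plus_fun_apply algebra_simps)
    ultimately show "f + g \<in> carr (dual F)" unfolding dual_simps by blast
  qed (rule cl)
  then show ?thesis using nn sc by (simp add: seminormed_def dual_simps(1))
qed

text \<open>Trades the supremum in the dual norm for a pointwise estimate, the form in which members
  of dual unit balls are built and used.\<close>

lemma unit_ball_dual_iff:
  assumes F: "seminormed F"
  shows "f \<in> unit_ball (dual F) \<longleftrightarrow> lin_on F (*) f \<and> (\<forall>x\<in>carr F. norm (f x) \<le> nrm F x) \<and>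
     (\<forall>x. x \<notin> carr F \<longrightarrow> f x = 0)" (is "?l \<longleftrightarrow> ?r")
proof
  assume f: ?l
  have "norm (f x) \<le> nrm F x" if x: "x \<in> carr F" for x
  proof -
    have "norm (f x) \<le> nrm (dual F) f * nrm F x" using f x by (intro dual_bound[OF F]) (auto simp: unit_ball_def)
    also have "\<dots> \<le> 1 * nrm F x"
      using f seminormedD(2)[OF F x] by (intro mult_right_mono) (auto simp: unit_ball_def)
    finally show ?thesis by simp
  qed
  then show ?r using f by (auto simp: unit_ball_def dual_simps)
next
  assume r: ?r
  then have "nrm (dual F) f \<le> 1" by (intro dual_nrm_le[OF F]) auto
  moreover have "f \<in> carr (dual F)" using r unfolding dual_simps by (auto intro!: exI[of _ 1])
  ultimately show ?l by (simp add: unit_ball_def)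
qed

lemma sub_nsp_simps [simp]:
  "carr (sub_nsp sL Z) = Z" "smul (sub_nsp sL Z) = sL" "nrm (sub_nsp sL Z) = norm"
  by (simp_all add: sub_nsp_def)

lemma MIN_space_simps [simp]:
  "carr (MIN_space sL F) = carr F" "smul (MIN_space sL F) = smul F" "lnorm (MIN_space sL F) = inj_norm sL F"
  by (simp_all add: MIN_space_def)

lemma bilin_cong:
  "carr E = carr E' \<Longrightarrow> smul E = smul E' \<Longrightarrow> bilin sL E = bilin sL E'"
  by (simp add: bilin_def lin_on_def)

text \<open>The tensor product depends only on carrier and scalar multiplication, which
  \<open>MIN_space\<close> keeps. As simp rules these equations make \<open>MIN_space\<close>
  disappear everywhere except in the norm.\<close>

lemma MIN_space_tensor [simp]:
  "bilin sL (MIN_space sL F) = bilin sL F"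
  "etensor sL (MIN_space sL F) = etensor sL F"
  "ltensor sL (MIN_space sL F) = ltensor sL F"
  "act sL (MIN_space sL F) = act sL F"
  "amplify sL (MIN_space sL F) = amplify sL F"
  "lin_op (MIN_space sL F) E = lin_op F E"
  "lin_op G (MIN_space sL F) = lin_op G F"
  "linear_space (MIN_space sL F) = linear_space F"
proof -
  show b: "bilin sL (MIN_space sL F) = bilin sL F" by (rule bilin_cong) auto
  show e: "etensor sL (MIN_space sL F) = etensor sL F" by (simp add: etensor_def b fun_eq_iff)
  show "ltensor sL (MIN_space sL F) = ltensor sL F" by (simp add: ltensor_def e)
  show "act sL (MIN_space sL F) = act sL F" by (simp add: act_def b fun_eq_iff)
  show "amplify sL (MIN_space sL F) = amplify sL F" by (simp add: amplify_def b fun_eq_iff)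
  show "lin_op (MIN_space sL F) E = lin_op F E" by (simp add: lin_op_def lin_on_def fun_eq_iff)
  show "lin_op G (MIN_space sL F) = lin_op G F" by (simp add: lin_op_def lin_on_def fun_eq_iff)
  show "linear_space (MIN_space sL F) = linear_space F" by (simp add: linear_space_def)
qed

section \<open>The injective tensor norm\<close>

context normed_space_over
begin

lemma seminormed_sub: "subspace Z \<Longrightarrow> seminormed (sub_nsp sL Z)"
  using vector_space_axioms by (simp add: seminormed_def linear_space_def norm_smul)

lemma seminormed_UNIV: "seminormed (sub_nsp sL UNIV)"
  by (rule seminormed_sub) simp

lemma unit_ball_dual_UNIV:
  "f \<in> unit_ball (dual (sub_nsp sL UNIV)) \<longleftrightarrow>
     Vector_Spaces.linear sL (*) f \<and> (\<forall>x. norm (f x) \<le> norm x)"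
  by (simp add: unit_ball_dual_iff[OF seminormed_UNIV] lin_on_def linear_functional_iff)

lemma tensor_functional_bilin:
  assumes "Vector_Spaces.linear sL (*) f" "lin_on E (*) g"
  shows "(\<lambda>\<xi> x. f \<xi> * g x) \<in> bilin sL E"
  using assms unfolding bilin_def linear_functional_iff by (auto simp: lin_on_def algebra_simps)

text \<open>An elementary tensor is bounded by norm \<xi> * nrm F x uniformly over both unit balls,
  and such bounds add up over a finite sum.\<close>

lemma inj_norm_bdd:
  assumes F: "seminormed F" and v: "v \<in> ltensor sL F"
  shows "bdd_above ((\<lambda>(f, g). norm (v (\<lambda>\<xi> x. f \<xi> * g x))) `
      (unit_ball (dual (sub_nsp sL UNIV)) \<times> unit_ball (dual F)))"
proof -
  have "\<exists>C. \<forall>f\<in>unit_ball (dual (sub_nsp sL UNIV)). \<forall>g\<in>unit_ball (dual F).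
      norm (v (\<lambda>\<xi> x. f \<xi> * g x)) \<le> C"
    using v
  proof (induction rule: ltensor_induct)
    case zero
    then show ?case by (auto simp: zero_fun_apply)
  next
    case (elem \<xi> x)
    have "norm (etensor sL F \<xi> x (\<lambda>\<xi> x. f \<xi> * g x)) \<le> norm \<xi> * nrm F x"
      if "f \<in> unit_ball (dual (sub_nsp sL UNIV))" "g \<in> unit_ball (dual F)" for f g
      using that elem seminormedD(2)[OF F elem] unfolding unit_ball_dual_UNIV unit_ball_dual_iff[OF F]
      by (auto simp: etensor_def norm_mult intro!: mult_mono)
    then show ?case by blast
  next
    case (add u v)
    then obtain C D where
      "\<And>f g. f\<in>unit_ball (dual (sub_nsp sL UNIV)) \<Longrightarrow> g\<in>unit_ball (dual F) \<Longrightarrow>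
        norm (u (\<lambda>\<xi> x. f \<xi> * g x)) \<le> C"
      "\<And>f g. f\<in>unit_ball (dual (sub_nsp sL UNIV)) \<Longrightarrow> g\<in>unit_ball (dual F) \<Longrightarrow>
        norm (v (\<lambda>\<xi> x. f \<xi> * g x)) \<le> D" by metis
    then have "norm ((u + v) (\<lambda>\<xi> x. f \<xi> * g x)) \<le> C + D"
      if "f \<in> unit_ball (dual (sub_nsp sL UNIV))" "g \<in> unit_ball (dual F)" for f g
      unfolding plus_fun_apply using that by (intro norm_triangle_mono)
    then show ?case by blast
  qed
  then show ?thesis by (auto simp: bdd_above_def)
qed

lemma inj_norm_least:
  assumes F: "seminormed F"
    and "\<And>f g. Vector_Spaces.linear sL (*) f \<Longrightarrow> (\<And>\<xi>. norm (f \<xi>) \<le> norm \<xi>) \<Longrightarrow>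
      g \<in> unit_ball (dual F) \<Longrightarrow> norm (v (\<lambda>\<xi> x. f \<xi> * g x)) \<le> C"
  shows "inj_norm sL F v \<le> C"
  unfolding inj_norm_def
proof (rule cSUP_least)
  show "unit_ball (dual (sub_nsp sL UNIV)) \<times> unit_ball (dual F) \<noteq> {}"
    using unit_ball_0[OF seminormed_dual[OF seminormed_UNIV]] unit_ball_0[OF seminormed_dual[OF F]] by blast
  fix z assume "z \<in> unit_ball (dual (sub_nsp sL UNIV)) \<times> unit_ball (dual F)"
  then obtain f g where z: "z = (f, g)" "f \<in> unit_ball (dual (sub_nsp sL UNIV))" "g \<in> unit_ball (dual F)"
    by blast
  then have "norm (v (\<lambda>\<xi> x. f \<xi> * g x)) \<le> C" unfolding unit_ball_dual_UNIV by (intro assms(2)) auto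
  then show "(case z of (f, g) \<Rightarrow> norm (v (\<lambda>\<xi> x. f \<xi> * g x))) \<le> C" by (simp add: z(1))
qed

text \<open>Homogeneous form of the defining supremum: the functionals need only have bounds
  \<open>A\<close> and \<open>B\<close>, and \<open>g\<close> may be arbitrary off the
  carrier.\<close>

lemma inj_norm_upper:
  assumes F: "seminormed F" and v: "v \<in> ltensor sL F"
    and f: "Vector_Spaces.linear sL (*) f" "\<And>\<xi>. norm (f \<xi>) \<le> A * norm \<xi>" and A: "A \<ge> 0"
    and g: "lin_on F (*) g" "\<And>x. x \<in> carr F \<Longrightarrow> norm (g x) \<le> B * nrm F x" and B: "B \<ge> 0"
  shows "norm (v (\<lambda>\<xi> x. f \<xi> * g x)) \<le> A * B * inj_norm sL F v"
proof -
  \<comment> \<open>Normalisation into the unit balls. If a bound is 0, \<open>inverse 0 = 0\<close>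
    yields the zero functional; \<open>g'\<close> is cut off outside the carrier because
    \<open>dual\<close> demands it.\<close>
  define f' where "f' \<xi> = of_real (inverse A) * f \<xi>" for \<xi>
  define g' where "g' x = (if x \<in> carr F then of_real (inverse B) * g x else 0)" for x
  have f': "f' \<in> unit_ball (dual (sub_nsp sL UNIV))"
    unfolding unit_ball_dual_UNIV
  proof
    show "Vector_Spaces.linear sL (*) f'"
      using f(1) by (simp add: linear_functional_iff f'_def algebra_simps)
    show "\<forall>x. norm (f' x) \<le> norm x"
    proof (cases "A = 0")
      case False
      then show ?thesis using f(2) A by (auto simp: f'_def norm_mult norm_divide field_simps)
    qed (simp add: f'_def)
  qed
  have g': "g' \<in> unit_ball (dual F)"
    unfolding unit_ball_dual_iff[OF F]
  proof (intro conjI ballI)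
    show "lin_on F (*) g'"
      using g(1) linear_spaceD(4,5)[OF seminormedD(1)[OF F]] by (simp add: lin_on_def g'_def algebra_simps)
    show "norm (g' x) \<le> nrm F x" if "x \<in> carr F" for x
    proof (cases "B = 0")
      case False
      then show ?thesis using g(2)[OF that] B that by (auto simp: g'_def norm_mult norm_divide field_simps)
    qed (use that seminormedD(2)[OF F] in \<open>simp add: g'_def\<close>)
  qed (simp add: g'_def)
  define T where "T = (\<lambda>\<xi> x. f' \<xi> * g' x)"
  have lf: "Vector_Spaces.linear sL (*) (\<lambda>\<xi>. c * f' \<xi>)" for c
    using f' unfolding unit_ball_dual_UNIV linear_functional_iff by (auto simp: algebra_simps)
  have lg: "lin_on F (*) g'" using g' unit_ball_dual_iff[OF F] by blast
  have T: "T \<in> bilin sL F" "(\<lambda>\<xi> x. c * T \<xi> x) \<in> bilin sL F" for c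
    using tensor_functional_bilin[OF lf[of 1] lg] tensor_functional_bilin[OF lf lg]
    by (simp_all add: T_def mult.assoc)
  have eq: "f \<xi> * g x = of_real (A * B) * T \<xi> x" if x: "x \<in> carr F" for \<xi> x
  proof (cases "A = 0 \<or> B = 0")
    case True
    then show ?thesis using f(2)[of \<xi>] g(2)[OF x] by auto
  next
    case False
    then show ?thesis using x by (simp add: T_def f'_def g'_def divide_simps)
  qed
  have "v (\<lambda>\<xi> x. f \<xi> * g x) = v (\<lambda>\<xi> x. of_real (A * B) * T \<xi> x)"
    using v tensor_functional_bilin[OF f(1) g(1)] T(2) eq by (rule ltensor_eval_cong)
  also have "\<dots> = of_real (A * B) * v T" by (rule ltensor_eval_scale[OF v T])
  finally have "norm (v (\<lambda>\<xi> x. f \<xi> * g x)) = A * B * norm (v T)"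
    using A B by (simp add: norm_mult)
  also have "norm (v T) \<le> inj_norm sL F v"
    unfolding inj_norm_def T_def using f' g' by (intro cSUP_upper2[OF inj_norm_bdd[OF F v], of "(f', g')"]) auto
  finally show ?thesis using A B by (simp add: mult_left_mono)
qed

text \<open>All properties of an L-norm except definiteness, which for duals of complemented
  subspaces comes later from the canonical tensor. The module estimate holds because composing f
  with \<open>a\<close> multiplies its bound by at most \<open>onorm a\<close>.\<close>

lemma inj_norm_seminorm:
  assumes F: "seminormed F" and v: "v \<in> ltensor sL F"
  shows "inj_norm sL F v \<ge> 0"
    "u \<in> ltensor sL F \<Longrightarrow> inj_norm sL F (u + v) \<le> inj_norm sL F u + inj_norm sL F v"
    "inj_norm sL F (pscale c v) = norm c * inj_norm sL F v"
    "bounded_op sL a \<Longrightarrow> inj_norm sL F (act sL F a v) \<le> onorm a * inj_norm sL F v"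
    "inj_norm sL F 0 = 0"
proof -
  have upper: "norm (v (\<lambda>\<xi> x. f \<xi> * g x)) \<le> inj_norm sL F v"
    if "v \<in> ltensor sL F" "Vector_Spaces.linear sL (*) f" "\<And>\<xi>. norm (f \<xi>) \<le> norm \<xi>" "g \<in> unit_ball (dual F)"
    for v f g
    using inj_norm_upper[OF F that(1,2), of 1 g 1] that unit_ball_dual_iff[OF F] by simp
  have ball: "lin_on F (*) g" "\<And>x. x \<in> carr F \<Longrightarrow> norm (g x) \<le> 1 * nrm F x" if "g \<in> unit_ball (dual F)" for g
    using that unit_ball_dual_iff[OF F] by auto
  have lin0: "Vector_Spaces.linear sL (*) (\<lambda>_. 0 :: 'k)" by (simp add: linear_functional_iff)
  have nn: "inj_norm sL F v \<ge> 0" if v: "v \<in> ltensor sL F" for v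
    using upper[OF v lin0 _ unit_ball_0[OF seminormed_dual[OF F]]] norm_ge_zero by (rule order_trans[rotated]) simp
  then show "inj_norm sL F v \<ge> 0" using v .
  show "inj_norm sL F (u + v) \<le> inj_norm sL F u + inj_norm sL F v" if u: "u \<in> ltensor sL F"
    by (rule inj_norm_least[OF F])
      (auto simp: plus_fun_apply intro!: norm_triangle_mono upper u v)
  have le: "inj_norm sL F (pscale c v) \<le> norm c * inj_norm sL F v" if v: "v \<in> ltensor sL F" for c v
    by (rule inj_norm_least[OF F]) (auto simp: pscale_apply norm_mult intro!: mult_left_mono upper v)
  show z: "inj_norm sL F 0 = 0"
    using le[OF ltensor_0, of 0] nn[OF ltensor_0] by (simp add: pscale_def zero_fun_def)
  show "inj_norm sL F (pscale c v) = norm c * inj_norm sL F v"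
  proof (cases "c = 0")
    case True
    then show ?thesis using z by (simp add: pscale_def zero_fun_def)
  next
    case False
    have "norm c * inj_norm sL F v = norm c * inj_norm sL F (pscale (inverse c) (pscale c v))"
      using False pscale_inverse[of "inverse c" v] by simp
    also have "\<dots> \<le> norm c * (norm (inverse c) * inj_norm sL F (pscale c v))"
      by (intro mult_left_mono le ltensor_scale v) auto
    also have "\<dots> = inj_norm sL F (pscale c v)" using False by (simp add: norm_inverse)
    finally show ?thesis using le[OF v, of c] by simp
  qed
  show "inj_norm sL F (act sL F a v) \<le> onorm a * inj_norm sL F v" if a: "bounded_op sL a"
  proof (rule inj_norm_least[OF F])
    fix f g assume f: "Vector_Spaces.linear sL (*) f" "\<And>\<xi>. norm (f \<xi>) \<le> norm \<xi>"
      and g: "g \<in> unit_ball (dual F)"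
    have a': "Vector_Spaces.linear sL sL a" "bounded_linear a" using a by (auto simp: bounded_op_def)
    have fa: "Vector_Spaces.linear sL (*) (\<lambda>\<xi>. f (a \<xi>))"
      using f(1) a'(1) by (simp add: linear_functional_iff Vector_Spaces.linear_iff)
    have "norm (f (a \<xi>)) \<le> onorm a * norm \<xi>" for \<xi>
      using f(2)[of "a \<xi>"] onorm[OF a'(2), of \<xi>] by linarith
    then have "norm (v (\<lambda>\<xi> x. f (a \<xi>) * g x)) \<le> onorm a * 1 * inj_norm sL F v"
      using ball[OF g] by (intro inj_norm_upper[OF F v fa]) (auto simp: onorm_pos_le[OF a'(2)])
    then show "norm (act sL F a v (\<lambda>\<xi> x. f \<xi> * g x)) \<le> onorm a * inj_norm sL F v"
      using tensor_functional_bilin[OF f(1) ball(1)[OF g]] by (simp add: act_def)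
  qed
qed

end

section \<open>The canonical tensor of a finite-dimensional complemented subspace\<close>

text \<open>The coordinate functionals \<open>fs\<close> are defined and bounded on the whole base
  space, so their restrictions lie in the Banach dual of \<open>Z\<close> directly, without an
  appeal to equivalence of norms in finite dimension.\<close>

locale fd_complemented = normed_space_over sL
  for sL :: "'k::real_or_complex \<Rightarrow> 'l::real_normed_vector \<Rightarrow> 'l" +
  fixes Z :: "'l set" and p :: "'l \<Rightarrow> 'l" and S :: "'l set" and fs :: "'l \<Rightarrow> 'l \<Rightarrow> 'k"
  assumes finS: "finite S" and Z: "Z = span S"
    and fs: "\<And>s. s \<in> S \<Longrightarrow> Vector_Spaces.linear sL (*) (fs s)"
    and fs_bdd: "\<And>s. s \<in> S \<Longrightarrow> \<exists>C. \<forall>\<xi>. norm (fs s \<xi>) \<le> C * norm \<xi>"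
    and expand: "\<And>z. z \<in> Z \<Longrightarrow> z = (\<Sum>s\<in>S. sL (fs s z) s)"
    and p: "bounded_op sL p" "\<And>z. z \<in> Z \<Longrightarrow> p z = z" "\<And>\<xi>. norm (p \<xi>) \<le> norm \<xi>"
      "\<And>\<xi>. p \<xi> \<in> Z"
begin

abbreviation D :: "('k, 'l \<Rightarrow> 'k) nsp" where "D \<equiv> dual (sub_nsp sL Z)"

text \<open>Restriction to \<open>Z\<close>; the value 0 elsewhere matches the normalisation in
  \<open>dual\<close>.\<close>

definition res :: "('l \<Rightarrow> 'k) \<Rightarrow> 'l \<Rightarrow> 'k" where
  "res f = (\<lambda>z. if z \<in> Z then f z else 0)"

text \<open>Under \<open>Z \<otimes> Z\<^sup>* = B(Z)\<close> this is the identity of \<open>Z\<close>.\<close>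

definition canon :: "('k, 'l \<Rightarrow> 'k, 'l) tensor" where
  "canon = (\<Sum>s\<in>S. etensor sL D s (res (fs s)))"

lemma Z_subspace: "subspace Z"
  by (simp add: Z subspace_span)

lemma S_Z: "s \<in> S \<Longrightarrow> s \<in> Z"
  by (simp add: Z span_base)

lemma seminormed_Z: "seminormed (sub_nsp sL Z)"
  by (rule seminormed_sub[OF Z_subspace])

lemma seminormed_D: "seminormed D"
  by (rule seminormed_dual[OF seminormed_Z])

lemma linear_space_D: "linear_space D"
  by (rule seminormedD(1)[OF seminormed_D])

lemma p_linear: "Vector_Spaces.linear sL sL p"
  using p(1) by (simp add: bounded_op_def)

lemma p_add: "p (\<xi> + \<eta>) = p \<xi> + p \<eta>" and p_scale: "p (sL c \<xi>) = sL c (p \<xi>)"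
  using p_linear by (simp_all add: Vector_Spaces.linear_iff)

lemma D_lin: "g \<in> carr D \<Longrightarrow> lin_on (sub_nsp sL Z) (*) g"
  by (simp add: dual_simps)

lemma D_add: "g \<in> carr D \<Longrightarrow> y \<in> Z \<Longrightarrow> z \<in> Z \<Longrightarrow> g (y + z) = g y + g z"
  and D_scale: "g \<in> carr D \<Longrightarrow> z \<in> Z \<Longrightarrow> g (sL c z) = c * g z"
  and D_off: "g \<in> carr D \<Longrightarrow> z \<notin> Z \<Longrightarrow> g z = 0"
  by (auto simp: dual_simps lin_on_def)

text \<open>Composition with \<open>p\<close> extends a functional from \<open>Z\<close> to the base
  space; by the next lemma its norm does not grow.\<close>

lemma D_p_linear: "g \<in> carr D \<Longrightarrow> Vector_Spaces.linear sL (*) (\<lambda>\<xi>. g (p \<xi>))"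
  by (simp add: linear_functional_iff p_add p_scale D_add D_scale p(4))

lemma D_p_bound: "g \<in> carr D \<Longrightarrow> norm (g (p \<xi>)) \<le> nrm D g * norm \<xi>"
  using dual_bound[OF seminormed_Z, of g "p \<xi>"] p(3,4)[of \<xi>] seminormedD(2)[OF seminormed_D, of g]
  by (simp add: order_trans[OF _ mult_left_mono])

lemma res_in:
  assumes f: "Vector_Spaces.linear sL (*) f" and C: "\<And>\<xi>. norm (f \<xi>) \<le> C * norm \<xi>"
  shows "res f \<in> carr D"
proof -
  have "lin_on (sub_nsp sL Z) (*) (res f)"
    using f Z_subspace by (auto simp: lin_on_def res_def linear_functional_iff subspace_add subspace_scale)
  moreover have "\<exists>C. \<forall>x\<in>carr (sub_nsp sL Z). norm (res f x) \<le> C * nrm (sub_nsp sL Z) x"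
    using C by (intro exI[of _ C]) (auto simp: res_def)
  moreover have "\<forall>x. x \<notin> carr (sub_nsp sL Z) \<longrightarrow> res f x = 0" by (simp add: res_def)
  ultimately show ?thesis unfolding dual_simps by blast
qed

lemma res_fs_in: "s \<in> S \<Longrightarrow> res (fs s) \<in> carr D"
  using res_in[OF fs] fs_bdd by metis

text \<open>Expansion in the dual basis: apply \<open>g\<close> to the coordinate expansion of a
  vector of \<open>Z\<close>. Off \<open>Z\<close> both sides vanish by normalisation.\<close>

lemma D_expand:
  assumes g: "g \<in> carr D"
  shows "g = (\<Sum>s\<in>S. pscale (g s) (res (fs s)))"
proof
  fix z
  show "g z = (\<Sum>s\<in>S. pscale (g s) (res (fs s))) z"
  proof (cases "z \<in> Z")
    case True
    have "g z = g (\<Sum>s\<in>S. sL (fs s z) s)" using expand[OF True] by simp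
    also have "\<dots> = (\<Sum>s\<in>S. g (sL (fs s z) s))"
      using Z_subspace S_Z
      by (intro lin_on_sum[OF seminormedD(1)[OF seminormed_Z] D_lin[OF g]]) (simp add: subspace_scale)
    also have "\<dots> = (\<Sum>s\<in>S. fs s z * g s)" by (intro sum.cong refl D_scale g S_Z)
    finally show ?thesis using True by (simp add: sum_fun_apply pscale_def res_def mult.commute)
  next
    case False
    then show ?thesis using D_off[OF g] by (simp add: sum_fun_apply pscale_def res_def)
  qed
qed

lemma canon_in: "canon \<in> ltensor sL D"
  unfolding canon_def by (intro ltensor_sum etensor_in res_fs_in)

lemma canon_eval: "B \<in> bilin sL D \<Longrightarrow> canon B = (\<Sum>s\<in>S. B s (res (fs s)))"
  by (simp add: canon_def sum_fun_apply etensor_def)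

text \<open>Pairing the identity of \<open>Z\<close> with f \<otimes> h must evaluate h at f
  restricted to \<open>Z\<close>; in coordinates this is the dual basis expansion of
  \<open>res f\<close>.\<close>

lemma canon_eval_tensor:
  assumes h: "lin_on D (*) h" and f: "Vector_Spaces.linear sL (*) f"
    and C: "\<And>\<xi>. norm (f \<xi>) \<le> C * norm \<xi>"
  shows "canon (\<lambda>\<xi> g. f \<xi> * h g) = h (res f)"
proof -
  have "h (res f) = h (\<Sum>s\<in>S. pscale (res f s) (res (fs s)))"
    using D_expand[OF res_in[OF f C]] by simp
  also have "\<dots> = (\<Sum>s\<in>S. h (pscale (res f s) (res (fs s))))"
    using linear_spaceD(5)[OF linear_space_D] res_fs_in
    by (intro lin_on_sum[OF linear_space_D h]) (simp add: dual_simps(1))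
  also have "\<dots> = (\<Sum>s\<in>S. f s * h (res (fs s)))"
  proof (intro sum.cong refl)
    fix s assume s: "s \<in> S"
    have "h (pscale (res f s) (res (fs s))) = res f s * h (res (fs s))"
      using h res_fs_in[OF s] by (simp add: lin_on_def dual_simps(1))
    then show "h (pscale (res f s) (res (fs s))) = f s * h (res (fs s))"
      using S_Z[OF s] by (simp add: res_def)
  qed
  also have "\<dots> = canon (\<lambda>\<xi> g. f \<xi> * h g)" by (simp add: canon_eval tensor_functional_bilin f h)
  finally show ?thesis ..
qed

text \<open>By the preceding evaluation the supremum runs over numbers h (res f) with f and h of
  norm at most 1, and restriction does not increase norms.\<close>

lemma inj_norm_canon: "inj_norm sL D canon \<le> 1"
proof (rule inj_norm_least[OF seminormed_D])
  fix f h assume f: "Vector_Spaces.linear sL (*) f" "\<And>\<xi>. norm (f \<xi>) \<le> norm \<xi>"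
    and h: "h \<in> unit_ball (dual D)"
  have f1: "norm (f \<xi>) \<le> 1 * norm \<xi>" for \<xi> using f(2) by simp
  have "lin_on D (*) h" using h unit_ball_dual_iff[OF seminormed_D] by blast
  then have "canon (\<lambda>\<xi> g. f \<xi> * h g) = h (res f)" by (rule canon_eval_tensor[OF _ f(1) f1])
  also have "norm \<dots> \<le> nrm D (res f)"
    using h res_in[OF f(1) f1] unit_ball_dual_iff[OF seminormed_D] by blast
  also have "\<dots> \<le> 1" using f(2) by (intro dual_nrm_le[OF seminormed_Z]) (auto simp: res_def)
  finally show "norm (canon (\<lambda>\<xi> g. f \<xi> * h g)) \<le> 1" .
qed

lemma act_p_canon: "act sL D p canon = canon"
  unfolding canon_def act_sum
  by (intro sum.cong refl) (simp add: act_etensor[OF p_linear res_fs_in] p(2) S_Z)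

text \<open>A tensor v is an operator from \<open>Z\<close> to the base space, and \<open>a\<close>
  is this operator preceded by \<open>p\<close>; letting it act on the identity of \<open>Z\<close>
  returns v. Since \<open>a\<close> factors through \<open>p\<close>, its norm is seen by
  functionals on the dual of \<open>Z\<close>.\<close>

lemma tensor_eq_act_canon:
  assumes v: "v \<in> ltensor sL D"
  obtains a where "bounded_op sL a" "onorm a \<le> inj_norm sL D v" "act sL D a canon = v"
proof -
  \<comment> \<open>The last conjunct is carried through the induction for the norm estimate:
    slicing v at \<open>p \<xi>\<close> reads off \<open>a \<xi>\<close>.\<close>
  have "\<exists>a. bounded_op sL a \<and> act sL D a canon = v \<and>
      (\<forall>f \<xi>. Vector_Spaces.linear sL (*) f \<longrightarrow> v (\<lambda>\<eta> g. f \<eta> * g (p \<xi>)) = f (a \<xi>))"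
    using v
  proof (induction rule: ltensor_induct)
    case zero
    have b: "bounded_op sL (\<lambda>_. 0)"
      using vector_space_axioms by (simp add: bounded_op_def Vector_Spaces.linear_iff)
    then have l: "Vector_Spaces.linear sL sL (\<lambda>_. 0)" by (simp add: bounded_op_def)
    have "act sL D (\<lambda>_. 0) canon = 0"
      unfolding canon_def act_sum
      by (intro sum.neutral ballI) (simp add: act_etensor[OF l res_fs_in] etensor_0_left[OF res_fs_in])
    moreover have "f 0 = 0" if "Vector_Spaces.linear sL (*) f" for f :: "'l \<Rightarrow> 'k"
      using that unfolding linear_functional_iff by (metis add_cancel_right_right)
    ultimately show ?case using b by (intro exI[of _ "\<lambda>_. 0"]) (simp add: zero_fun_apply)
  next
    case (elem \<eta> g)
    \<comment> \<open>The rank-one operator that \<eta> \<otimes> g stands for, extended from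
      \<open>Z\<close> by \<open>p\<close>.\<close>
    define a where "a \<xi> = sL (g (p \<xi>)) \<eta>" for \<xi>
    have l: "Vector_Spaces.linear sL sL a"
      using vector_space_axioms D_p_linear[OF elem]
      by (simp add: Vector_Spaces.linear_iff linear_functional_iff a_def scale_left_distrib)
    have "bounded_linear a"
    proof (rule bounded_linear_intro)
      show "a (x + y) = a x + a y" for x y using l by (simp add: Vector_Spaces.linear_iff)
      show "a (r *\<^sub>R x) = r *\<^sub>R a x" for r x
        using l unfolding Vector_Spaces.linear_iff smul_of_real[symmetric] by blast
      show "norm (a x) \<le> norm x * (nrm D g * norm \<eta>)" for x
        using mult_right_mono[OF D_p_bound[OF elem, of x], of "norm \<eta>"]
        by (simp add: a_def norm_smul algebra_simps)
    qed
    moreover have "act sL D a canon = etensor sL D \<eta> g"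
    proof -
      have "act sL D a canon = (\<Sum>s\<in>S. etensor sL D \<eta> (pscale (g s) (res (fs s))))"
        unfolding canon_def act_sum
      proof (intro sum.cong refl)
        fix s assume s: "s \<in> S"
        show "act sL D a (etensor sL D s (res (fs s))) = etensor sL D \<eta> (pscale (g s) (res (fs s)))"
          using etensor_bilinear(3,4)[OF res_fs_in[OF s] res_fs_in[OF s], of sL]
          by (simp add: act_etensor[OF l res_fs_in[OF s]] a_def p(2) S_Z s dual_simps(1))
      qed
      also have "\<dots> = etensor sL D \<eta> (\<Sum>s\<in>S. pscale (g s) (res (fs s)))"
        using linear_spaceD(5)[OF linear_space_D] res_fs_in
        by (intro etensor_sum_right[symmetric] linear_space_D) (simp add: dual_simps(1))
      finally show ?thesis using D_expand[OF elem] by simp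
    qed
    moreover have "etensor sL D \<eta> g (\<lambda>\<eta> g. f \<eta> * g (p \<xi>)) = f (a \<xi>)"
      if f: "Vector_Spaces.linear sL (*) f" for f \<xi>
    proof -
      have "lin_on D (*) (\<lambda>g. g (p \<xi>))" by (simp add: lin_on_def dual_simps(1) plus_fun_apply pscale_def)
      then show ?thesis using f
        by (simp add: etensor_def tensor_functional_bilin a_def linear_functional_iff mult.commute)
    qed
    ultimately show ?case using l by (intro exI[of _ a]) (simp add: bounded_op_def)
  next
    case (add u v)
    from add.IH(1) obtain a where a: "bounded_op sL a" "act sL D a canon = u"
        "\<forall>f \<xi>. Vector_Spaces.linear sL (*) f \<longrightarrow> u (\<lambda>\<eta> g. f \<eta> * g (p \<xi>)) = f (a \<xi>)"
      by (elim exE conjE)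
    from add.IH(2) obtain b where b: "bounded_op sL b" "act sL D b canon = v"
        "\<forall>f \<xi>. Vector_Spaces.linear sL (*) f \<longrightarrow> v (\<lambda>\<eta> g. f \<eta> * g (p \<xi>)) = f (b \<xi>)"
      by (elim exE conjE)
    have la: "Vector_Spaces.linear sL sL a" "bounded_linear a"
      and lb: "Vector_Spaces.linear sL sL b" "bounded_linear b" using a b by (auto simp: bounded_op_def)
    have l: "Vector_Spaces.linear sL sL (\<lambda>\<xi>. a \<xi> + b \<xi>)"
      using la(1) lb(1) by (simp add: Vector_Spaces.linear_iff scale_right_distrib)
    have "bounded_op sL (\<lambda>\<xi>. a \<xi> + b \<xi>)"
      using l la(2) lb(2) by (simp add: bounded_op_def bounded_linear_add)
    moreover have "act sL D (\<lambda>\<xi>. a \<xi> + b \<xi>) canon = u + v"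
      using act_add_op[OF la(1) lb(1) l canon_in] a b by simp
    ultimately show ?case using a(3) b(3)
      by (intro exI[of _ "\<lambda>\<xi>. a \<xi> + b \<xi>"]) (simp add: plus_fun_apply linear_functional_iff)
  qed
  then obtain a where a: "bounded_op sL a" "act sL D a canon = v"
    "\<forall>f \<xi>. Vector_Spaces.linear sL (*) f \<longrightarrow> v (\<lambda>\<eta> g. f \<eta> * g (p \<xi>)) = f (a \<xi>)"
    by (elim exE conjE)
  have "onorm a \<le> inj_norm sL D v"
  proof (rule onorm_bound)
    show "inj_norm sL D v \<ge> 0" by (rule inj_norm_seminorm[OF seminormed_D v])
    fix \<xi>
    \<comment> \<open>Hahn-Banach enters here. Evaluation at \<open>p \<xi>\<close> is a functional
      on the dual of \<open>Z\<close> bounded by norm \<xi>, so for f norming \<open>a \<xi>\<close>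
      the injective norm of v controls norm (a \<xi>).\<close>
    obtain f where f: "Vector_Spaces.linear sL (*) f" "\<And>x. norm (f x) \<le> norm x"
      "norm (f (a \<xi>)) = norm (a \<xi>)" using norming_functional[of "a \<xi>"] by blast
    have "lin_on D (*) (\<lambda>g. g (p \<xi>))" by (simp add: lin_on_def dual_simps(1) plus_fun_apply pscale_def)
    then have "norm (v (\<lambda>\<eta> g. f \<eta> * g (p \<xi>))) \<le> 1 * norm \<xi> * inj_norm sL D v"
      using f D_p_bound[of _ \<xi>]
      by (intro inj_norm_upper[OF seminormed_D v f(1)]) (auto simp: mult.commute)
    moreover have "v (\<lambda>\<eta> g. f \<eta> * g (p \<xi>)) = f (a \<xi>)" using a(3) f(1) by blast
    ultimately show "norm (a \<xi>) \<le> inj_norm sL D v * norm \<xi>" using f(3) by (simp add: mult.commute)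
  qed
  with a that show thesis by blast
qed

text \<open>Definiteness is the property still missing: if the injective norm is 0, the representing
  operator \<open>a\<close> is 0, and so is its action on the canonical tensor.\<close>

lemma L_space_MIN: "L_space sL (MIN_space sL D)"
proof -
  have "u = 0" if u: "u \<in> ltensor sL D" and 0: "inj_norm sL D u = 0" for u
  proof -
    obtain a where a: "bounded_op sL a" "onorm a \<le> inj_norm sL D u" "act sL D a canon = u"
      using tensor_eq_act_canon[OF u] .
    have l: "Vector_Spaces.linear sL sL a" "bounded_linear a" using a(1) by (auto simp: bounded_op_def)
    have "a \<xi> = 0" for \<xi>
    proof -
      have "onorm a * norm \<xi> \<le> 0" using a(2) 0 by (intro mult_nonpos_nonneg) auto
      then have "norm (a \<xi>) \<le> 0" using onorm[OF l(2), of \<xi>] by linarith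
      then show ?thesis by simp
    qed
    then have "act sL D a canon = 0"
      unfolding canon_def act_sum
      by (intro sum.neutral ballI) (simp add: act_etensor[OF l(1) res_fs_in] etensor_0_left[OF res_fs_in])
    then show ?thesis using a by simp
  qed
  then show ?thesis
    unfolding L_space_def MIN_space_simps MIN_space_tensor
    using inj_norm_seminorm[OF seminormed_D] linear_space_D by blast
qed

text \<open>Amplification commutes with the action, so the image of a \<cdot> w is \<open>a\<close>
  acting on the image of w; the module estimate in E and \<open>onorm a\<close> \<le>
  \<open>inj_norm sL D v\<close> give the bound.\<close>

lemma Lb_le_MIN:
  assumes \<phi>: "lin_op D E \<phi>" and E: "L_space sL E"
  shows "Lb_le sL (MIN_space sL D) E \<phi> (lnorm E (amplify sL E \<phi> canon))"
  unfolding Lb_le_def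
proof (intro conjI ballI)
  show "lin_op (MIN_space sL D) E \<phi>" using \<phi> by simp
  fix v assume v: "v \<in> ltensor sL (MIN_space sL D)"
  then obtain a where a: "bounded_op sL a" "onorm a \<le> inj_norm sL D v" "act sL D a canon = v"
    using tensor_eq_act_canon[of v] by auto
  have l: "Vector_Spaces.linear sL sL a" using a(1) by (simp add: bounded_op_def)
  have w: "amplify sL E \<phi> canon \<in> ltensor sL E" by (rule amplify_in[OF \<phi> canon_in])
  have "lnorm E (amplify sL E \<phi> v) = lnorm E (act sL E a (amplify sL E \<phi> canon))"
    using amplify_act[OF \<phi> l canon_in] a(3) by simp
  also have "\<dots> \<le> onorm a * lnorm E (amplify sL E \<phi> canon)" by (rule L_spaceD(6)[OF E a(1) w])
  also have "\<dots> \<le> inj_norm sL D v * lnorm E (amplify sL E \<phi> canon)"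
    by (intro mult_right_mono a(2) L_spaceD(2)[OF E w])
  finally show "lnorm E (amplify sL E \<phi> v) \<le> lnorm E (amplify sL E \<phi> canon) * lnorm (MIN_space sL D) v"
    by (simp add: mult.commute)
qed

text \<open>For \<xi> \<otimes> x take g \<mapsto> g (p \<xi>) x: the coordinates of
  \<open>p \<xi>\<close> move to the left factor and reassemble to \<open>p \<xi>\<close>. Since the
  left factors of \<open>canon\<close> lie in \<open>Z\<close>, only the part p \<cdot> u of u can
  be reached.\<close>

lemma operator_of_tensor:
  assumes E: "linear_space E" and u: "u \<in> ltensor sL E"
  obtains \<phi> where "lin_op D E \<phi>" "amplify sL E \<phi> canon = act sL E p u"
proof -
  interpret E: module "smul E" by (rule linear_spaceD(2)[OF E])
  have "\<exists>\<phi>. lin_op D E \<phi> \<and> amplify sL E \<phi> canon = act sL E p u"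
    using u
  proof (induction rule: ltensor_induct)
    case zero
    have l: "lin_op D E (\<lambda>_. 0)" by (rule lin_opI) (simp_all add: linear_spaceD(3)[OF E])
    have "amplify sL E (\<lambda>_. 0) canon = 0"
      unfolding canon_def amplify_sum
      by (intro sum.neutral ballI) (simp add: amplify_etensor[OF l res_fs_in] etensor_0_right[OF E])
    with l show ?case by (intro exI[of _ "\<lambda>_. 0"]) simp
  next
    case (elem \<xi> x)
    define \<phi> where "\<phi> g = smul E (g (p \<xi>)) x" for g
    have l: "lin_op D E \<phi>"
      by (rule lin_opI)
        (simp_all add: \<phi>_def plus_fun_apply pscale_def dual_simps(1) E.scale_left_distrib linear_spaceD(5)[OF E] elem)
    have "amplify sL E \<phi> canon = (\<Sum>s\<in>S. etensor sL E (sL (fs s (p \<xi>)) s) x)"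
      unfolding canon_def amplify_sum
    proof (intro sum.cong refl)
      fix s assume s: "s \<in> S"
      have "\<phi> (res (fs s)) = smul E (fs s (p \<xi>)) x" using p(4) by (simp add: \<phi>_def res_def)
      then show "amplify sL E \<phi> (etensor sL D s (res (fs s))) = etensor sL E (sL (fs s (p \<xi>)) s) x"
        using etensor_bilinear(3,4)[OF elem elem, of sL]
        by (simp add: amplify_etensor[OF l res_fs_in[OF s]])
    qed
    also have "\<dots> = etensor sL E (p \<xi>) x"
      using expand[OF p(4)[of \<xi>]] by (simp add: etensor_sum_left[OF elem, symmetric])
    finally show ?case using l by (intro exI[of _ \<phi>]) (simp add: act_etensor[OF p_linear elem])
  next
    case (add u v)
    then obtain \<phi> \<psi> where l: "lin_op D E \<phi>" "lin_op D E \<psi>"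
      and e: "amplify sL E \<phi> canon = act sL E p u" "amplify sL E \<psi> canon = act sL E p v" by blast
    \<comment> \<open>The sum of two operators is written as a sum over the two truth values, so
      that the lemmas on finite sums of operators apply.\<close>
    define T where "T i = (if i then \<phi> else \<psi>)" for i :: bool
    have "lin_op D E (T i)" for i using l by (simp add: T_def)
    then have "lin_op D E (\<lambda>x. \<Sum>i\<in>UNIV. T i x)"
      "amplify sL E (\<lambda>x. \<Sum>i\<in>UNIV. T i x) canon = (\<Sum>i\<in>UNIV. amplify sL E (T i) canon)"
      by (auto intro: lin_op_sum amplify_sum_op E canon_in)
    then show ?case
      by (intro exI[of _ "\<lambda>x. \<Sum>i\<in>UNIV. T i x"]) (simp add: UNIV_bool T_def e act_add add.commute)
  qed
  then show thesis using that by blast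
qed

text \<open>Pairing the amplified canonical tensor with (g composed with \<open>p\<close>) \<otimes>
  h yields h (\<phi> g). As functionals h separate the vectors of E, the one tensor determines the
  operator on all of the dual of \<open>Z\<close>.\<close>

lemma operator_eqI:
  assumes E: "linear_space E" and \<phi>: "lin_op D E \<phi>" and \<psi>: "lin_op D E \<psi>"
    and eq: "amplify sL E \<phi> canon = amplify sL E \<psi> canon" and g: "g \<in> carr D"
  shows "\<phi> g = \<psi> g"
proof (rule ccontr)
  assume "\<phi> g \<noteq> \<psi> g"
  then obtain h where h: "Vector_Spaces.linear (smul E) (*) h" "h (\<phi> g) \<noteq> (h (\<psi> g) :: 'k)"
    using exists_separating_functional[OF linear_spaceD(1)[OF E]] by blast
  have hE: "lin_on E (*) h" using h(1) by (simp add: lin_on_def Vector_Spaces.linear_iff)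
  define B where "B = (\<lambda>\<xi> x. g (p \<xi>) * h x)"
  have B: "B \<in> bilin sL E" unfolding B_def by (rule tensor_functional_bilin[OF D_p_linear[OF g] hE])
  have "amplify sL E \<theta> canon B = h (\<theta> g)" if \<theta>: "lin_op D E \<theta>" for \<theta>
  proof -
    have l: "lin_on D (*) (\<lambda>g. h (\<theta> g))"
      using h(1) lin_opD[OF \<theta>] by (simp add: lin_on_def Vector_Spaces.linear_iff)
    have "amplify sL E \<theta> canon B = canon (\<lambda>\<xi> g'. g (p \<xi>) * h (\<theta> g'))"
      using B by (simp add: amplify_def B_def)
    also have "\<dots> = h (\<theta> (res (\<lambda>\<xi>. g (p \<xi>))))"
      by (rule canon_eval_tensor[OF l D_p_linear[OF g] D_p_bound[OF g]])
    also have "res (\<lambda>\<xi>. g (p \<xi>)) = g" using p(2) D_off[OF g] by (auto simp: res_def fun_eq_iff)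
    finally show ?thesis .
  qed
  from this[OF \<phi>] this[OF \<psi>] eq h(2) show False by simp
qed

end

section \<open>Bounded coordinate functionals for complemented subspaces\<close>

context normed_space_over
begin

text \<open>One vector at a time: a norming functional for the part \<open>y\<close> of
  \<open>x\<close> beyond the span of \<open>S\<close> is corrected to vanish on \<open>S\<close>
  and scaled to 1 at \<open>x\<close>; the old functionals are then corrected at \<open>x\<close>.
  Only norming functionals are combined, so boundedness on the whole base space is kept.\<close>

lemma exists_biorthogonal:
  assumes "finite S" "independent S"
  shows "\<exists>fs. \<forall>s\<in>S. Vector_Spaces.linear sL (*) (fs s) \<and> (\<exists>C. \<forall>\<xi>. norm (fs s \<xi>) \<le> C * norm \<xi>) \<and>
    (\<forall>t\<in>S. fs s t = (if s = t then 1 else (0::'k)))"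
  using assms
proof (induction S)
  case (insert x S)
  have ind: "independent S" "x \<notin> span S"
    using insert.hyps insert.prems by (auto simp: independent_insert)
  obtain fs where fs: "\<And>s. s \<in> S \<Longrightarrow> Vector_Spaces.linear sL (*) (fs s)"
    and bd: "\<And>s. s \<in> S \<Longrightarrow> \<exists>C. \<forall>\<xi>. norm (fs s \<xi>) \<le> C * norm \<xi>"
    and dl: "\<And>s t. s \<in> S \<Longrightarrow> t \<in> S \<Longrightarrow> fs s t = (if s = t then 1 else (0::'k))"
    using insert.IH[OF ind(1)] by metis
  define y where "y = x - (\<Sum>s\<in>S. sL (fs s x) s)"
  have "(\<Sum>s\<in>S. sL (fs s x) s) \<in> span S" by (intro span_sum span_scale span_base)
  then have "y \<noteq> 0" using ind(2) by (auto simp: y_def)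
  obtain f where f: "Vector_Spaces.linear sL (*) f" "\<And>\<xi>. norm (f \<xi>) \<le> norm \<xi>" "norm (f y) = norm y"
    using norming_functional[of y] by blast
  have fy: "f y \<noteq> 0" using f(3) \<open>y \<noteq> 0\<close> by auto
  interpret f: Vector_Spaces.linear sL "(*)" f by (rule f(1))
  \<comment> \<open>\<open>f y\<close> is the value at \<open>x\<close> of the bracket in
    \<open>g\<close> below, because \<open>y\<close> is \<open>x\<close> minus its coordinates over
    \<open>S\<close>.\<close>
  define c where "c = inverse (f y)"
  define g where "g \<xi> = c * (f \<xi> - (\<Sum>s\<in>S. f s * fs s \<xi>))" for \<xi>
  have gl: "Vector_Spaces.linear sL (*) g"
    using fs unfolding linear_functional_iff g_def
    by (auto simp: f.add f.scale sum.distrib sum_distrib_left algebra_simps)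
  have gS: "g t = 0" if "t \<in> S" for t
  proof -
    have "(\<Sum>s\<in>S. f s * fs s t) = (\<Sum>s\<in>S. if s = t then f s else 0)"
      using dl that by (intro sum.cong refl) simp
    then show ?thesis using that insert.hyps(1) by (simp add: g_def)
  qed
  have "f y = f x - (\<Sum>s\<in>S. f s * fs s x)"
    by (simp add: y_def f.diff f.sum f.scale mult.commute)
  then have gx: "g x = 1" using fy by (simp add: g_def c_def)
  have gb: "\<exists>C. \<forall>\<xi>. norm (g \<xi>) \<le> C * norm \<xi>"
  proof -
    from bd obtain C where C: "\<And>s \<xi>. s \<in> S \<Longrightarrow> norm (fs s \<xi>) \<le> C s * norm \<xi>" by metis
    have "norm (g \<xi>) \<le> norm c * (1 + (\<Sum>s\<in>S. norm (f s) * C s)) * norm \<xi>" for \<xi>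
    proof -
      have "norm (\<Sum>s\<in>S. f s * fs s \<xi>) \<le> (\<Sum>s\<in>S. norm (f s) * (C s * norm \<xi>))"
        using C by (intro sum_norm_le) (simp add: norm_mult mult_left_mono)
      then have "norm (f \<xi> - (\<Sum>s\<in>S. f s * fs s \<xi>)) \<le> norm \<xi> + (\<Sum>s\<in>S. norm (f s) * (C s * norm \<xi>))"
        using f(2)[of \<xi>] norm_triangle_ineq4[of "f \<xi>" "\<Sum>s\<in>S. f s * fs s \<xi>"] by linarith
      then have "norm c * norm (f \<xi> - (\<Sum>s\<in>S. f s * fs s \<xi>)) \<le>
          norm c * (norm \<xi> + (\<Sum>s\<in>S. norm (f s) * (C s * norm \<xi>)))"
        by (rule mult_left_mono) simp
      moreover have "norm (g \<xi>) = norm c * norm (f \<xi> - (\<Sum>s\<in>S. f s * fs s \<xi>))"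
        by (simp only: g_def norm_mult)
      moreover have "norm c * (norm \<xi> + (\<Sum>s\<in>S. norm (f s) * (C s * norm \<xi>))) =
          norm c * (1 + (\<Sum>s\<in>S. norm (f s) * C s)) * norm \<xi>"
        by (simp add: algebra_simps sum_distrib_right sum_distrib_left)
      ultimately show ?thesis by simp
    qed
    then show ?thesis by blast
  qed
  define fs' where "fs' s = (if s = x then g else (\<lambda>\<xi>. fs s \<xi> - fs s x * g \<xi>))" for s
  have nx: "s \<noteq> x" if "s \<in> S" for s using that insert.hyps by auto
  show ?case
  proof (intro exI[of _ fs'] ballI conjI)
    fix s assume s: "s \<in> insert x S"
    show "Vector_Spaces.linear sL (*) (fs' s)"
      using s gl fs unfolding fs'_def linear_functional_iff by (auto simp: algebra_simps)
    show "\<exists>C. \<forall>\<xi>. norm (fs' s \<xi>) \<le> C * norm \<xi>"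
    proof (cases "s = x")
      case False
      then obtain C where C: "\<And>\<xi>. norm (fs s \<xi>) \<le> C * norm \<xi>" using bd s by auto
      obtain D where D: "\<And>\<xi>. norm (g \<xi>) \<le> D * norm \<xi>" using gb by blast
      have "norm (fs' s \<xi>) \<le> (C + norm (fs s x) * D) * norm \<xi>" for \<xi>
      proof -
        have "norm (fs' s \<xi>) \<le> norm (fs s \<xi>) + norm (fs s x) * norm (g \<xi>)"
          using False norm_triangle_ineq4[of "fs s \<xi>" "fs s x * g \<xi>"] by (simp add: fs'_def norm_mult)
        also have "\<dots> \<le> C * norm \<xi> + norm (fs s x) * (D * norm \<xi>)"
          by (intro add_mono mult_left_mono C D) simp
        finally show ?thesis by (simp add: algebra_simps)
      qed
      then show ?thesis by blast
    qed (use gb in \<open>simp add: fs'_def\<close>)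
    fix t assume t: "t \<in> insert x S"
    show "fs' s t = (if s = t then 1 else 0)"
      using s t gx gS dl nx by (auto simp: fs'_def)
  qed
qed simp

text \<open>A spanning set is thinned to an independent one, for which biorthogonal functionals
  exist. They reproduce the vectors of \<open>S\<close> and thus, by linearity, all of
  \<open>Z\<close>.\<close>

lemma fd_complemented_exists:
  assumes "fin_dim sL Z" "contractively_complemented sL Z"
  obtains p S fs where "fd_complemented sL Z p S fs"
proof -
  obtain T where T: "finite T" "Z = span T" using assms(1) by (auto simp: fin_dim_def)
  obtain S where S: "S \<subseteq> T" "independent S" "T \<subseteq> span S" using maximal_independent_subset[of T] by blast
  have finS: "finite S" using S(1) T(1) by (rule finite_subset)
  have Z: "Z = span S" using S T(2) by (metis span_mono span_span subset_antisym)
  obtain fs where fs: "\<And>s. s \<in> S \<Longrightarrow> Vector_Spaces.linear sL (*) (fs s)"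
    and bd: "\<And>s. s \<in> S \<Longrightarrow> \<exists>C. \<forall>\<xi>. norm (fs s \<xi>) \<le> C * norm \<xi>"
    and dl: "\<And>s t. s \<in> S \<Longrightarrow> t \<in> S \<Longrightarrow> fs s t = (if s = t then 1 else (0::'k))"
    using exists_biorthogonal[OF finS S(2)] by metis
  obtain p where p: "bounded_op sL p" "p \<circ> p = p" "onorm p \<le> 1" "range p = Z"
    using assms(2) by (auto simp: contractively_complemented_def)
  have bl: "bounded_linear p" using p(1) by (simp add: bounded_op_def)
  have ex: "z = (\<Sum>s\<in>S. sL (fs s z) s)" if "z \<in> Z" for z
    using that unfolding Z
  proof (induction rule: span_induct_alt)
    case base
    have "fs s 0 = 0" if "s \<in> S" for s
      using fs[OF that] unfolding linear_functional_iff by (metis add_cancel_right_right)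
    then show ?case by simp
  next
    case (step c x y)
    have "(\<Sum>s\<in>S. sL (fs s (sL c x + y)) s) = (\<Sum>s\<in>S. (if s = x then sL c s else 0) + sL (fs s y) s)"
      using fs dl step.hyps
      by (intro sum.cong refl) (auto simp: linear_functional_iff scale_left_distrib)
    also have "\<dots> = sL c x + y" using step finS by (simp add: sum.distrib)
    finally show ?case by simp
  qed
  have np: "norm (p \<xi>) \<le> norm \<xi>" for \<xi>
    using onorm[OF bl, of \<xi>] mult_right_mono[OF p(3), of "norm \<xi>"] by simp
  have pz: "p z = z" if "z \<in> Z" for z using that p(2,4) by (metis comp_apply imageE)
  have "fd_complemented sL Z p S fs"
  proof (intro fd_complemented.intro normed_space_over_axioms fd_complemented_axioms.intro)
    show "p \<xi> \<in> Z" for \<xi> using p(4) by blast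
  qed (fact finS Z fs bd ex p(1) pz np)+
  then show thesis by (rule that)
qed

end

section \<open>Direct sums\<close>

lemma pscale_0: "pscale c 0 = (0 :: 'a \<Rightarrow> 'k::field)"
  by (simp add: pscale_def zero_fun_def)

lemma amplify_zero_op: "linear_space E \<Longrightarrow> u \<in> ltensor sL G \<Longrightarrow> amplify sL E (\<lambda>_. 0) u = 0"
  using amplify_sum_op[of E "{}" G _ u sL] by simp

text \<open>The scalar multiplication of \<open>oplus1\<close> acts at every index, also outside
  \<open>M\<close>, and must make the whole function type a vector space; hence \<open>vs\<close>
  ranges over all indices while \<open>L\<close> concerns \<open>M\<close> only.\<close>

locale l1_sum =
  fixes sL :: "'k::real_or_complex \<Rightarrow> 'l::real_normed_vector \<Rightarrow> 'l"
    and M :: "'i set" and E :: "'i \<Rightarrow> ('k, 'e::ab_group_add, 'l) lsp"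
  assumes vs: "\<And>\<mu>. vector_space (smul (E \<mu>))"
    and L: "\<And>\<mu>. \<mu> \<in> M \<Longrightarrow> L_space sL (E \<mu>)"
begin

abbreviation W :: "('k, 'i \<Rightarrow> 'e, 'l) lsp" where "W \<equiv> oplus1 sL M E"

definition cpt :: "'i \<Rightarrow> ('k, 'i \<Rightarrow> 'e, 'l) tensor \<Rightarrow> ('k, 'e, 'l) tensor" where
  "cpt \<mu> u = amplify sL (E \<mu>) (\<lambda>x. x \<mu>) u"

definition inc :: "'i \<Rightarrow> 'e \<Rightarrow> 'i \<Rightarrow> 'e" where
  "inc \<mu> x = (\<lambda>\<nu>. if \<nu> = \<mu> then x else 0)"

definition supp :: "('k, 'i \<Rightarrow> 'e, 'l) tensor \<Rightarrow> 'i set" where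
  "supp u = {\<mu> \<in> M. cpt \<mu> u \<noteq> 0}"

lemma carr_W: "x \<in> carr W \<longleftrightarrow>
    (\<forall>\<mu>\<in>M. x \<mu> \<in> carr (E \<mu>)) \<and> (\<forall>\<mu>. \<mu> \<notin> M \<longrightarrow> x \<mu> = 0) \<and> finite {\<mu>. x \<mu> \<noteq> 0}"
  and smul_W: "smul W c x = (\<lambda>\<mu>. smul (E \<mu>) c (x \<mu>))"
  and lnorm_W: "lnorm W u = (\<Sum>\<mu>\<in>supp u. lnorm (E \<mu>) (cpt \<mu> u))"
  by (simp_all add: oplus1_def supp_def cpt_def)

lemma ls: "\<mu> \<in> M \<Longrightarrow> linear_space (E \<mu>)"
  using L by (rule L_spaceD)

lemma mod: "module (smul (E \<mu>))"
  by (simp add: module_iff_vector_space vs)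

lemma linear_space_W: "linear_space W"
proof -
  have v: "vector_space (smul W)"
    unfolding vector_space_def smul_W
    using vs unfolding vector_space_def by (auto simp: fun_eq_iff plus_fun_apply)
  have m: "module (smul W)" using v unfolding module_iff_vector_space .
  have "module.subspace (smul W) (carr W)"
  proof (rule module.subspaceI[OF m])
    show "0 \<in> carr W" by (auto simp: carr_W zero_fun_apply linear_spaceD(3)[OF ls])
    show "x + y \<in> carr W" if "x \<in> carr W" "y \<in> carr W" for x y
    proof -
      have "{\<mu>. (x + y) \<mu> \<noteq> 0} \<subseteq> {\<mu>. x \<mu> \<noteq> 0} \<union> {\<mu>. y \<mu> \<noteq> 0}" by (auto simp: plus_fun_apply)
      then have "finite {\<mu>. (x + y) \<mu> \<noteq> 0}"
        using that by (auto simp: carr_W intro: finite_subset)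
      then show ?thesis using that by (simp add: carr_W plus_fun_apply linear_spaceD(4)[OF ls])
    qed
    show "smul W c x \<in> carr W" if "x \<in> carr W" for c x
    proof -
      have z: "smul (E \<mu>) c 0 = 0" for \<mu> by (rule module.scale_zero_right[OF mod])
      have "{\<mu>. smul W c x \<mu> \<noteq> 0} \<subseteq> {\<mu>. x \<mu> \<noteq> 0}" using z by (auto simp: smul_W)
      then have "finite {\<mu>. smul W c x \<mu> \<noteq> 0}"
        using that by (auto simp: carr_W intro: finite_subset)
      then show ?thesis using that z by (simp add: carr_W smul_W linear_spaceD(5)[OF ls])
    qed
  qed
  with v show ?thesis by (simp add: linear_space_def)
qed

lemma proj_lin: "\<mu> \<in> M \<Longrightarrow> lin_op W (E \<mu>) (\<lambda>x. x \<mu>)"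
  by (rule lin_opI) (simp_all add: carr_W smul_W plus_fun_apply)

lemma inc_lin:
  assumes "\<mu> \<in> M"
  shows "lin_op (E \<mu>) W (inc \<mu>)"
proof (rule lin_opI)
  show "inc \<mu> x \<in> carr W" if "x \<in> carr (E \<mu>)" for x
  proof -
    have "{\<nu>. inc \<mu> x \<nu> \<noteq> 0} \<subseteq> {\<mu>}" by (auto simp: inc_def)
    then have "finite {\<nu>. inc \<mu> x \<nu> \<noteq> 0}" by (rule finite_subset) simp
    then show ?thesis using that assms linear_spaceD(3)[OF ls] by (auto simp: carr_W inc_def)
  qed
  show "inc \<mu> (smul (E \<mu>) c x) = smul W c (inc \<mu> x)" for c x
    using module.scale_zero_right[OF mod] by (auto simp: inc_def smul_W fun_eq_iff)
qed (auto simp: inc_def fun_eq_iff plus_fun_apply)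

lemma carr_expand:
  assumes "finite A" "{\<mu>. x \<mu> \<noteq> 0} \<subseteq> A"
  shows "x = (\<Sum>\<mu>\<in>A. inc \<mu> (x \<mu>))"
proof
  fix \<nu>
  have "(\<Sum>\<mu>\<in>A. inc \<mu> (x \<mu>)) \<nu> = (\<Sum>\<mu>\<in>A. if \<nu> = \<mu> then x \<mu> else 0)"
    by (simp add: sum_fun_apply inc_def)
  then show "x \<nu> = (\<Sum>\<mu>\<in>A. inc \<mu> (x \<mu>)) \<nu>" using assms by auto
qed

lemma cpt_0: "cpt \<mu> 0 = 0"
  and cpt_add: "cpt \<mu> (u + v) = cpt \<mu> u + cpt \<mu> v"
  and cpt_scale: "cpt \<mu> (pscale c u) = pscale c (cpt \<mu> u)"
  by (simp_all only: cpt_def amplify_0 amplify_add amplify_scale)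

lemma cpt_etensor: "\<mu> \<in> M \<Longrightarrow> x \<in> carr W \<Longrightarrow> cpt \<mu> (etensor sL W \<xi> x) = etensor sL (E \<mu>) \<xi> (x \<mu>)"
  unfolding cpt_def by (rule amplify_etensor[OF proj_lin])

lemma cpt_act:
  "\<mu> \<in> M \<Longrightarrow> Vector_Spaces.linear sL sL a \<Longrightarrow> u \<in> ltensor sL W \<Longrightarrow>
    cpt \<mu> (act sL W a u) = act sL (E \<mu>) a (cpt \<mu> u)"
  unfolding cpt_def by (rule amplify_act[OF proj_lin])

lemma cpt_in: "\<mu> \<in> M \<Longrightarrow> u \<in> ltensor sL W \<Longrightarrow> cpt \<mu> u \<in> ltensor sL (E \<mu>)"
  unfolding cpt_def by (rule amplify_in[OF proj_lin])

lemma finite_supp: "u \<in> ltensor sL W \<Longrightarrow> finite (supp u)"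
proof (induction rule: ltensor_induct)
  case zero
  then show ?case by (simp add: supp_def cpt_0)
next
  case (elem \<xi> x)
  have "supp (etensor sL W \<xi> x) \<subseteq> {\<mu>. x \<mu> \<noteq> 0}"
    using elem by (auto simp: supp_def cpt_etensor etensor_0_right[OF ls])
  then show ?case using elem by (auto simp: carr_W intro: finite_subset)
next
  case (add u v)
  have "supp (u + v) \<subseteq> supp u \<union> supp v" by (auto simp: supp_def cpt_add)
  then show ?case using add by (auto intro: finite_subset)
qed

lemma supp_subset: "supp u \<subseteq> M"
  by (auto simp: supp_def)

text \<open>The norm sums over a support that depends on the tensor. Comparing two tensors takes a
  common index set, and terms outside the support contribute 0.\<close>

lemma sum_supp:
  assumes "finite A" "supp u \<subseteq> A" "A \<subseteq> M" "\<And>\<mu>. \<mu> \<in> M \<Longrightarrow> F \<mu> 0 = 0"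
  shows "(\<Sum>\<mu>\<in>supp u. F \<mu> (cpt \<mu> u)) = (\<Sum>\<mu>\<in>A. F \<mu> (cpt \<mu> u))"
  using assms by (intro sum.mono_neutral_left) (auto simp: supp_def)

lemma lnorm_W_eq:
  assumes "finite A" "supp u \<subseteq> A" "A \<subseteq> M"
  shows "lnorm W u = (\<Sum>\<mu>\<in>A. lnorm (E \<mu>) (cpt \<mu> u))"
  unfolding lnorm_W using L_spaceD(7)[OF L] by (intro sum_supp assms)

text \<open>The identification of the tensor product with the direct sum of the tensor products, in
  the encoding used here: a tensor is the sum of its components put back in place. For an elementary
  tensor this is the coordinate expansion of its right factor.\<close>

lemma decompose:
  assumes u: "u \<in> ltensor sL W"
  shows "u = (\<Sum>\<mu>\<in>supp u. amplify sL W (inc \<mu>) (cpt \<mu> u))"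
  using u
proof (induction rule: ltensor_induct)
  case zero
  then show ?case by (simp add: supp_def cpt_0)
next
  case (elem \<xi> x)
  define A where "A = {\<mu>. x \<mu> \<noteq> 0}"
  have A: "finite A" "A \<subseteq> M" "\<And>\<mu>. \<mu> \<in> M \<Longrightarrow> x \<mu> \<in> carr (E \<mu>)" using elem by (auto simp: carr_W A_def)
  have sA: "supp (etensor sL W \<xi> x) \<subseteq> A"
    using elem by (auto simp: supp_def A_def cpt_etensor etensor_0_right[OF ls])
  have "etensor sL W \<xi> x = etensor sL W \<xi> (\<Sum>\<mu>\<in>A. inc \<mu> (x \<mu>))"
    using carr_expand[OF A(1), of x] by (simp add: A_def)
  also have "\<dots> = (\<Sum>\<mu>\<in>A. etensor sL W \<xi> (inc \<mu> (x \<mu>)))"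
    using A lin_opD(1)[OF inc_lin] by (intro etensor_sum_right linear_space_W) blast
  also have "\<dots> = (\<Sum>\<mu>\<in>A. amplify sL W (inc \<mu>) (cpt \<mu> (etensor sL W \<xi> x)))"
  proof (intro sum.cong refl)
    fix \<mu> assume "\<mu> \<in> A"
    then have \<mu>: "\<mu> \<in> M" using A by blast
    show "etensor sL W \<xi> (inc \<mu> (x \<mu>)) = amplify sL W (inc \<mu>) (cpt \<mu> (etensor sL W \<xi> x))"
      by (simp only: cpt_etensor[OF \<mu> elem] amplify_etensor[OF inc_lin[OF \<mu>] A(3)[OF \<mu>]])
  qed
  also have "\<dots> = (\<Sum>\<mu>\<in>supp (etensor sL W \<xi> x). amplify sL W (inc \<mu>) (cpt \<mu> (etensor sL W \<xi> x)))"
    using A sA by (intro sum_supp[symmetric] amplify_0)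
  finally show ?case .
next
  case (add u v)
  define A where "A = supp u \<union> supp v"
  have A: "finite A" "A \<subseteq> M" using add finite_supp supp_subset by (auto simp: A_def)
  have s: "(\<Sum>\<mu>\<in>supp w. amplify sL W (inc \<mu>) (cpt \<mu> w)) = (\<Sum>\<mu>\<in>A. amplify sL W (inc \<mu>) (cpt \<mu> w))"
    if "supp w \<subseteq> A" for w
    using A that by (intro sum_supp amplify_0)
  have "supp (u + v) \<subseteq> A" by (auto simp: A_def supp_def cpt_add)
  then have "(\<Sum>\<mu>\<in>supp (u + v). amplify sL W (inc \<mu>) (cpt \<mu> (u + v))) =
      (\<Sum>\<mu>\<in>A. amplify sL W (inc \<mu>) (cpt \<mu> u)) + (\<Sum>\<mu>\<in>A. amplify sL W (inc \<mu>) (cpt \<mu> v))"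
    by (subst s) (simp_all only: cpt_add amplify_add sum.distrib)
  also have "\<dots> = (\<Sum>\<mu>\<in>supp u. amplify sL W (inc \<mu>) (cpt \<mu> u)) +
      (\<Sum>\<mu>\<in>supp v. amplify sL W (inc \<mu>) (cpt \<mu> v))"
    using s[of u] s[of v] by (simp only: A_def Un_upper1 Un_upper2)
  also have "\<dots> = u + v" by (simp only: add.IH(1)[symmetric] add.IH(2)[symmetric])
  finally show ?case by (rule sym)
qed

text \<open>Each axiom is summed over the components. Definiteness needs \<open>decompose\<close>: a
  tensor without nonzero components vanishes.\<close>

lemma L_space_W: "L_space sL W"
proof -
  have nn: "lnorm (E \<mu>) (cpt \<mu> u) \<ge> 0" if "\<mu> \<in> M" "u \<in> ltensor sL W" for \<mu> u
    using L_spaceD(2)[OF L] cpt_in that by blast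
  have nn': "lnorm W u \<ge> 0" if "u \<in> ltensor sL W" for u
    unfolding lnorm_W using nn that supp_subset by (intro sum_nonneg) blast
  have zero: "lnorm W u = 0 \<longleftrightarrow> u = 0" if u: "u \<in> ltensor sL W" for u
  proof
    assume "lnorm W u = 0"
    then have z: "\<forall>\<mu>\<in>supp u. lnorm (E \<mu>) (cpt \<mu> u) = 0"
      unfolding lnorm_W using nn u supp_subset by (subst (asm) sum_nonneg_eq_0_iff[OF finite_supp[OF u]]) blast+
    have "supp u = {}"
    proof (rule equals0I)
      fix \<mu> assume \<mu>: "\<mu> \<in> supp u"
      then have M: "\<mu> \<in> M" "cpt \<mu> u \<noteq> 0" by (auto simp: supp_def)
      show False using z \<mu> M(2) L_spaceD(3)[OF L[OF M(1)] cpt_in[OF M(1) u]] by blast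
    qed
    then show "u = 0" using decompose[OF u] by simp
  next
    assume "u = 0"
    then show "lnorm W u = 0" by (simp add: lnorm_W supp_def cpt_0)
  qed
  have scale: "lnorm W (pscale c u) = norm c * lnorm W u" if u: "u \<in> ltensor sL W" for c u
  proof -
    have "supp (pscale c u) \<subseteq> supp u" by (auto simp: supp_def cpt_scale pscale_0)
    then have "lnorm W (pscale c u) = (\<Sum>\<mu>\<in>supp u. lnorm (E \<mu>) (cpt \<mu> (pscale c u)))"
      using finite_supp[OF u] supp_subset by (intro lnorm_W_eq)
    also have "\<dots> = (\<Sum>\<mu>\<in>supp u. norm c * lnorm (E \<mu>) (cpt \<mu> u))"
      unfolding cpt_scale using supp_subset cpt_in[OF _ u] by (intro sum.cong refl L_spaceD(4)[OF L]) blast+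
    finally show ?thesis by (simp add: lnorm_W sum_distrib_left)
  qed
  have add: "lnorm W (u + v) \<le> lnorm W u + lnorm W v"
    if u: "u \<in> ltensor sL W" and v: "v \<in> ltensor sL W" for u v
  proof -
    define A where "A = supp u \<union> supp v"
    have A: "finite A" "A \<subseteq> M" "supp u \<subseteq> A" "supp v \<subseteq> A" "supp (u + v) \<subseteq> A"
      using u v finite_supp supp_subset by (auto simp: A_def supp_def cpt_add)
    have "lnorm W (u + v) = (\<Sum>\<mu>\<in>A. lnorm (E \<mu>) (cpt \<mu> u + cpt \<mu> v))"
      using A by (simp add: lnorm_W_eq[of A] cpt_add)
    also have "\<dots> \<le> (\<Sum>\<mu>\<in>A. lnorm (E \<mu>) (cpt \<mu> u) + lnorm (E \<mu>) (cpt \<mu> v))"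
      using A(2) cpt_in u v by (intro sum_mono L_spaceD(5)[OF L]) blast+
    also have "\<dots> = lnorm W u + lnorm W v" using A by (simp add: lnorm_W_eq[of A] sum.distrib)
    finally show ?thesis .
  qed
  have act: "lnorm W (act sL W a u) \<le> onorm a * lnorm W u"
    if a: "bounded_op sL a" and u: "u \<in> ltensor sL W" for a u
  proof -
    have l: "Vector_Spaces.linear sL sL a" using a by (simp add: bounded_op_def)
    have c: "cpt \<mu> (act sL W a u) = act sL (E \<mu>) a (cpt \<mu> u)" if "\<mu> \<in> M" for \<mu>
      using that l u by (rule cpt_act)
    have "supp (act sL W a u) \<subseteq> supp u"
    proof
      fix \<mu> assume "\<mu> \<in> supp (act sL W a u)"
      then have m: "\<mu> \<in> M" "cpt \<mu> (act sL W a u) \<noteq> 0" by (auto simp: supp_def)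
      have "cpt \<mu> u \<noteq> 0" using m(2) unfolding c[OF m(1)] by (metis act_0)
      with m(1) show "\<mu> \<in> supp u" by (simp add: supp_def)
    qed
    then have "lnorm W (act sL W a u) = (\<Sum>\<mu>\<in>supp u. lnorm (E \<mu>) (cpt \<mu> (act sL W a u)))"
      using finite_supp[OF u] supp_subset by (intro lnorm_W_eq)
    also have "\<dots> \<le> (\<Sum>\<mu>\<in>supp u. onorm a * lnorm (E \<mu>) (cpt \<mu> u))"
    proof (rule sum_mono)
      fix \<mu> assume "\<mu> \<in> supp u"
      then have m: "\<mu> \<in> M" using supp_subset by blast
      show "lnorm (E \<mu>) (cpt \<mu> (act sL W a u)) \<le> onorm a * lnorm (E \<mu>) (cpt \<mu> u)"
        unfolding c[OF m] by (rule L_spaceD(6)[OF L[OF m] a cpt_in[OF m u]])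
    qed
    finally show ?thesis by (simp add: lnorm_W sum_distrib_left)
  qed
  show ?thesis unfolding L_space_def using linear_space_W nn' zero scale add act by blast
qed

lemma cpt_inc:
  assumes \<mu>: "\<mu> \<in> M" and \<nu>: "\<nu> \<in> M" and v: "v \<in> ltensor sL (E \<mu>)"
  shows "cpt \<nu> (amplify sL W (inc \<mu>) v) = (if \<nu> = \<mu> then v else 0)"
proof -
  have "cpt \<nu> (amplify sL W (inc \<mu>) v) = amplify sL (E \<nu>) (\<lambda>x. inc \<mu> x \<nu>) v"
    unfolding cpt_def by (rule amplify_comp[OF inc_lin[OF \<mu>] proj_lin[OF \<nu>] v])
  also have "\<dots> = (if \<nu> = \<mu> then v else 0)"
    by (simp add: inc_def amplify_id[OF v] amplify_zero_op[OF ls[OF \<nu>] v])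
  finally show ?thesis .
qed

lemma lnorm_inc:
  assumes \<mu>: "\<mu> \<in> M" and v: "v \<in> ltensor sL (E \<mu>)"
  shows "lnorm W (amplify sL W (inc \<mu>) v) = lnorm (E \<mu>) v"
proof -
  have "supp (amplify sL W (inc \<mu>) v) \<subseteq> {\<mu>}"
    using cpt_inc[OF \<mu> _ v] by (auto simp: supp_def split: if_splits)
  then have "lnorm W (amplify sL W (inc \<mu>) v) = (\<Sum>\<nu>\<in>{\<mu>}. lnorm (E \<nu>) (cpt \<nu> (amplify sL W (inc \<mu>) v)))"
    using \<mu> by (intro lnorm_W_eq) auto
  then show ?thesis by (simp add: cpt_inc[OF \<mu> \<mu> v])
qed

text \<open>Universal property of the l1-sum: one bound \<open>C\<close> for all summands is enough,
  because the triangle inequality in G produces the sum of \<open>C\<close> times the component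
  norms, which is \<open>C\<close> times the norm of the sum space.\<close>

lemma glue:
  assumes G: "L_space sL G" and C: "C \<ge> 0" and \<psi>: "\<And>\<mu>. \<mu> \<in> M \<Longrightarrow> Lb_le sL (E \<mu>) G (\<psi> \<mu>) C"
  obtains \<theta> where "Lb_le sL W G \<theta> C" "\<And>\<mu> x. \<mu> \<in> M \<Longrightarrow> x \<in> carr (E \<mu>) \<Longrightarrow> \<theta> (inc \<mu> x) = \<psi> \<mu> x"
proof -
  have lG: "linear_space G" by (rule L_spaceD(1)[OF G])
  interpret G: module "smul G" by (rule linear_spaceD(2)[OF lG])
  have l: "lin_op (E \<mu>) G (\<psi> \<mu>)" if "\<mu> \<in> M" for \<mu> using \<psi>[OF that] by (rule Lb_leD)
  have \<psi>0: "\<psi> \<mu> 0 = 0" if "\<mu> \<in> M" for \<mu> by (rule lin_on_0[OF ls[OF that] lin_opD(4)[OF l[OF that]]])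
  define \<theta> where "\<theta> x = (\<Sum>\<mu> | x \<mu> \<noteq> 0. \<psi> \<mu> (x \<mu>))" for x
  \<comment> \<open>As \<open>\<psi> \<mu> 0 = 0\<close>, the sum may run over any larger finite
    subset of \<open>M\<close>; additivity uses one set for both arguments.\<close>
  have \<theta>: "\<theta> x = (\<Sum>\<mu>\<in>A. \<psi> \<mu> (x \<mu>))" if "finite A" "A \<subseteq> M" "{\<mu>. x \<mu> \<noteq> 0} \<subseteq> A" for x A
    unfolding \<theta>_def using that \<psi>0 by (intro sum.mono_neutral_left) auto
  have \<theta>lin: "lin_op W G \<theta>"
  proof (rule lin_opI)
    fix x assume x: "x \<in> carr W"
    then show "\<theta> x \<in> carr G"
      unfolding \<theta>_def using lin_opD(1)[OF l] by (intro linear_spaceD(7)[OF lG]) (auto simp: carr_W)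
    show "\<theta> (smul W c x) = smul G c (\<theta> x)" for c
    proof -
      define A where "A = {\<mu>. x \<mu> \<noteq> 0}"
      have A: "finite A" "A \<subseteq> M" using x by (auto simp: carr_W A_def)
      have "{\<mu>. smul W c x \<mu> \<noteq> 0} \<subseteq> A"
        using module.scale_zero_right[OF mod] by (auto simp: A_def smul_W)
      then have "\<theta> (smul W c x) = (\<Sum>\<mu>\<in>A. \<psi> \<mu> (smul W c x \<mu>))" by (intro \<theta> A)
      also have "\<dots> = (\<Sum>\<mu>\<in>A. smul G c (\<psi> \<mu> (x \<mu>)))"
        unfolding smul_W using A x lin_opD(3)[OF l] by (intro sum.cong refl) (auto simp: carr_W)
      also have "\<dots> = smul G c (\<theta> x)" by (simp add: \<theta>_def A_def G.scale_sum_right)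
      finally show ?thesis .
    qed
    fix y assume y: "y \<in> carr W"
    define A where "A = {\<mu>. x \<mu> \<noteq> 0} \<union> {\<mu>. y \<mu> \<noteq> 0}"
    have A: "finite A" "A \<subseteq> M" "{\<mu>. x \<mu> \<noteq> 0} \<subseteq> A" "{\<mu>. y \<mu> \<noteq> 0} \<subseteq> A" "{\<mu>. (x + y) \<mu> \<noteq> 0} \<subseteq> A"
      using x y by (auto simp: carr_W A_def plus_fun_apply)
    have "\<theta> (x + y) = (\<Sum>\<mu>\<in>A. \<psi> \<mu> (x \<mu> + y \<mu>))" using A by (simp add: \<theta>[of A] plus_fun_apply)
    also have "\<dots> = (\<Sum>\<mu>\<in>A. \<psi> \<mu> (x \<mu>) + \<psi> \<mu> (y \<mu>))"
      using A x y lin_opD(2)[OF l] by (intro sum.cong refl) (auto simp: carr_W)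
    also have "\<dots> = \<theta> x + \<theta> y" using A by (simp add: \<theta>[of A] sum.distrib)
    finally show "\<theta> (x + y) = \<theta> x + \<theta> y" .
  qed
  have \<theta>inc: "\<theta> (inc \<mu> x) = \<psi> \<mu> x" if "\<mu> \<in> M" for \<mu> x
  proof -
    have "\<theta> (inc \<mu> x) = (\<Sum>\<nu>\<in>{\<mu>}. \<psi> \<nu> (inc \<mu> x \<nu>))"
      using that by (intro \<theta>) (auto simp: inc_def)
    then show ?thesis by (simp add: inc_def)
  qed
  have "Lb_le sL W G \<theta> C"
    unfolding Lb_le_def
  proof (intro conjI ballI \<theta>lin)
    fix u assume u: "u \<in> ltensor sL W"
    have c: "cpt \<mu> u \<in> ltensor sL (E \<mu>)" "\<mu> \<in> M" if "\<mu> \<in> supp u" for \<mu>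
      using that cpt_in[OF _ u] by (auto simp: supp_def)
    have "amplify sL G \<theta> u = amplify sL G \<theta> (\<Sum>\<mu>\<in>supp u. amplify sL W (inc \<mu>) (cpt \<mu> u))"
      using decompose[OF u] by simp
    also have "\<dots> = (\<Sum>\<mu>\<in>supp u. amplify sL G (\<psi> \<mu>) (cpt \<mu> u))"
      unfolding amplify_sum
    proof (intro sum.cong refl)
      fix \<mu> assume "\<mu> \<in> supp u"
      note c = c[OF this]
      show "amplify sL G \<theta> (amplify sL W (inc \<mu>) (cpt \<mu> u)) = amplify sL G (\<psi> \<mu>) (cpt \<mu> u)"
        unfolding amplify_comp[OF inc_lin[OF c(2)] \<theta>lin c(1)] by (simp only: \<theta>inc[OF c(2)])
    qed
    finally have "lnorm G (amplify sL G \<theta> u) = lnorm G (\<Sum>\<mu>\<in>supp u. amplify sL G (\<psi> \<mu>) (cpt \<mu> u))"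
      by simp
    also have "\<dots> \<le> (\<Sum>\<mu>\<in>supp u. lnorm G (amplify sL G (\<psi> \<mu>) (cpt \<mu> u)))"
      by (rule lnorm_sum[OF G]) (rule amplify_in[OF l[OF c(2)] c(1)])
    also have "\<dots> \<le> (\<Sum>\<mu>\<in>supp u. C * lnorm (E \<mu>) (cpt \<mu> u))"
      using c Lb_leD(2)[OF \<psi>] by (intro sum_mono) blast
    also have "\<dots> = C * lnorm W u" by (simp add: lnorm_W sum_distrib_left)
    finally show "lnorm G (amplify sL G \<theta> u) \<le> C * lnorm W u" .
  qed
  with \<theta>inc that show thesis by blast
qed

end

section \<open>Lifting along coisometric operators\<close>

text \<open>The lifted tensor \<open>v\<close> need not come from an operator, but p \<cdot> v does.
  It still lifts the right tensor, since \<open>u\<close> is the image of \<open>canon\<close>,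
  which \<open>p\<close> fixes. The constant \<open>K\<close> is 1 for strictly coisometric and 1 +
  \<delta> for coisometric \<tau>.\<close>

lemma (in fd_complemented) lift_MIN:
  assumes G: "L_space sL G" and E: "L_space sL E" and \<tau>: "lin_op G E \<tau>" and K: "K \<ge> 0" and C: "C \<ge> 0"
    and lift: "\<And>u. u \<in> ltensor sL E \<Longrightarrow> \<exists>v\<in>ltensor sL G. amplify sL E \<tau> v = u \<and> lnorm G v \<le> K * lnorm E u"
    and \<phi>: "Lb_le sL (MIN_space sL D) E \<phi> C"
  obtains \<psi> where "Lb_le sL (MIN_space sL D) G \<psi> (K * C)" "\<And>g. g \<in> carr D \<Longrightarrow> \<tau> (\<psi> g) = \<phi> g"
proof -
  have \<phi>l: "lin_op D E \<phi>" using Lb_leD(1)[OF \<phi>] by simp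
  define u where "u = amplify sL E \<phi> canon"
  have u: "u \<in> ltensor sL E" unfolding u_def by (rule amplify_in[OF \<phi>l canon_in])
  have "lnorm E u \<le> C * inj_norm sL D canon"
    using Lb_leD(2)[OF \<phi>, of canon] canon_in by (simp add: u_def)
  also have "\<dots> \<le> C * 1" by (intro mult_left_mono inj_norm_canon C)
  finally have uC: "lnorm E u \<le> C" by simp
  obtain v where v: "v \<in> ltensor sL G" "amplify sL E \<tau> v = u" "lnorm G v \<le> K * lnorm E u"
    using lift[OF u] by blast
  obtain \<psi> where \<psi>: "lin_op D G \<psi>" "amplify sL G \<psi> canon = act sL G p v"
    using operator_of_tensor[OF L_spaceD(1)[OF G] v(1)] .
  have "lnorm G (act sL G p v) \<le> onorm p * lnorm G v" by (rule L_spaceD(6)[OF G p(1) v(1)])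
  also have "\<dots> \<le> 1 * lnorm G v"
    using p(3) by (intro mult_right_mono onorm_bound L_spaceD(2)[OF G v(1)]) auto
  also have "\<dots> \<le> K * C" using v(3) mult_left_mono[OF uC K] by simp
  finally have "lnorm G (act sL G p v) \<le> K * C" .
  then have "Lb_le sL (MIN_space sL D) G \<psi> (K * C)"
    using Lb_le_MIN[OF \<psi>(1) G] unfolding \<psi>(2) by (rule Lb_le_mono[OF _ _ L_space_MIN, rotated])
  moreover have "\<tau> (\<psi> g) = \<phi> g" if g: "g \<in> carr D" for g
  proof (rule operator_eqI[OF L_spaceD(1)[OF E] lin_op_comp[OF \<psi>(1) \<tau>] \<phi>l _ g])
    have "amplify sL E (\<lambda>x. \<tau> (\<psi> x)) canon = amplify sL E \<tau> (amplify sL G \<psi> canon)"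
      by (rule amplify_comp[OF \<psi>(1) \<tau> canon_in, symmetric])
    also have "\<dots> = act sL E p u"
      unfolding \<psi>(2) by (simp only: amplify_act[OF \<tau> p_linear v(1)] v(2))
    also have "\<dots> = amplify sL E \<phi> (act sL D p canon)"
      unfolding u_def by (rule amplify_act[OF \<phi>l p_linear canon_in, symmetric])
    finally show "amplify sL E (\<lambda>x. \<tau> (\<psi> x)) canon = amplify sL E \<phi> canon" by (simp only: act_p_canon)
  qed
  ultimately show thesis by (rule that)
qed

context normed_space_over
begin

abbreviation MIN_dual :: "'l set \<Rightarrow> ('k, 'l \<Rightarrow> 'k, 'l) lsp" where
  "MIN_dual Z \<equiv> MIN_space sL (dual (sub_nsp sL Z))"

lemma l1_sum_MIN_dual:
  assumes "\<And>\<mu>. \<mu> \<in> M \<Longrightarrow> fin_dim sL (Z \<mu>) \<and> contractively_complemented sL (Z \<mu>)"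
  shows "l1_sum sL M (\<lambda>\<mu>. MIN_dual (Z \<mu>))"
proof (rule l1_sum.intro)
  show "vector_space (smul (MIN_dual (Z \<mu>)))" for \<mu> by (simp add: dual_simps(1) vector_space_pscale)
  show "L_space sL (MIN_dual (Z \<mu>))" if \<mu>: "\<mu> \<in> M" for \<mu>
  proof -
    obtain p S fs where "fd_complemented sL (Z \<mu>) p S fs"
      using fd_complemented_exists[of "Z \<mu>"] assms[OF \<mu>] by blast
    then show ?thesis by (rule fd_complemented.L_space_MIN)
  qed
qed

lemma L_space_well_composed:
  assumes "well_composed sL W"
  shows "L_space sL W"
proof -
  obtain M Z where Z: "\<And>\<mu>. \<mu> \<in> M \<Longrightarrow> fin_dim sL (Z \<mu>) \<and> contractively_complemented sL (Z \<mu>)"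
    and W: "W = oplus1 sL M (\<lambda>\<mu>. MIN_dual (Z \<mu>))" using assms unfolding well_composed_def by blast
  show ?thesis unfolding W by (rule l1_sum.L_space_W[OF l1_sum_MIN_dual[OF Z]])
qed

text \<open>The inclusions of the summands are isometric, so each restriction of \<phi> has the
  bound \<open>C\<close> and lifts with the same constant \<open>K * C\<close>; a uniform bound is
  what \<open>glue\<close> asks for.\<close>

lemma lift_well_composed:
  assumes W: "well_composed sL W"
    and G: "L_space sL G" and E: "L_space sL E" and \<tau>: "lin_op G E \<tau>" and K: "K \<ge> 0" and C: "C \<ge> 0"
    and lift: "\<And>u. u \<in> ltensor sL E \<Longrightarrow> \<exists>v\<in>ltensor sL G. amplify sL E \<tau> v = u \<and> lnorm G v \<le> K * lnorm E u"
    and \<phi>: "Lb_le sL W E \<phi> C"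
  obtains \<psi> where "Lb_le sL W G \<psi> (K * C)" "\<And>x. x \<in> carr W \<Longrightarrow> \<tau> (\<psi> x) = \<phi> x"
proof -
  obtain M Z where Z: "\<And>\<mu>. \<mu> \<in> M \<Longrightarrow> fin_dim sL (Z \<mu>) \<and> contractively_complemented sL (Z \<mu>)"
    and W_eq: "W = oplus1 sL M (\<lambda>\<mu>. MIN_dual (Z \<mu>))" using W unfolding well_composed_def by blast
  interpret l1_sum sL M "\<lambda>\<mu>. MIN_dual (Z \<mu>)" by (rule l1_sum_MIN_dual[OF Z])
  have lsW: "linear_space W" unfolding W_eq by (rule linear_space_W)
  have \<phi>l: "lin_op W E \<phi>" using \<phi> by (rule Lb_leD)
  have "\<exists>\<psi>. Lb_le sL (MIN_dual (Z \<mu>)) G \<psi> (K * C) \<and>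
      (\<forall>g\<in>carr (MIN_dual (Z \<mu>)). \<tau> (\<psi> g) = \<phi> (inc \<mu> g))" if \<mu>: "\<mu> \<in> M" for \<mu>
  proof -
    obtain p S fs where "fd_complemented sL (Z \<mu>) p S fs"
      using fd_complemented_exists[of "Z \<mu>"] Z[OF \<mu>] by blast
    then interpret fd: fd_complemented sL "Z \<mu>" p S fs .
    have "Lb_le sL (MIN_dual (Z \<mu>)) W (inc \<mu>) 1"
      unfolding Lb_le_def W_eq using inc_lin[OF \<mu>] lnorm_inc[OF \<mu>] by simp
    from Lb_le_comp[OF this \<phi> C] have "Lb_le sL (MIN_dual (Z \<mu>)) E (\<lambda>x. \<phi> (inc \<mu> x)) C" by simp
    from fd.lift_MIN[OF G E \<tau> K C lift this] show ?thesis by (metis MIN_space_simps(1))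
  qed
  then obtain \<psi> where \<psi>: "\<And>\<mu>. \<mu> \<in> M \<Longrightarrow> Lb_le sL (MIN_dual (Z \<mu>)) G (\<psi> \<mu>) (K * C)"
    "\<And>\<mu> g. \<mu> \<in> M \<Longrightarrow> g \<in> carr (MIN_dual (Z \<mu>)) \<Longrightarrow> \<tau> (\<psi> \<mu> g) = \<phi> (inc \<mu> g)" by metis
  obtain \<theta> where \<theta>: "Lb_le sL W G \<theta> (K * C)"
    "\<And>\<mu> x. \<mu> \<in> M \<Longrightarrow> x \<in> carr (MIN_dual (Z \<mu>)) \<Longrightarrow> \<theta> (inc \<mu> x) = \<psi> \<mu> x"
    using glue[OF G mult_nonneg_nonneg[OF K C] \<psi>(1)] unfolding W_eq by blast
  have "\<tau> (\<theta> x) = \<phi> x" if x: "x \<in> carr W" for x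
  proof -
    define A where "A = {\<mu>. x \<mu> \<noteq> 0}"
    have A: "finite A" "A \<subseteq> M" "\<And>\<mu>. \<mu> \<in> M \<Longrightarrow> x \<mu> \<in> carr (MIN_dual (Z \<mu>))"
      using x[unfolded W_eq carr_W] by (auto simp: A_def)
    have i: "inc \<mu> (x \<mu>) \<in> carr W" if "\<mu> \<in> A" for \<mu>
      unfolding W_eq using that A by (intro lin_opD(1)[OF inc_lin]) auto
    have xs: "x = (\<Sum>\<mu>\<in>A. inc \<mu> (x \<mu>))" by (rule carr_expand) (auto simp: A(1) A_def[symmetric])
    have \<tau>\<theta>: "lin_op W E (\<lambda>x. \<tau> (\<theta> x))" by (rule lin_op_comp[OF Lb_leD(1)[OF \<theta>(1)] \<tau>])
    have "\<tau> (\<theta> x) = (\<Sum>\<mu>\<in>A. \<tau> (\<theta> (inc \<mu> (x \<mu>))))"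
      using lin_on_sum[OF lsW lin_opD(4)[OF \<tau>\<theta>], of A "\<lambda>\<mu>. inc \<mu> (x \<mu>)"] i xs by simp
    also have "\<dots> = (\<Sum>\<mu>\<in>A. \<phi> (inc \<mu> (x \<mu>)))"
      using A by (intro sum.cong refl) (simp add: \<theta>(2) \<psi>(2) subset_iff)
    also have "\<dots> = \<phi> x"
      using lin_on_sum[OF lsW lin_opD(4)[OF \<phi>l], of A "\<lambda>\<mu>. inc \<mu> (x \<mu>)"] i xs by simp
    finally show ?thesis .
  qed
  with \<theta>(1) show thesis by (rule that)
qed

section \<open>Projective spaces are retracts\<close>

text \<open>The left factors of a representation of u form the set A. This is how proper
  presentation enters: a complemented subspace containing A has a projection that fixes u.\<close>

lemma ltensor_finite_support:
  "u \<in> ltensor sL E \<Longrightarrow> \<exists>A. finite A \<and>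
     (\<forall>p. Vector_Spaces.linear sL sL p \<longrightarrow> (\<forall>\<xi>\<in>A. p \<xi> = \<xi>) \<longrightarrow> act sL E p u = u)"
proof (induction rule: ltensor_induct)
  case (elem \<xi> x)
  show ?case by (rule exI[of _ "{\<xi>}"]) (simp add: act_etensor elem)
next
  case (add u v)
  then obtain A B where "finite A" "finite B"
    "\<And>p. Vector_Spaces.linear sL sL p \<Longrightarrow> \<forall>\<xi>\<in>A. p \<xi> = \<xi> \<Longrightarrow> act sL E p u = u"
    "\<And>p. Vector_Spaces.linear sL sL p \<Longrightarrow> \<forall>\<xi>\<in>B. p \<xi> = \<xi> \<Longrightarrow> act sL E p v = v" by metis
  then show ?case by (intro exI[of _ "A \<union> B"]) (simp add: act_add)
qed (auto intro: exI[of _ "{}"])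

text \<open>The slice map f \<otimes> 1 from the tensor product to E, given by its value y, which is
  pinned down by the pairings with all algebraic functionals.\<close>

lemma tensor_slice:
  assumes E: "linear_space E" and f: "Vector_Spaces.linear sL (*) f" and u: "u \<in> ltensor sL E"
  shows "\<exists>y\<in>carr E. \<forall>h. lin_on E (*) h \<longrightarrow> u (\<lambda>\<xi> x. f \<xi> * h x) = h y"
  using u
proof (induction rule: ltensor_induct)
  case zero
  have "h 0 = 0" if "lin_on E (*) h" for h :: "_ \<Rightarrow> 'k" by (rule lin_on_0[OF E that])
  then show ?case by (intro bexI[of _ 0] linear_spaceD(3)[OF E]) (simp add: zero_fun_apply)
next
  case (elem \<xi> x)
  have "etensor sL E \<xi> x (\<lambda>\<xi> x. f \<xi> * h x) = h (smul E (f \<xi>) x)" if "lin_on E (*) h" for h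
    using that elem by (simp add: etensor_def tensor_functional_bilin[OF f] lin_on_def)
  then show ?case by (intro bexI[of _ "smul E (f \<xi>) x"] linear_spaceD(5)[OF E] elem) blast
next
  case (add u v)
  from add.IH obtain y z where y: "y \<in> carr E" "\<forall>h. lin_on E (*) h \<longrightarrow> u (\<lambda>\<xi> x. f \<xi> * h x) = h y"
    and z: "z \<in> carr E" "\<forall>h. lin_on E (*) h \<longrightarrow> v (\<lambda>\<xi> x. f \<xi> * h x) = h z"
    by (elim bexE)
  have "(u + v) (\<lambda>\<xi> x. f \<xi> * h x) = h (y + z)" if "lin_on E (*) h" for h
    using y z that by (simp add: plus_fun_apply lin_on_def)
  then show ?case using y(1) z(1) by (intro bexI[of _ "y + z"] linear_spaceD(4)[OF E]) blast+
qed

text \<open>Lift \<xi> \<otimes> x and slice the lifting by a functional with f \<xi> = 1: the slice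
  is a preimage of x. A nonzero \<xi> is essential, because over the zero base space all tensors
  vanish.\<close>

lemma surjective_of_amplify:
  assumes E: "linear_space E" and W: "linear_space W" and \<tau>: "lin_op W E \<tau>" and \<xi>: "\<xi> \<noteq> (0::'l)"
    and onto: "\<And>u. u \<in> ltensor sL E \<Longrightarrow> \<exists>v\<in>ltensor sL W. amplify sL E \<tau> v = u"
  shows "\<tau> ` carr W = carr E"
proof
  show "\<tau> ` carr W \<subseteq> carr E" using lin_opD(1)[OF \<tau>] by blast
  show "carr E \<subseteq> \<tau> ` carr W"
  proof
    fix x assume x: "x \<in> carr E"
    obtain f0 where f0: "Vector_Spaces.linear sL (*) f0" "norm (f0 \<xi>) = norm \<xi>"
      using norming_functional[of \<xi>] by blast
    define f where "f \<eta> = inverse (f0 \<xi>) * f0 \<eta>" for \<eta>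
    have "f0 \<xi> \<noteq> 0" using f0(2) \<xi> by auto
    then have f1: "f \<xi> = 1" by (simp add: f_def)
    have f: "Vector_Spaces.linear sL (*) f"
      using f0(1) by (simp add: linear_functional_iff f_def algebra_simps)
    obtain v where v: "v \<in> ltensor sL W" "amplify sL E \<tau> v = etensor sL E \<xi> x"
      using onto[OF etensor_in[OF x]] by blast
    obtain y where y: "y \<in> carr W" "\<forall>h. lin_on W (*) h \<longrightarrow> v (\<lambda>\<xi> x. f \<xi> * h x) = h y"
      using tensor_slice[OF W f v(1)] by blast
    have "x = \<tau> y"
    proof (rule ccontr)
      assume "x \<noteq> \<tau> y"
      then obtain h where h: "Vector_Spaces.linear (smul E) (*) h" "h x \<noteq> (h (\<tau> y) :: 'k)"
        using exists_separating_functional[OF linear_spaceD(1)[OF E]] by blast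
      have hE: "lin_on E (*) h" using h(1) by (simp add: lin_on_def Vector_Spaces.linear_iff)
      have hW: "lin_on W (*) (\<lambda>x. h (\<tau> x))"
        using h(1) lin_opD[OF \<tau>] by (simp add: lin_on_def Vector_Spaces.linear_iff)
      have b: "(\<lambda>\<xi> x. f \<xi> * h x) \<in> bilin sL E" by (rule tensor_functional_bilin[OF f hE])
      have "h x = etensor sL E \<xi> x (\<lambda>\<xi> x. f \<xi> * h x)" using b f1 by (simp add: etensor_def)
      also have "\<dots> = v (\<lambda>\<xi> x. f \<xi> * h (\<tau> x))" unfolding v(2)[symmetric] using b by (simp add: amplify_def)
      also have "\<dots> = h (\<tau> y)" using y(2) hW by blast
      finally show False using h(2) by simp
    qed
    then show "x \<in> \<tau> ` carr W" using y(1) by blast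
  qed
qed

text \<open>For each tensor u of the closed unit ball, a summand is chosen whose canonical tensor is
  sent to u. Since that canonical tensor has norm at most 1, u is hit from the closed unit ball, and
  homogeneity gives exact liftings of all tensors.\<close>

lemma well_composed_cover:
  fixes E :: "('k, 'e::ab_group_add, 'l) lsp"
  assumes pp: "properly_presented sL {Z. fin_dim sL Z \<and> contractively_complemented sL Z}"
    and E: "L_space sL E"
  obtains W :: "('k, ('k, 'e, 'l) tensor \<Rightarrow> 'l \<Rightarrow> 'k, 'l) lsp" and \<tau>
  where "well_composed sL W" "Lb_le sL W E \<tau> 1"
    "\<And>u. u \<in> ltensor sL E \<Longrightarrow> \<exists>v\<in>ltensor sL W. amplify sL E \<tau> v = u \<and> lnorm W v \<le> lnorm E u"
proof -
  \<comment> \<open>The index set is the unit ball itself, which fixes the index type of the well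
    composed space.\<close>
  define M where "M = L_cball sL E"
  have lE: "linear_space E" by (rule L_spaceD(1)[OF E])
  have "\<exists>Z p S fs. fin_dim sL Z \<and> contractively_complemented sL Z \<and> fd_complemented sL Z p S fs \<and> act sL E p u = u"
    if u: "u \<in> M" for u
  proof -
    obtain A where A: "finite A"
      "\<And>p. Vector_Spaces.linear sL sL p \<Longrightarrow> \<forall>\<xi>\<in>A. p \<xi> = \<xi> \<Longrightarrow> act sL E p u = u"
      using ltensor_finite_support[of u E] u by (auto simp: M_def L_cball_def)
    obtain Z where Z: "fin_dim sL Z" "contractively_complemented sL Z" "A \<subseteq> Z"
      using pp A(1) unfolding properly_presented_def by blast
    obtain p S fs where fd: "fd_complemented sL Z p S fs" using fd_complemented_exists[OF Z(1,2)] .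
    interpret fd: fd_complemented sL Z p S fs by (rule fd)
    have "act sL E p u = u" using Z(3) fd.p(2) by (intro A(2) fd.p_linear) blast
    with Z fd show ?thesis by blast
  qed
  then obtain Z p S fs where Z: "\<And>u. u \<in> M \<Longrightarrow> fin_dim sL (Z u) \<and> contractively_complemented sL (Z u)"
    and fd: "\<And>u. u \<in> M \<Longrightarrow> fd_complemented sL (Z u) (p u) (S u) (fs u)"
    and pu: "\<And>u. u \<in> M \<Longrightarrow> act sL E (p u) u = u" by metis
  interpret l1_sum sL M "\<lambda>\<mu>. MIN_dual (Z \<mu>)" by (rule l1_sum_MIN_dual[OF Z])
  define can where "can u = fd_complemented.canon sL (Z u) (S u) (fs u)" for u
  have "\<exists>\<phi>. Lb_le sL (MIN_dual (Z u)) E \<phi> 1 \<and> amplify sL E \<phi> (can u) = u" if u: "u \<in> M" for u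
  proof -
    interpret fd: fd_complemented sL "Z u" "p u" "S u" "fs u" by (rule fd[OF u])
    have u': "u \<in> ltensor sL E" "lnorm E u \<le> 1" using u by (auto simp: M_def L_cball_def)
    obtain \<phi> where \<phi>: "lin_op fd.D E \<phi>" "amplify sL E \<phi> fd.canon = act sL E (p u) u"
      using fd.operator_of_tensor[OF lE u'(1)] .
    have *: "amplify sL E \<phi> fd.canon = u" unfolding \<phi>(2) by (rule pu[OF u])
    have "Lb_le sL (MIN_dual (Z u)) E \<phi> 1"
      using Lb_le_mono[OF fd.Lb_le_MIN[OF \<phi>(1) E] _ fd.L_space_MIN, of 1] u'(2) by (simp add: *)
    with * show ?thesis by (auto simp: can_def)
  qed
  then obtain \<phi> where \<phi>: "\<And>u. u \<in> M \<Longrightarrow> Lb_le sL (MIN_dual (Z u)) E (\<phi> u) 1"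
    and \<phi>u: "\<And>u. u \<in> M \<Longrightarrow> amplify sL E (\<phi> u) (can u) = u" by metis
  obtain \<tau> where \<tau>: "Lb_le sL W E \<tau> 1"
    and \<tau>inc: "\<And>u x. u \<in> M \<Longrightarrow> x \<in> carr (MIN_dual (Z u)) \<Longrightarrow> \<tau> (inc u x) = \<phi> u x"
    using glue[OF E zero_le_one \<phi>] by blast
  have \<tau>l: "lin_op W E \<tau>" by (rule Lb_leD(1)[OF \<tau>])
  have "amplify sL E \<tau> ` L_cball sL W = L_cball sL E"
  proof
    show "amplify sL E \<tau> ` L_cball sL W \<subseteq> L_cball sL E"
      using Lb_leD(2)[OF \<tau>] amplify_in[OF \<tau>l] by (force simp: L_cball_def)
    show "L_cball sL E \<subseteq> amplify sL E \<tau> ` L_cball sL W"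
    proof
      fix u assume "u \<in> L_cball sL E"
      then have u: "u \<in> M" by (simp add: M_def)
      interpret fd: fd_complemented sL "Z u" "p u" "S u" "fs u" by (rule fd[OF u])
      have c: "can u \<in> ltensor sL (MIN_dual (Z u))" unfolding can_def using fd.canon_in by simp
      \<comment> \<open>The preimage of \<open>u\<close> is the canonical tensor in the summand with
        index \<open>u\<close>.\<close>
      define v where "v = amplify sL W (inc u) (can u)"
      have "amplify sL E \<tau> v = amplify sL E (\<lambda>x. \<tau> (inc u x)) (can u)"
        unfolding v_def by (rule amplify_comp[OF inc_lin[OF u] \<tau>l c])
      also have "\<dots> = amplify sL E (\<phi> u) (can u)"
        by (rule amplify_cong[OF lin_op_comp[OF inc_lin[OF u] \<tau>l] \<tau>inc[OF u] c ls[OF u]])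
      finally have "amplify sL E \<tau> v = u" by (simp only: \<phi>u[OF u])
      moreover have "v \<in> ltensor sL W" unfolding v_def by (rule amplify_in[OF inc_lin[OF u] c])
      moreover have "lnorm W v = lnorm (MIN_dual (Z u)) (can u)"
        unfolding v_def by (rule lnorm_inc[OF u c])
      then have "lnorm W v \<le> 1" using fd.inj_norm_canon by (simp add: can_def)
      ultimately show "u \<in> amplify sL E \<tau> ` L_cball sL W" by (auto simp: L_cball_def)
    qed
  qed
  with \<tau>l have "L_strictly_coisometric sL W E \<tau>" by (simp add: L_strictly_coisometric_def)
  then have "\<exists>v\<in>ltensor sL W. amplify sL E \<tau> v = u \<and> lnorm W v \<le> lnorm E u" if "u \<in> ltensor sL E" for u
    using L_strictly_coisometricD(2)[OF _ L_space_W E that] by blast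
  moreover have "well_composed sL W" unfolding well_composed_def using Z by blast
  ultimately show thesis using \<tau> that by blast
qed

text \<open>The operator \<phi> \<sigma> lifts on the well composed space, and composing the lifting
  with the right inverse \<rho> lifts \<phi> \<sigma> \<rho> = \<phi>. All constants are 1, so the
  norm does not grow.\<close>

lemma metrically_projective_retract:
  assumes P: "L_space sL P" and W: "well_composed sL W" and PW: "L_retract_of sL P W"
  shows "metrically_projective TYPE('g::ab_group_add) TYPE('e::ab_group_add) sL P"
  unfolding metrically_projective_def
proof (intro conjI P allI impI, elim conjE)
  fix G :: "('k, 'g, 'l) lsp" and E :: "('k, 'e, 'l) lsp" and \<tau> \<phi>
  assume G: "L_space sL G" and E: "L_space sL E" and \<tau>: "L_strictly_coisometric sL G E \<tau>"
    and \<phi>: "L_bounded sL P E \<phi>"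
  have LW: "L_space sL W" by (rule L_space_well_composed[OF W])
  obtain \<sigma> \<rho> where \<sigma>: "Lb_le sL W P \<sigma> 1" and \<rho>: "Lb_le sL P W \<rho> 1" and \<sigma>\<rho>: "\<And>x. x \<in> carr P \<Longrightarrow> \<sigma> (\<rho> x) = x"
    using PW L_contractive_iff[OF LW P] L_contractive_iff[OF P LW]
    unfolding L_retract_of_def retraction_op_def right_inverse_def by blast
  define C where "C = Lb_norm sL P E \<phi>"
  have C: "Lb_le sL P E \<phi> C" "0 \<le> C" unfolding C_def by (rule Lb_le_Lb_norm[OF \<phi> P E])+
  note \<tau>' = L_strictly_coisometricD[OF \<tau> G E]
  have lift: "\<exists>v\<in>ltensor sL G. amplify sL E \<tau> v = u \<and> lnorm G v \<le> 1 * lnorm E u" if "u \<in> ltensor sL E" for u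
    using \<tau>'(2)[OF that] by simp
  obtain \<psi> where \<psi>: "Lb_le sL W G \<psi> (1 * (C * 1))" "\<And>x. x \<in> carr W \<Longrightarrow> \<tau> (\<psi> x) = \<phi> (\<sigma> x)"
    using lift_well_composed[OF W G E Lb_leD(1)[OF \<tau>'(1)] zero_le_one _ lift Lb_le_comp[OF \<sigma> C]] C(2) by auto
  have "Lb_le sL P G (\<lambda>x. \<psi> (\<rho> x)) (1 * (C * 1) * 1)" using C(2) by (intro Lb_le_comp[OF \<rho> \<psi>(1)]) simp
  then have b: "Lb_le sL P G (\<lambda>x. \<psi> (\<rho> x)) C" by simp
  have lift\<phi>: "lifting P \<tau> \<phi> (\<lambda>x. \<psi> (\<rho> x))"
    using \<psi>(2) \<sigma>\<rho> lin_opD(1)[OF Lb_leD(1)[OF \<rho>]] by (simp add: lifting_def)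
  have bd: "L_bounded sL P G (\<lambda>x. \<psi> (\<rho> x))" using b by (auto simp: L_bounded_iff)
  \<comment> \<open>The reverse inequality, needed for equality of norms: \<phi> is \<tau> after the
    lifting, and \<tau> is contractive.\<close>
  define C' where "C' = Lb_norm sL P G (\<lambda>x. \<psi> (\<rho> x))"
  have C': "Lb_le sL P G (\<lambda>x. \<psi> (\<rho> x)) C'" "0 \<le> C'" unfolding C'_def by (rule Lb_le_Lb_norm[OF bd P G])+
  have "Lb_le sL P E (\<lambda>x. \<tau> (\<psi> (\<rho> x))) (1 * C')" by (rule Lb_le_comp[OF C'(1) \<tau>'(1)]) simp
  then have le: "lnorm E (amplify sL E (\<lambda>x. \<tau> (\<psi> (\<rho> x))) u) \<le> C' * lnorm P u" if "u \<in> ltensor sL P" for u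
    using Lb_leD(2)[OF _ that] by fastforce
  have "amplify sL E \<phi> u = amplify sL E (\<lambda>x. \<tau> (\<psi> (\<rho> x))) u" if "u \<in> ltensor sL P" for u
    using lift\<phi> by (intro amplify_cong[OF Lb_leD(1)[OF C(1)] _ that L_spaceD(1)[OF P]]) (simp add: lifting_def)
  then have "Lb_le sL P E \<phi> C'"
    using le Lb_leD(1)[OF C(1)] by (simp add: Lb_le_def)
  then have "C \<le> C'" unfolding C_def by (rule Lb_norm_le[OF _ C'(2) P])
  moreover have "C' \<le> C" unfolding C'_def by (rule Lb_norm_le[OF b C(2) P])
  ultimately have "C' = C" by simp
  then show "\<exists>\<psi>. L_bounded sL P G \<psi> \<and> lifting P \<tau> \<phi> \<psi> \<and> Lb_norm sL P G \<psi> = Lb_norm sL P E \<phi>"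
    using bd lift\<phi> unfolding C_def C'_def by blast
qed

lemma extremely_projective_near_retract:
  assumes P: "L_space sL P" and W: "well_composed sL W" and PW: "L_near_retract_of sL P W"
  shows "extremely_projective TYPE('g::ab_group_add) TYPE('e::ab_group_add) sL P"
  unfolding extremely_projective_def
proof (intro conjI P allI impI, elim conjE)
  fix G :: "('k, 'g, 'l) lsp" and E :: "('k, 'e, 'l) lsp" and \<tau> \<phi> and \<epsilon> :: real
  assume G: "L_space sL G" and E: "L_space sL E" and \<tau>: "L_coisometric sL G E \<tau>"
    and \<phi>: "L_bounded sL P E \<phi>" and \<epsilon>: "\<epsilon> > 0"
  have LW: "L_space sL W" by (rule L_space_well_composed[OF W])
  define C where "C = Lb_norm sL P E \<phi>"
  have C: "Lb_le sL P E \<phi> C" "0 \<le> C" unfolding C_def by (rule Lb_le_Lb_norm[OF \<phi> P E])+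
  \<comment> \<open>A factor 1 + \<delta> is lost in the lifting and another in the right inverse.
    The excess \<delta> C (2 + \<delta>) is at most 3 \<delta> C since \<delta> \<le> 1, and this is
    below \<epsilon>; \<open>C + 1\<close> keeps the quotient meaningful for
    \<open>C = 0\<close>.\<close>
  define \<delta> where "\<delta> = min 1 (\<epsilon> / (4 * (C + 1)))"
  have \<delta>: "0 < \<delta>" "\<delta> \<le> 1" "\<delta> * (4 * (C + 1)) \<le> \<epsilon>"
  proof -
    show "0 < \<delta>" "\<delta> \<le> 1" using C(2) \<epsilon> by (auto simp: \<delta>_def)
    have "\<delta> \<le> \<epsilon> / (4 * (C + 1))" by (simp add: \<delta>_def)
    then show "\<delta> * (4 * (C + 1)) \<le> \<epsilon>" using C(2) by (subst (asm) pos_le_divide_eq) auto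
  qed
  have "(1 + \<delta>) * C * (1 + \<delta>) = C + \<delta> * (C * (2 + \<delta>))" by (simp add: algebra_simps)
  also have "\<delta> * (C * (2 + \<delta>)) \<le> \<delta> * (C * 3)" using C(2) \<delta> by (intro mult_left_mono) auto
  also have "\<dots> < \<delta> * (4 * (C + 1))" using C(2) \<delta> by (intro mult_strict_left_mono) auto
  finally have small: "(1 + \<delta>) * C * (1 + \<delta>) < C + \<epsilon>" using \<delta>(3) by simp
  obtain \<sigma> where \<sigma>: "Lb_le sL W P \<sigma> 1"
    and near: "\<And>\<epsilon>. \<epsilon> > 0 \<Longrightarrow> \<exists>\<rho>. L_bounded sL P W \<rho> \<and> right_inverse P \<sigma> \<rho> \<and> Lb_norm sL P W \<rho> < 1 + \<epsilon>"
    using PW L_contractive_iff[OF LW P] unfolding L_near_retract_of_def near_retraction_op_def by blast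
  obtain \<rho> where \<rho>: "L_bounded sL P W \<rho>" "Lb_norm sL P W \<rho> < 1 + \<delta>"
    and \<sigma>\<rho>: "\<And>x. x \<in> carr P \<Longrightarrow> \<sigma> (\<rho> x) = x"
    using near[OF \<delta>(1)] unfolding right_inverse_def by blast
  have \<rho>': "Lb_le sL P W \<rho> (1 + \<delta>)"
    using Lb_le_mono[OF Lb_le_Lb_norm(1)[OF \<rho>(1) P LW] _ P, of "1 + \<delta>"] \<rho>(2) by simp
  have \<tau>l: "lin_op G E \<tau>" using \<tau> by (simp add: L_coisometric_def)
  have \<delta>1: "0 \<le> 1 + \<delta>" using \<delta> by simp
  obtain \<psi> where \<psi>: "Lb_le sL W G \<psi> ((1 + \<delta>) * (C * 1))" "\<And>x. x \<in> carr W \<Longrightarrow> \<tau> (\<psi> x) = \<phi> (\<sigma> x)"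
    using lift_well_composed[OF W G E \<tau>l \<delta>1 _ L_coisometricD[OF \<tau> G E _ \<delta>(1)] Lb_le_comp[OF \<sigma> C]] C(2) by auto
  have n: "0 \<le> (1 + \<delta>) * C" using C(2) \<delta>1 by simp
  have b: "Lb_le sL P G (\<lambda>x. \<psi> (\<rho> x)) ((1 + \<delta>) * C * (1 + \<delta>))"
    using Lb_le_comp[OF \<rho>' \<psi>(1)] n by simp
  have "Lb_norm sL P G (\<lambda>x. \<psi> (\<rho> x)) \<le> (1 + \<delta>) * C * (1 + \<delta>)"
    by (rule Lb_norm_le[OF b mult_nonneg_nonneg[OF n \<delta>1] P])
  with small have "Lb_norm sL P G (\<lambda>x. \<psi> (\<rho> x)) < Lb_norm sL P E \<phi> + \<epsilon>" unfolding C_def by linarith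
  moreover have "lifting P \<tau> \<phi> (\<lambda>x. \<psi> (\<rho> x))"
    using \<psi>(2) \<sigma>\<rho> lin_opD(1)[OF L_bounded_def[THEN iffD1, THEN conjunct1, OF \<rho>(1)]] by (simp add: lifting_def)
  moreover have "L_bounded sL P G (\<lambda>x. \<psi> (\<rho> x))" using b by (auto simp: L_bounded_iff)
  ultimately show "\<exists>\<psi>. L_bounded sL P G \<psi> \<and> lifting P \<tau> \<phi> \<psi> \<and> Lb_norm sL P G \<psi> < Lb_norm sL P E \<phi> + \<epsilon>"
    by blast
qed

text \<open>The identity of \<open>P\<close> is lifted along the cover. The test types of
  projectivity are those of this single problem: functions on tensors for the covering space, and
  the type of \<open>P\<close>.\<close>

lemma retract_metrically_projective:
  fixes P :: "('k, 'p::ab_group_add, 'l) lsp"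
  assumes pp: "properly_presented sL {Z. fin_dim sL Z \<and> contractively_complemented sL Z}"
    and MP: "metrically_projective TYPE(('k, 'p, 'l) tensor \<Rightarrow> 'l \<Rightarrow> 'k) TYPE('p) sL P"
  obtains W :: "('k, ('k, 'p, 'l) tensor \<Rightarrow> 'l \<Rightarrow> 'k, 'l) lsp"
  where "well_composed sL W" "L_retract_of sL P W"
proof -
  have P: "L_space sL P" using MP by (simp add: metrically_projective_def)
  obtain W :: "('k, ('k, 'p, 'l) tensor \<Rightarrow> 'l \<Rightarrow> 'k, 'l) lsp" and \<tau>
    where W: "well_composed sL W" and \<tau>: "Lb_le sL W P \<tau> 1"
    and onto: "\<And>u. u \<in> ltensor sL P \<Longrightarrow> \<exists>v\<in>ltensor sL W. amplify sL P \<tau> v = u \<and> lnorm W v \<le> lnorm P u"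
    using well_composed_cover[OF pp P] by blast
  have LW: "L_space sL W" by (rule L_space_well_composed[OF W])
  have "L_strictly_coisometric sL W P \<tau>" by (rule L_coisometricI(1)[OF \<tau> onto])
  moreover have "L_bounded sL P P (\<lambda>x. x)" using Lb_le_id by (auto simp: L_bounded_iff)
  ultimately obtain \<psi> where \<psi>: "L_bounded sL P W \<psi>" "lifting P \<tau> (\<lambda>x. x) \<psi>"
    "Lb_norm sL P W \<psi> = Lb_norm sL P P (\<lambda>x. x)"
    using MP LW P unfolding metrically_projective_def by blast
  have "Lb_norm sL P P (\<lambda>x. x) \<le> 1" by (rule Lb_norm_le[OF Lb_le_id zero_le_one P])
  then have "L_contractive sL P W \<psi>" using \<psi> by (simp add: L_contractive_def)
  moreover have "right_inverse P \<tau> \<psi>" using \<psi>(2) by (simp add: right_inverse_def lifting_def)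
  ultimately have "L_retract_of sL P W"
    using \<tau> L_contractive_iff[OF LW P] unfolding L_retract_of_def retraction_op_def by blast
  with W show thesis by (rule that)
qed

text \<open>The cover is chosen once, before \<epsilon>, as a near-retraction requires; only the
  lifting of the identity varies with \<epsilon>.\<close>

lemma near_retract_extremely_projective:
  fixes P :: "('k, 'p::ab_group_add, 'l) lsp"
  assumes pp: "properly_presented sL {Z. fin_dim sL Z \<and> contractively_complemented sL Z}"
    and EP: "extremely_projective TYPE(('k, 'p, 'l) tensor \<Rightarrow> 'l \<Rightarrow> 'k) TYPE('p) sL P"
  obtains W :: "('k, ('k, 'p, 'l) tensor \<Rightarrow> 'l \<Rightarrow> 'k, 'l) lsp"
  where "well_composed sL W" "L_near_retract_of sL P W"
proof -
  have P: "L_space sL P" using EP by (simp add: extremely_projective_def)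
  obtain W :: "('k, ('k, 'p, 'l) tensor \<Rightarrow> 'l \<Rightarrow> 'k, 'l) lsp" and \<tau>
    where W: "well_composed sL W" and \<tau>: "Lb_le sL W P \<tau> 1"
    and onto: "\<And>u. u \<in> ltensor sL P \<Longrightarrow> \<exists>v\<in>ltensor sL W. amplify sL P \<tau> v = u \<and> lnorm W v \<le> lnorm P u"
    using well_composed_cover[OF pp P] by blast
  have LW: "L_space sL W" by (rule L_space_well_composed[OF W])
  have co: "L_coisometric sL W P \<tau>" by (rule L_coisometricI(2)[OF \<tau> onto])
  have idP: "L_bounded sL P P (\<lambda>x. x)" "Lb_norm sL P P (\<lambda>x. x) \<le> 1"
    using Lb_le_id by (auto simp: L_bounded_iff intro: Lb_norm_le[OF Lb_le_id zero_le_one P])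
  have "\<exists>\<rho>. L_bounded sL P W \<rho> \<and> right_inverse P \<tau> \<rho> \<and> Lb_norm sL P W \<rho> < 1 + \<epsilon>" if \<epsilon>: "\<epsilon> > 0" for \<epsilon>
  proof -
    obtain \<psi> where \<psi>: "L_bounded sL P W \<psi>" "lifting P \<tau> (\<lambda>x. x) \<psi>"
      "Lb_norm sL P W \<psi> < Lb_norm sL P P (\<lambda>x. x) + \<epsilon>"
      using EP LW P co idP(1) \<epsilon> unfolding extremely_projective_def by blast
    then show ?thesis using idP(2) by (intro exI[of _ \<psi>]) (simp add: right_inverse_def lifting_def)
  qed
  then have "L_near_retract_of sL P W"
    using \<tau> L_contractive_iff[OF LW P] unfolding L_near_retract_of_def near_retraction_op_def by blast
  with W show thesis by (rule that)
qed

text \<open>A strictly coisometric operator is by definition onto at the level of tensors. The last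
  clause adds that it is onto E itself, which tensors can detect only over a nonzero base
  space.\<close>

lemma strictly_coisometric_cover:
  fixes E :: "('k, 'e::ab_group_add, 'l) lsp"
  assumes pp: "properly_presented sL {Z. fin_dim sL Z \<and> contractively_complemented sL Z}"
    and E: "L_space sL E"
  obtains W :: "('k, ('k, 'e, 'l) tensor \<Rightarrow> 'l \<Rightarrow> 'k, 'l) lsp" and \<tau>
  where "well_composed sL W" "L_strictly_coisometric sL W E \<tau>"
    "(UNIV :: 'l set) \<noteq> {0} \<longrightarrow> \<tau> ` carr W = carr E"
proof -
  obtain W :: "('k, ('k, 'e, 'l) tensor \<Rightarrow> 'l \<Rightarrow> 'k, 'l) lsp" and \<tau>
    where W: "well_composed sL W" and \<tau>: "Lb_le sL W E \<tau> 1"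
    and onto: "\<And>u. u \<in> ltensor sL E \<Longrightarrow> \<exists>v\<in>ltensor sL W. amplify sL E \<tau> v = u \<and> lnorm W v \<le> lnorm E u"
    using well_composed_cover[OF pp E] by blast
  have LW: "L_space sL W" by (rule L_space_well_composed[OF W])
  have "\<tau> ` carr W = carr E" if ne: "(UNIV :: 'l set) \<noteq> {0}"
  proof -
    have "\<exists>\<xi> :: 'l. \<xi> \<noteq> 0" using ne by auto
    then obtain \<xi> :: 'l where "\<xi> \<noteq> 0" ..
    then show ?thesis
      by (rule surjective_of_amplify[OF L_spaceD(1)[OF E] L_spaceD(1)[OF LW] Lb_leD(1)[OF \<tau>]])
        (use onto in blast)
  qed
  then show thesis by (intro that[OF W L_coisometricI(1)[OF \<tau> onto]] impI)
qed

end

theorem theorem3p7: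
  fixes sL :: "'k::real_or_complex \<Rightarrow> 'l::real_normed_vector \<Rightarrow> 'l"
  assumes "normed_space_over sL"
  shows
    "(\<forall>(P :: ('k, 'p::ab_group_add, 'l) lsp) (W :: ('k, 'i \<Rightarrow> 'l \<Rightarrow> 'k, 'l) lsp).
        L_space sL P \<and> well_composed sL W \<longrightarrow>
          (L_retract_of sL P W \<longrightarrow>
             metrically_projective TYPE('g::ab_group_add) TYPE('e::ab_group_add) sL P) \<and>
          (L_near_retract_of sL P W \<longrightarrow>
             extremely_projective TYPE('g) TYPE('e) sL P)) \<and>
     (properly_presented sL {Z. fin_dim sL Z \<and> contractively_complemented sL Z} \<longrightarrow>
        (\<forall>P :: ('k, 'p, 'l) lsp.
          (metrically_projective TYPE(('k, 'p, 'l) tensor \<Rightarrow> 'l \<Rightarrow> 'k) TYPE('p) sL P \<longrightarrow>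
             (\<exists>W :: ('k, ('k, 'p, 'l) tensor \<Rightarrow> 'l \<Rightarrow> 'k, 'l) lsp.
                well_composed sL W \<and> L_retract_of sL P W)) \<and>
          (extremely_projective TYPE(('k, 'p, 'l) tensor \<Rightarrow> 'l \<Rightarrow> 'k) TYPE('p) sL P \<longrightarrow>
             (\<exists>W :: ('k, ('k, 'p, 'l) tensor \<Rightarrow> 'l \<Rightarrow> 'k, 'l) lsp.
                well_composed sL W \<and> L_near_retract_of sL P W)))) \<and>
     (properly_presented sL {Z. fin_dim sL Z \<and> contractively_complemented sL Z} \<longrightarrow>
        (\<forall>E :: ('k, 'p, 'l) lsp. L_space sL E \<longrightarrow>
          (\<exists>(W :: ('k, ('k, 'p, 'l) tensor \<Rightarrow> 'l \<Rightarrow> 'k, 'l) lsp) \<tau>.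
             well_composed sL W \<and> L_strictly_coisometric sL W E \<tau> \<and>
             ((UNIV :: 'l set) \<noteq> {0} \<longrightarrow> \<tau> ` carr W = carr E))))"
proof -
  interpret normed_space_over sL by fact
  show ?thesis
  proof (intro conjI allI impI)
    fix P :: "('k, 'p, 'l) lsp" and W :: "('k, 'i \<Rightarrow> 'l \<Rightarrow> 'k, 'l) lsp"
    assume PW: "L_space sL P \<and> well_composed sL W"
    show "metrically_projective TYPE('g) TYPE('e) sL P" if "L_retract_of sL P W"
      using metrically_projective_retract[OF conjunct1[OF PW] conjunct2[OF PW] that] .
    show "extremely_projective TYPE('g) TYPE('e) sL P" if "L_near_retract_of sL P W"
      using extremely_projective_near_retract[OF conjunct1[OF PW] conjunct2[OF PW] that] .
  next
    assume pp: "properly_presented sL {Z. fin_dim sL Z \<and> contractively_complemented sL Z}"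
    fix P :: "('k, 'p, 'l) lsp"
    show "\<exists>W :: ('k, ('k, 'p, 'l) tensor \<Rightarrow> 'l \<Rightarrow> 'k, 'l) lsp. well_composed sL W \<and> L_retract_of sL P W"
      if "metrically_projective TYPE(('k, 'p, 'l) tensor \<Rightarrow> 'l \<Rightarrow> 'k) TYPE('p) sL P"
      using retract_metrically_projective[OF pp that] by metis
    show "\<exists>W :: ('k, ('k, 'p, 'l) tensor \<Rightarrow> 'l \<Rightarrow> 'k, 'l) lsp. well_composed sL W \<and> L_near_retract_of sL P W"
      if "extremely_projective TYPE(('k, 'p, 'l) tensor \<Rightarrow> 'l \<Rightarrow> 'k) TYPE('p) sL P"
      using near_retract_extremely_projective[OF pp that] by metis
  next
    assume pp: "properly_presented sL {Z. fin_dim sL Z \<and> contractively_complemented sL Z}"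
    fix E :: "('k, 'p, 'l) lsp"
    assume E: "L_space sL E"
    show "\<exists>(W :: ('k, ('k, 'p, 'l) tensor \<Rightarrow> 'l \<Rightarrow> 'k, 'l) lsp) \<tau>.
        well_composed sL W \<and> L_strictly_coisometric sL W E \<tau> \<and>
        ((UNIV :: 'l set) \<noteq> {0} \<longrightarrow> \<tau> ` carr W = carr E)"
      by (rule strictly_coisometric_cover[OF pp E]) (intro exI conjI)
  qed
qed

end
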